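(* Let $\Phi:\mathcal{L}(\mathcal{H})\to\mathcal{L}(\mathcal{K})$ be a quantum channel with $d_{\max}(\Phi)\leq3$. Then $\Phi$ admits a dominating transmittable algebra if and only if $\mathscr{A}_{\mathrm{cap}}(\Phi)$ is defined (i.e. $N_d(\Phi)\ge0$ for all $1\le d\le d_{\max}(\Phi)$) and transmittable via $\Phi$.
   Context: All Hilbert spaces are finite-dimensional and complex; all $C^*$-algebras are finite-dimensional and nonzero. $\mathcal{L}(\mathcal{H})$ is the algebra of linear operators on $\mathcal{H}$. A quantum channel is a linear, completely positive, trace-preserving map $\Phi:\mathcal{L}(\mathcal{H})\to\mathcal{L}(\mathcal{K})$; its adjoint $\Phi^*$ is defined by $\mathrm{Tr}(Y\Phi(X))=\mathrm{Tr}(\Phi^*(Y)X)$. Embedding: $\mathscr{A}\leq\mathscr{B}$ means there is an injective (not necessarily unital) $*$-homomorphism $\mathscr{A}\to\mathscr{B}$. Correctability: a $*$-subalgebra $\mathscr{A}\subseteq\mathcal{L}(\mathcal{H})$ with unit projection $P$ (possibly $P\neq 1_{\mathcal{H}}$) is correctable for $\Phi$ if, with $C=P\mathcal{H}$, $V:C\to\mathcal{H}$ the inclusion and $\Phi|_C(Y)=\Phi(VYV^* )$, there is a channel $\mathcal{D}:\mathcal{L}(\mathcal{K})\to\mathcal{L}(C)$ with $(\mathcal{D}\circ\Phi|_C)^*(X)=X$ for all $X\in V^*\mathscr{A}V$. $\mathscr{A}$ is transmittable via $\Phi$ if there is an injective $*$-homomorphism $\pi:\mathscr{A}\to\mathcal{L}(\mathcal{H})$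 whose image is correctable for $\Phi$; $\mathscr{T}(\Phi)$ is the set of transmittable algebras up to $*$-isomorphism. A dominating transmittable algebra is an element of $\mathscr{T}(\Phi)$ into which every element of $\mathscr{T}(\Phi)$ embeds. Hybrid capacities: $d_{\max}(\Phi)=\max\{d\in\mathbb{N}:\mathbb{M}_d(\mathbb{C})\in\mathscr{T}(\Phi)\}$, and for $1\le d\le d_{\max}(\Phi)$, $c_d(\Phi)=\max\{c\in\mathbb{N}:\mathbb{M}_d(\mathbb{C})^{\oplus c}\in\mathscr{T}(\Phi)\}$. Define integers recursively (descending in $d$) by $N_{d_{\max}(\Phi)}(\Phi)=c_{d_{\max}(\Phi)}(\Phi)$ and $$N_d(\Phi)=c_d(\Phi)-\sum_{m=d+1}^{d_{\max}(\Phi)}N_m(\Phi)\left\lfloor\frac{m}{d}\right\rfloor,\qquad 1\leq d<d_{\max}(\Phi).$$ When all $N_d(\Phi)\ge0$, the capacity algebra is defined as $\mathscr{A}_{\mathrm{cap}}(\Phi)=\bigoplus_{d=1}^{d_{\max}(\Phi)}\mathbb{M}_d(\mathbb{C})^{\oplus N_d(\Phi)}$, with summands of zero multiplicity omitted. *)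

theory Defs
  imports "Jordan_Normal_Form.Schur_Decomposition"
begin

(* A Hilbert space of dimension n is represented as C^n, so that L(C^n) is carrier_mat n n, with
   mat_adjoint as the involution.  The order on complex numbers is that of HOL-Library.Complex_Order:
   0 \<le> z says that z is real and nonnegative. *)

section \<open>Finite-dimensional C*-algebras\<close>

record 'a star_alg =
  elems :: "'a set"
  zero_alg :: "'a"
  add_alg :: "'a \<Rightarrow> 'a \<Rightarrow> 'a"
  scale_alg :: "complex \<Rightarrow> 'a \<Rightarrow> 'a"
  mult_alg :: "'a \<Rightarrow> 'a \<Rightarrow> 'a"
  star :: "'a \<Rightarrow> 'a"

definition is_star_algebra :: "'a star_alg \<Rightarrow> bool" where
  "is_star_algebra A \<longleftrightarrow>
     zero_alg A \<in> elems A \<and>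
     (\<forall>x\<in>elems A. \<forall>y\<in>elems A. add_alg A x y \<in> elems A \<and> mult_alg A x y \<in> elems A) \<and>
     (\<forall>c. \<forall>x\<in>elems A. scale_alg A c x \<in> elems A) \<and>
     (\<forall>x\<in>elems A. star A x \<in> elems A) \<and>
     (\<forall>x\<in>elems A. \<forall>y\<in>elems A. add_alg A x y = add_alg A y x) \<and>
     (\<forall>x\<in>elems A. \<forall>y\<in>elems A. \<forall>z\<in>elems A.
        add_alg A (add_alg A x y) z = add_alg A x (add_alg A y z)) \<and>
     (\<forall>x\<in>elems A. add_alg A (zero_alg A) x = x) \<and>
     (\<forall>x\<in>elems A. \<exists>y\<in>elems A. add_alg A x y = zero_alg A) \<and>
     (\<forall>x\<in>elems A. scale_alg A 1 x = x) \<and>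
     (\<forall>a b. \<forall>x\<in>elems A. scale_alg A a (scale_alg A b x) = scale_alg A (a * b) x) \<and>
     (\<forall>a b. \<forall>x\<in>elems A. scale_alg A (a + b) x = add_alg A (scale_alg A a x) (scale_alg A b x)) \<and>
     (\<forall>a. \<forall>x\<in>elems A. \<forall>y\<in>elems A.
        scale_alg A a (add_alg A x y) = add_alg A (scale_alg A a x) (scale_alg A a y)) \<and>
     (\<forall>x\<in>elems A. \<forall>y\<in>elems A. \<forall>z\<in>elems A.
        mult_alg A (mult_alg A x y) z = mult_alg A x (mult_alg A y z)) \<and>
     (\<forall>x\<in>elems A. \<forall>y\<in>elems A. \<forall>z\<in>elems A.
        mult_alg A (add_alg A x y) z = add_alg A (mult_alg A x z) (mult_alg A y z) \<and>
        mult_alg A z (add_alg A x y) = add_alg A (mult_alg A z x) (mult_alg A z y)) \<and>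
     (\<forall>a. \<forall>x\<in>elems A. \<forall>y\<in>elems A.
        mult_alg A (scale_alg A a x) y = scale_alg A a (mult_alg A x y) \<and>
        mult_alg A x (scale_alg A a y) = scale_alg A a (mult_alg A x y)) \<and>
     (\<forall>x\<in>elems A. star A (star A x) = x) \<and>
     (\<forall>x\<in>elems A. \<forall>y\<in>elems A. star A (add_alg A x y) = add_alg A (star A x) (star A y)) \<and>
     (\<forall>a. \<forall>x\<in>elems A. star A (scale_alg A a x) = scale_alg A (cnj a) (star A x)) \<and>
     (\<forall>x\<in>elems A. \<forall>y\<in>elems A. star A (mult_alg A x y) = mult_alg A (star A y) (star A x))"

definition is_cstar_norm :: "'a star_alg \<Rightarrow> ('a \<Rightarrow> real) \<Rightarrow> bool" where
  "is_cstar_norm A N \<longleftrightarrow>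
     (\<forall>x\<in>elems A. N x \<ge> 0 \<and> (N x = 0 \<longleftrightarrow> x = zero_alg A)) \<and>
     (\<forall>c. \<forall>x\<in>elems A. N (scale_alg A c x) = cmod c * N x) \<and>
     (\<forall>x\<in>elems A. \<forall>y\<in>elems A. N (add_alg A x y) \<le> N x + N y) \<and>
     (\<forall>x\<in>elems A. \<forall>y\<in>elems A. N (mult_alg A x y) \<le> N x * N y) \<and>
     (\<forall>x\<in>elems A. N (mult_alg A (star A x) x) = (N x)\<^sup>2)"

fun lin_comb :: "'a star_alg \<Rightarrow> (complex \<times> 'a) list \<Rightarrow> 'a" where
  "lin_comb A [] = zero_alg A"
| "lin_comb A ((c, b) # cbs) = add_alg A (scale_alg A c b) (lin_comb A cbs)"

definition finite_dimensional :: "'a star_alg \<Rightarrow> bool" where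
  "finite_dimensional A \<longleftrightarrow>
     (\<exists>bs. set bs \<subseteq> elems A \<and>
        (\<forall>x\<in>elems A. \<exists>cs. length cs = length bs \<and> x = lin_comb A (zip cs bs)))"

(* A C*-norm on a *-algebra is unique, and completeness is automatic in finite dimension; hence the
   norm is not part of the structure and only its existence is required. *)
definition fd_cstar_algebra :: "'a star_alg \<Rightarrow> bool" where
  "fd_cstar_algebra A \<longleftrightarrow>
     is_star_algebra A \<and> finite_dimensional A \<and> (\<exists>N. is_cstar_norm A N) \<and>
     elems A \<noteq> {zero_alg A}"

(* Neither the algebras nor the homomorphisms are required to be unital. *)
definition star_hom :: "'a star_alg \<Rightarrow> 'b star_alg \<Rightarrow> ('a \<Rightarrow> 'b) \<Rightarrow> bool" where
  "star_hom A B f \<longleftrightarrow>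
     (\<forall>x\<in>elems A. f x \<in> elems B) \<and>
     (\<forall>x\<in>elems A. \<forall>y\<in>elems A. f (add_alg A x y) = add_alg B (f x) (f y)) \<and>
     (\<forall>c. \<forall>x\<in>elems A. f (scale_alg A c x) = scale_alg B c (f x)) \<and>
     (\<forall>x\<in>elems A. \<forall>y\<in>elems A. f (mult_alg A x y) = mult_alg B (f x) (f y)) \<and>
     (\<forall>x\<in>elems A. f (star A x) = star B (f x))"

definition embeds :: "'a star_alg \<Rightarrow> 'b star_alg \<Rightarrow> bool" where
  "embeds A B \<longleftrightarrow> (\<exists>f. star_hom A B f \<and> inj_on f (elems A))"

definition matrix_alg :: "nat \<Rightarrow> complex mat star_alg" where
  "matrix_alg d = \<lparr> elems = carrier_mat d d, zero_alg = 0\<^sub>m d d, add_alg = (+),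
     scale_alg = (\<cdot>\<^sub>m), mult_alg = (*), star = mat_adjoint \<rparr>"

definition direct_sum :: "'a star_alg list \<Rightarrow> 'a list star_alg" where
  "direct_sum As =
     \<lparr> elems = {xs. length xs = length As \<and> (\<forall>i<length As. xs ! i \<in> elems (As ! i))},
       zero_alg = map zero_alg As,
       add_alg = (\<lambda>xs ys. map (\<lambda>i. add_alg (As ! i) (xs ! i) (ys ! i)) [0..<length As]),
       scale_alg = (\<lambda>c xs. map (\<lambda>i. scale_alg (As ! i) c (xs ! i)) [0..<length As]),
       mult_alg = (\<lambda>xs ys. map (\<lambda>i. mult_alg (As ! i) (xs ! i) (ys ! i)) [0..<length As]),
       star = (\<lambda>xs. map (\<lambda>i. star (As ! i) (xs ! i)) [0..<length As]) \<rparr>"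


section \<open>Quantum channels\<close>

definition mat_trace :: "complex mat \<Rightarrow> complex" where
  "mat_trace X = (\<Sum>i<dim_row X. X $$ (i, i))"

definition positive_semidefinite :: "nat \<Rightarrow> complex mat \<Rightarrow> bool" where
  "positive_semidefinite n X \<longleftrightarrow>
     X \<in> carrier_mat n n \<and> (\<forall>v\<in>carrier_vec n. 0 \<le> (X *\<^sub>v v) \<bullet>c v)"

definition linear_map :: "nat \<Rightarrow> nat \<Rightarrow> (complex mat \<Rightarrow> complex mat) \<Rightarrow> bool" where
  "linear_map n m \<Phi> \<longleftrightarrow>
     (\<forall>X\<in>carrier_mat n n. \<Phi> X \<in> carrier_mat m m) \<and>
     (\<forall>X\<in>carrier_mat n n. \<forall>Y\<in>carrier_mat n n. \<Phi> (X + Y) = \<Phi> X + \<Phi> Y) \<and>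
     (\<forall>c. \<forall>X\<in>carrier_mat n n. \<Phi> (c \<cdot>\<^sub>m X) = c \<cdot>\<^sub>m \<Phi> X)"

(* The map id \<otimes> \<Phi> on r \<times> r block matrices with blocks of size n, sending the block X_ij to \<Phi>(X_ij). *)
definition mat_block :: "nat \<Rightarrow> complex mat \<Rightarrow> nat \<Rightarrow> nat \<Rightarrow> complex mat" where
  "mat_block n X i j = mat n n (\<lambda>(a, b). X $$ (i * n + a, j * n + b))"

definition ampliation ::
    "nat \<Rightarrow> nat \<Rightarrow> nat \<Rightarrow> (complex mat \<Rightarrow> complex mat) \<Rightarrow> complex mat \<Rightarrow> complex mat" where
  "ampliation r n m \<Phi> X =
     mat (r * m) (r * m) (\<lambda>(a, b). \<Phi> (mat_block n X (a div m) (b div m)) $$ (a mod m, b mod m))"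

definition completely_positive :: "nat \<Rightarrow> nat \<Rightarrow> (complex mat \<Rightarrow> complex mat) \<Rightarrow> bool" where
  "completely_positive n m \<Phi> \<longleftrightarrow>
     (\<forall>r X. positive_semidefinite (r * n) X \<longrightarrow>
        positive_semidefinite (r * m) (ampliation r n m \<Phi> X))"

definition trace_preserving :: "nat \<Rightarrow> (complex mat \<Rightarrow> complex mat) \<Rightarrow> bool" where
  "trace_preserving n \<Phi> \<longleftrightarrow> (\<forall>X\<in>carrier_mat n n. mat_trace (\<Phi> X) = mat_trace X)"

definition channel :: "nat \<Rightarrow> nat \<Rightarrow> (complex mat \<Rightarrow> complex mat) \<Rightarrow> bool" where
  "channel n m \<Phi> \<longleftrightarrow> linear_map n m \<Phi> \<and> completely_positive n m \<Phi> \<and> trace_preserving n \<Phi>"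

definition adjoint_map :: "nat \<Rightarrow> (complex mat \<Rightarrow> complex mat) \<Rightarrow> complex mat \<Rightarrow> complex mat" where
  "adjoint_map n \<Phi> Y =
     (THE Z. Z \<in> carrier_mat n n \<and>
        (\<forall>X\<in>carrier_mat n n. mat_trace (Y * \<Phi> X) = mat_trace (Z * X)))"


section \<open>Correctable and transmittable algebras\<close>

definition star_subalgebra :: "nat \<Rightarrow> complex mat set \<Rightarrow> bool" where
  "star_subalgebra n S \<longleftrightarrow>
     S \<subseteq> carrier_mat n n \<and> 0\<^sub>m n n \<in> S \<and> S \<noteq> {0\<^sub>m n n} \<and>
     (\<forall>X\<in>S. \<forall>Y\<in>S. X + Y \<in> S \<and> X * Y \<in> S) \<and>
     (\<forall>c. \<forall>X\<in>S. c \<cdot>\<^sub>m X \<in> S) \<and>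
     (\<forall>X\<in>S. mat_adjoint X \<in> S)"

definition unit_projection :: "complex mat set \<Rightarrow> complex mat \<Rightarrow> bool" where
  "unit_projection S P \<longleftrightarrow>
     P \<in> S \<and> P * P = P \<and> mat_adjoint P = P \<and> (\<forall>X\<in>S. P * X = X \<and> X * P = X)"

(* V maps C^k isometrically onto the range of P: this is the inclusion of C = PH into H, with C
   identified with C^k by an orthonormal basis. *)
definition range_inclusion :: "nat \<Rightarrow> nat \<Rightarrow> complex mat \<Rightarrow> complex mat \<Rightarrow> bool" where
  "range_inclusion n k P V \<longleftrightarrow>
     V \<in> carrier_mat n k \<and> mat_adjoint V * V = 1\<^sub>m k \<and> V * mat_adjoint V = P"

definition restrict_map ::
    "complex mat \<Rightarrow> (complex mat \<Rightarrow> complex mat) \<Rightarrow> complex mat \<Rightarrow> complex mat" where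
  "restrict_map V \<Phi> Y = \<Phi> (V * Y * mat_adjoint V)"

definition correctable ::
    "nat \<Rightarrow> nat \<Rightarrow> (complex mat \<Rightarrow> complex mat) \<Rightarrow> complex mat set \<Rightarrow> bool" where
  "correctable n m \<Phi> S \<longleftrightarrow>
     star_subalgebra n S \<and>
     (\<exists>P k V \<D>. unit_projection S P \<and> range_inclusion n k P V \<and> channel m k \<D> \<and>
        (\<forall>X \<in> (\<lambda>Y. mat_adjoint V * Y * V) ` S. adjoint_map k (\<D> \<circ> restrict_map V \<Phi>) X = X))"

definition transmittable ::
    "nat \<Rightarrow> nat \<Rightarrow> (complex mat \<Rightarrow> complex mat) \<Rightarrow> 'a star_alg \<Rightarrow> bool" where
  "transmittable n m \<Phi> A \<longleftrightarrow>
     fd_cstar_algebra A \<and>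
     (\<exists>\<pi>. star_hom A (matrix_alg n) \<pi> \<and> inj_on \<pi> (elems A) \<and> correctable n m \<Phi> (\<pi> ` elems A))"

(* Every transmittable algebra is *-isomorphic to a *-subalgebra of L(H), so algebras with elements
   of type complex mat represent all *-isomorphism classes of transmittable algebras. *)
definition dominating_transmittable ::
    "nat \<Rightarrow> nat \<Rightarrow> (complex mat \<Rightarrow> complex mat) \<Rightarrow> complex mat star_alg \<Rightarrow> bool" where
  "dominating_transmittable n m \<Phi> A \<longleftrightarrow>
     transmittable n m \<Phi> A \<and>
     (\<forall>B :: complex mat star_alg. transmittable n m \<Phi> B \<longrightarrow> embeds B A)"


section \<open>Hybrid capacities and the capacity algebra\<close>

definition d_max :: "nat \<Rightarrow> nat \<Rightarrow> (complex mat \<Rightarrow> complex mat) \<Rightarrow> nat" where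
  "d_max n m \<Phi> = Max {d. transmittable n m \<Phi> (matrix_alg d)}"

definition hybrid_capacity :: "nat \<Rightarrow> nat \<Rightarrow> (complex mat \<Rightarrow> complex mat) \<Rightarrow> nat \<Rightarrow> nat" where
  "hybrid_capacity n m \<Phi> d =
     Max {c. transmittable n m \<Phi> (direct_sum (replicate c (matrix_alg d)))}"

declare sum.cong [fundef_cong]

(* For d = d_max the sum is empty. *)
function cap_mult :: "nat \<Rightarrow> nat \<Rightarrow> (complex mat \<Rightarrow> complex mat) \<Rightarrow> nat \<Rightarrow> int" where
  "cap_mult n m \<Phi> d =
     int (hybrid_capacity n m \<Phi> d) -
     (\<Sum>k\<in>{d+1..d_max n m \<Phi>}. cap_mult n m \<Phi> k * \<lfloor>real k / real d\<rfloor>)"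
  by pat_completeness auto
termination
  by (relation "measure (\<lambda>(n, m, \<Phi>, d). d_max n m \<Phi> - d)") auto

declare cap_mult.simps [simp del]

definition cap_defined :: "nat \<Rightarrow> nat \<Rightarrow> (complex mat \<Rightarrow> complex mat) \<Rightarrow> bool" where
  "cap_defined n m \<Phi> \<longleftrightarrow> (\<forall>d\<in>{1..d_max n m \<Phi>}. cap_mult n m \<Phi> d \<ge> 0)"

(* Meaningful only if cap_defined holds, since nat sends negative integers to 0. *)
definition cap_algebra ::
    "nat \<Rightarrow> nat \<Rightarrow> (complex mat \<Rightarrow> complex mat) \<Rightarrow> complex mat list star_alg" where
  "cap_algebra n m \<Phi> =
     direct_sum (concat (map (\<lambda>d. replicate (nat (cap_mult n m \<Phi> d)) (matrix_alg d))
       [1..<Suc (d_max n m \<Phi>)]))"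

end

(* The class of transmittable algebras is closed under passing to embedded unital algebras: if D
   recovers an algebra with unit P, then a subalgebra with unit Q is recovered by D followed by
   compression to the range of Q, the lost weight being sent to a fixed state.  Every *-algebra of
   matrices is, up to mutual embedding, a sum of full matrix algebras, and c copies of M_d embed in
   a sum of blocks M_b if and only if c is at most the sum of the numbers b div d, because d*k
   nonzero orthogonal projections do not fit into M_b unless d*k <= b.

   Hence, if a dominating algebra A has block sizes b, then c_d is the sum of the b div d for all
   d, the recursion for N_d returns the number of blocks of size d, and A is the capacity algebra.
   Conversely, if B is transmittable, its blocks have sizes at most d_max <= 3 and its packing
   numbers are bounded by those of the capacity algebra; for sizes 1, 2, 3 these inequalities
   suffice to pack the blocks of B greedily, largest first, into those of the capacity algebra. *)

theory Submission
  imports Defs "Jordan_Normal_Form.Spectral_Radius" "HOL-Combinatorics.Permutations"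
begin

text \<open>Embeddings need not be unital, and domination and packing see an algebra only up to
  mutual embedding, so no isomorphism with a sum of blocks is constructed. Two obstacles shape the
  rest. A subalgebra has its own, smaller code space, so a decoder must be cut down to it without
  spoiling complete positivity or the trace. The repair leaves no error because P - Q, the
  difference of the two units, lies in the larger algebra: the decoder preserves its expectation,
  which is zero on the smaller code space. Moreover, domination quantifies over algebras whose
  elements are matrices, whereas sums of blocks consist of lists, so comparisons pass through a copy
  inside L(H).

  The bound 3 enters in the packing step. At size 4 the inequalities no longer suffice: M_3 + M_2
  has packing numbers 5, 2, 1, 0 for d = 1, 2, 3, 4, at most the 5, 2, 1, 1 of M_4 + M_1, yet M_2
  finds no room beside M_3 in M_4.\<close>

section \<open>Adjoints and matrix identities\<close>

lemma dim_mat_adjoint [simp]: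
  "dim_row (mat_adjoint A) = dim_col A" "dim_col (mat_adjoint A) = dim_row A"
  by (simp_all add: mat_adjoint_def)

lemma index_mat_adjoint [simp]:
  fixes A :: "complex mat"
  shows "i < dim_col A \<Longrightarrow> j < dim_row A \<Longrightarrow> mat_adjoint A $$ (i, j) = cnj (A $$ (j, i))"
  by (simp add: mat_adjoint_def mat_of_rows_def)

lemma mat_adjoint_carrier [simp]:
  "A \<in> carrier_mat n m \<Longrightarrow> mat_adjoint A \<in> carrier_mat m n"
  by auto

lemma mat_adjoint_adjoint [simp]: "mat_adjoint (mat_adjoint A) = (A :: complex mat)"
  by (rule eq_matI) auto

lemma mat_adjoint_mult:
  fixes A B :: "complex mat"
  shows "dim_col A = dim_row B \<Longrightarrow> mat_adjoint (A * B) = mat_adjoint B * mat_adjoint A"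
  by (rule eq_matI) (auto simp: scalar_prod_def mult.commute)

lemma mat_adjoint_add:
  fixes A B :: "complex mat"
  shows "dim_row A = dim_row B \<Longrightarrow> dim_col A = dim_col B \<Longrightarrow>
    mat_adjoint (A + B) = mat_adjoint A + mat_adjoint B"
  by (rule eq_matI) auto

lemma mat_adjoint_smult: "mat_adjoint (c \<cdot>\<^sub>m A) = cnj c \<cdot>\<^sub>m mat_adjoint (A :: complex mat)"
  by (rule eq_matI) auto

lemma mat_adjoint_zero [simp]: "mat_adjoint (0\<^sub>m n m :: complex mat) = 0\<^sub>m m n"
  by (rule eq_matI) auto

lemma mat_adjoint_one [simp]: "mat_adjoint (1\<^sub>m n :: complex mat) = 1\<^sub>m n"
  by (rule eq_matI) auto

text \<open>Matrix algebra with side conditions on dimensions, which the simplifier can discharge.\<close>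

lemma mat_assoc:
  fixes A :: "complex mat"
  shows "dim_col A = dim_row B \<Longrightarrow> dim_col B = dim_row C \<Longrightarrow> A * B * C = A * (B * C)"
  by (rule assoc_mult_mat[of _ "dim_row A" "dim_row B" _ "dim_row C" _ "dim_col C"]) auto

lemma mat_assoc_vec:
  fixes A :: "complex mat"
  shows "dim_col A = dim_row B \<Longrightarrow> dim_col B = dim_vec v \<Longrightarrow> A * B *\<^sub>v v = A *\<^sub>v (B *\<^sub>v v)"
  by (rule assoc_mult_mat_vec[of _ "dim_row A" "dim_row B" _ "dim_vec v"]) auto

lemma mat_distrib_right:
  fixes A :: "complex mat"
  shows "dim_row A = dim_row B \<Longrightarrow> dim_col A = dim_col B \<Longrightarrow> dim_col B = dim_row C \<Longrightarrow>
    (A + B) * C = A * C + B * C"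
  by (rule add_mult_distrib_mat[of _ "dim_row A" "dim_col A" _ _ "dim_col C"]) auto

lemma mat_distrib_left:
  fixes A :: "complex mat"
  shows "dim_row B = dim_row C \<Longrightarrow> dim_col B = dim_col C \<Longrightarrow> dim_col A = dim_row B \<Longrightarrow>
    A * (B + C) = A * B + A * C"
  by (rule mult_add_distrib_mat[of _ "dim_row A" "dim_col A" _ "dim_col B"]) auto

lemma mat_smult_left: "dim_col A = dim_row B \<Longrightarrow> (c \<cdot>\<^sub>m A) * B = c \<cdot>\<^sub>m (A * (B :: complex mat))"
  by (rule mult_smult_assoc_mat[of _ "dim_row A" "dim_col A" _ "dim_col B"]) auto

lemma mat_smult_right: "dim_col A = dim_row B \<Longrightarrow> A * (c \<cdot>\<^sub>m B) = c \<cdot>\<^sub>m (A * (B :: complex mat))"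
  by (rule mult_smult_distrib[of _ "dim_row A" "dim_col A" _ "dim_col B"]) auto

lemma mat_mult_zero [simp]:
  fixes A :: "complex mat"
  shows "dim_col A = n \<Longrightarrow> A * 0\<^sub>m n k = 0\<^sub>m (dim_row A) k"
    and "dim_row A = n \<Longrightarrow> 0\<^sub>m k n * A = 0\<^sub>m k (dim_col A)"
  by (rule right_mult_zero_mat left_mult_zero_mat, auto)+

lemma mat_mult_one [simp]:
  fixes A :: "complex mat"
  shows "dim_row A = n \<Longrightarrow> 1\<^sub>m n * A = A" and "dim_col A = n \<Longrightarrow> A * 1\<^sub>m n = A"
  by (rule left_mult_one_mat[of _ _ "dim_col A"] right_mult_one_mat[of _ "dim_row A"]; force)+

lemmas mat_distribs = mat_distrib_left mat_distrib_right mat_smult_left mat_smult_right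

lemma mat_mult_zero_vec [simp]:
  fixes A :: "complex mat"
  shows "dim_col A = n \<Longrightarrow> A *\<^sub>v 0\<^sub>v n = 0\<^sub>v (dim_row A)"
  by (rule eq_vecI) (auto simp: scalar_prod_def)

lemma zero_mat_mult_vec [simp]: "dim_vec v = m \<Longrightarrow> 0\<^sub>m n m *\<^sub>v v = (0\<^sub>v n :: complex vec)"
  by (rule eq_vecI) (auto simp: scalar_prod_def)

lemma inner_mat_adjoint:
  fixes A :: "complex mat"
  assumes "A \<in> carrier_mat n m" "v \<in> carrier_vec m" "w \<in> carrier_vec n"
  shows "(A *\<^sub>v v) \<bullet>c w = v \<bullet>c (mat_adjoint A *\<^sub>v w)"
proof -
  have "(A *\<^sub>v v) \<bullet>c w = (\<Sum>i<n. \<Sum>j<m. A $$ (i, j) * v $ j * cnj (w $ i))"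
    using assms by (auto simp: scalar_prod_def sum_distrib_right lessThan_atLeast0 intro!: sum.cong)
  also have "\<dots> = (\<Sum>j<m. \<Sum>i<n. A $$ (i, j) * v $ j * cnj (w $ i))"
    by (rule sum.swap)
  also have "\<dots> = v \<bullet>c (mat_adjoint A *\<^sub>v w)"
    using assms
    by (auto simp: scalar_prod_def sum_distrib_left lessThan_atLeast0 mult_ac intro!: sum.cong)
  finally show ?thesis .
qed

lemma mat_eq_by_unit_vec:
  fixes A B :: "complex mat"
  assumes "A \<in> carrier_mat n m" "B \<in> carrier_mat n m"
    and "\<And>j. j < m \<Longrightarrow> A *\<^sub>v unit_vec m j = B *\<^sub>v unit_vec m j"
  shows "A = B"
proof (rule eq_matI)
  fix i j assume ij: "i < dim_row B" "j < dim_col B"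
  have "(A *\<^sub>v unit_vec m j) $ i = (B *\<^sub>v unit_vec m j) $ i" using assms ij by simp
  then show "A $$ (i, j) = B $$ (i, j)" using ij assms(1,2) by simp
qed (use assms in auto)

lemma mat_eq_by_mult_vec:
  fixes A B :: "complex mat"
  assumes "A \<in> carrier_mat n m" "B \<in> carrier_mat n m"
    and "\<And>v. v \<in> carrier_vec m \<Longrightarrow> A *\<^sub>v v = B *\<^sub>v v"
  shows "A = B"
  using assms by (intro mat_eq_by_unit_vec[of A n m B]) auto

lemma mat_zero_by_mult_vec:
  fixes A :: "complex mat"
  assumes "A \<in> carrier_mat n m" "\<And>v. v \<in> carrier_vec m \<Longrightarrow> A *\<^sub>v v = 0\<^sub>v n"
  shows "A = 0\<^sub>m n m"
  using assms by (intro mat_eq_by_mult_vec[of _ n m]) auto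

lemma mat_nonzero_mult_vec:
  fixes A :: "complex mat"
  assumes "A \<in> carrier_mat n m" "A \<noteq> 0\<^sub>m n m"
  obtains v where "v \<in> carrier_vec m" "A *\<^sub>v v \<noteq> 0\<^sub>v n"
  using mat_zero_by_mult_vec[OF assms(1)] assms(2) by blast

text \<open>Pairing \<open>mat_adjoint A * A *\<^sub>v v\<close> with \<open>v\<close> gives the
  squared length of \<open>A *\<^sub>v v\<close>.\<close>

lemma adjoint_mult_self_vec_zero:
  fixes A :: "complex mat"
  assumes "A \<in> carrier_mat n m" "v \<in> carrier_vec m" "(mat_adjoint A * A) *\<^sub>v v = 0\<^sub>v m"
  shows "A *\<^sub>v v = 0\<^sub>v n"
proof -
  have "(A *\<^sub>v v) \<bullet>c (A *\<^sub>v v) = v \<bullet>c (mat_adjoint A *\<^sub>v (A *\<^sub>v v))"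
    using assms by (intro inner_mat_adjoint) auto
  also have "\<dots> = 0"
    using assms by (simp add: mat_assoc_vec[symmetric])
  finally show ?thesis using assms by (simp add: conjugate_square_eq_0_vec[of _ n])
qed

lemma adjoint_mult_self_zero:
  fixes A :: "complex mat"
  assumes "A \<in> carrier_mat n m" "mat_adjoint A * A = 0\<^sub>m m m"
  shows "A = 0\<^sub>m n m"
  by (rule mat_zero_by_mult_vec, fact, rule adjoint_mult_self_vec_zero) (use assms in auto)

section \<open>Orthonormal systems\<close>

definition vec_subspace :: "nat \<Rightarrow> complex vec set \<Rightarrow> bool" where
  "vec_subspace n U \<longleftrightarrow> U \<subseteq> carrier_vec n \<and> 0\<^sub>v n \<in> U \<and> (\<forall>u\<in>U. \<forall>v\<in>U. u + v \<in> U) \<and>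
     (\<forall>c. \<forall>u\<in>U. c \<cdot>\<^sub>v u \<in> U)"

text \<open>The columns of \<open>W\<close> are an orthonormal system in \<open>U\<close>. Kept as
  an isometry, the system serves at once as coordinate map (\<open>mat_adjoint W\<close>) and for
  compressing operators to \<open>U\<close>.\<close>

definition orthonormal_in :: "nat \<Rightarrow> nat \<Rightarrow> complex vec set \<Rightarrow> complex mat \<Rightarrow> bool" where
  "orthonormal_in n b U W \<longleftrightarrow> W \<in> carrier_mat n b \<and> mat_adjoint W * W = 1\<^sub>m b \<and>
     (\<forall>v\<in>carrier_vec b. W *\<^sub>v v \<in> U)"

text \<open>Padding by zero rows would make the system square, hence invertible with a zero row.\<close>

lemma orthonormal_le:
  fixes W :: "complex mat"
  assumes W: "W \<in> carrier_mat n b" and orth: "mat_adjoint W * W = 1\<^sub>m b"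
  shows "b \<le> n"
proof (rule ccontr)
  assume "\<not> b \<le> n"
  then have nb: "n < b" by simp
  define W' where "W' = mat b b (\<lambda>(i, j). if i < n then W $$ (i, j) else 0)"
  have W': "W' \<in> carrier_mat b b" by (simp add: W'_def)
  have "mat_adjoint W' * W' = mat_adjoint W * W"
  proof (rule eq_matI)
    fix i j assume "i < dim_row (mat_adjoint W * W)" "j < dim_col (mat_adjoint W * W)"
    then have ij: "i < b" "j < b" using W by auto
    have "(\<Sum>k = 0..<b. cnj (W' $$ (k, i)) * W' $$ (k, j)) = (\<Sum>k = 0..<n. cnj (W' $$ (k, i)) * W' $$ (k, j))"
      by (rule sum.mono_neutral_right) (use nb ij in \<open>auto simp: W'_def\<close>)
    also have "\<dots> = (\<Sum>k = 0..<n. cnj (W $$ (k, i)) * W $$ (k, j))"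
      by (rule sum.cong) (use nb ij in \<open>auto simp: W'_def\<close>)
    finally show "(mat_adjoint W' * W') $$ (i, j) = (mat_adjoint W * W) $$ (i, j)"
      using ij W W' by (simp add: scalar_prod_def)
  qed (use W W' in auto)
  then have "W' * mat_adjoint W' = 1\<^sub>m b"
    using mat_mult_left_right_inverse[of "mat_adjoint W'" b W'] W' orth by simp
  then have "(W' * mat_adjoint W') $$ (n, n) = 1" using nb by simp
  then show False using nb by (simp add: scalar_prod_def W'_def)
qed

text \<open>One Gram-Schmidt step: \<open>r\<close>, once normalised by \<open>c\<close>, becomes
  the last column.\<close>

lemma orthonormal_in_extend:
  assumes W: "orthonormal_in n b U W" and U: "vec_subspace n U" and r: "r \<in> U"
    and r0: "r \<noteq> 0\<^sub>v n" and Wr: "mat_adjoint W *\<^sub>v r = 0\<^sub>v b"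
  obtains W' where "orthonormal_in n (Suc b) U W'"
proof
  have Wc: "W \<in> carrier_mat n b" and WW: "mat_adjoint W * W = 1\<^sub>m b"
    and WU: "\<And>v. v \<in> carrier_vec b \<Longrightarrow> W *\<^sub>v v \<in> U"
    using W by (auto simp: orthonormal_in_def)
  have rc: "r \<in> carrier_vec n" using U r by (auto simp: vec_subspace_def)
  have rr: "r \<bullet>c r > 0" using conjugate_square_greater_0_vec[OF rc] r0 by simp
  define s where "s = Re (r \<bullet>c r)"
  have s: "r \<bullet>c r = complex_of_real s" "s > 0"
    using rr by (auto simp: s_def less_complex_def complex_eq_iff)
  define c where "c = complex_of_real (1 / sqrt s)"
  have c: "cnj c * c * (r \<bullet>c r) = 1"
    using s by (simp add: c_def flip: of_real_mult)
  define W' where "W' = mat n (Suc b) (\<lambda>(i, j). if j < b then W $$ (i, j) else c * r $ i)"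
  have W': "W' \<in> carrier_mat n (Suc b)" by (simp add: W'_def)
  have rsum: "(\<Sum>k = 0..<n. cnj (r $ k) * r $ k) = r \<bullet>c r"
    using rc by (simp add: scalar_prod_def mult.commute)
  have 1: "(\<Sum>k = 0..<n. cnj (W $$ (k, i)) * r $ k) = 0" if "i < b" for i
  proof -
    have "(mat_adjoint W *\<^sub>v r) $ i = 0" using Wr that by simp
    then show ?thesis using that rc Wc by (simp add: scalar_prod_def)
  qed
  have 2: "(\<Sum>k = 0..<n. cnj (r $ k) * W $$ (k, i)) = 0" if "i < b" for i
  proof -
    have "cnj (\<Sum>k = 0..<n. cnj (W $$ (k, i)) * r $ k) = 0" using 1[OF that] by simp
    then show ?thesis by (simp add: mult.commute)
  qed
  have 3: "(\<Sum>k = 0..<n. cnj (W $$ (k, i)) * W $$ (k, j)) = (if i = j then 1 else 0)"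
    if "i < b" "j < b" for i j
  proof -
    have "(mat_adjoint W * W) $$ (i, j) = (if i = j then 1 else 0)" using WW that by simp
    then show ?thesis using that carrier_matD[OF Wc] by (simp add: scalar_prod_def)
  qed
  have "mat_adjoint W' * W' = 1\<^sub>m (Suc b)"
  proof (rule eq_matI)
    fix i j assume "i < dim_row (1\<^sub>m (Suc b) :: complex mat)" "j < dim_col (1\<^sub>m (Suc b) :: complex mat)"
    then have ij: "i < Suc b" "j < Suc b" by auto
    have "(mat_adjoint W' * W') $$ (i, j) = (\<Sum>k = 0..<n. cnj (W' $$ (k, i)) * W' $$ (k, j))"
      using ij W' by (simp add: scalar_prod_def)
    also have "\<dots> = (if i = j then 1 else 0)"
    proof (cases "i < b")
      case i: True
      show ?thesis
      proof (cases "j < b")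
        case True
        then show ?thesis using i 3[of i j] by (simp add: W'_def)
      next
        case False
        have "(\<Sum>k = 0..<n. cnj (W' $$ (k, i)) * W' $$ (k, j)) = c * (\<Sum>k = 0..<n. cnj (W $$ (k, i)) * r $ k)"
          using i ij False by (simp add: W'_def sum_distrib_left mult_ac)
        then show ?thesis using 1[OF i] i False by simp
      qed
    next
      case i: False
      show ?thesis
      proof (cases "j < b")
        case True
        have "(\<Sum>k = 0..<n. cnj (W' $$ (k, i)) * W' $$ (k, j)) = cnj c * (\<Sum>k = 0..<n. cnj (r $ k) * W $$ (k, j))"
          using i ij True by (simp add: W'_def sum_distrib_left mult_ac)
        then show ?thesis using 2[OF True] i True by auto
      next
        case False
        have "(\<Sum>k = 0..<n. cnj (W' $$ (k, i)) * W' $$ (k, j)) = cnj c * c * (\<Sum>k = 0..<n. cnj (r $ k) * r $ k)"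
          using i ij False by (simp add: W'_def sum_distrib_left mult_ac)
        then show ?thesis using c i False ij rsum by simp
      qed
    qed
    finally show "(mat_adjoint W' * W') $$ (i, j) = 1\<^sub>m (Suc b) $$ (i, j)" using ij by simp
  qed (use W' in auto)
  moreover have "W' *\<^sub>v v \<in> U" if v: "v \<in> carrier_vec (Suc b)" for v
  proof -
    have "W' *\<^sub>v v = W *\<^sub>v (vec b (($) v)) + (c * v $ b) \<cdot>\<^sub>v r"
      by (rule eq_vecI) (use v rc Wc in \<open>auto simp: W'_def scalar_prod_def\<close>)
    then show ?thesis using WU[of "vec b (($) v)"] U r by (auto simp: vec_subspace_def)
  qed
  ultimately show "orthonormal_in n (Suc b) U W'" using W' by (auto simp: orthonormal_in_def)
qed

lemma orthonormal_in_0: "vec_subspace n U \<Longrightarrow> orthonormal_in n 0 U (0\<^sub>m n 0)"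
proof -
  assume "vec_subspace n U"
  moreover have "0\<^sub>m n 0 *\<^sub>v v = 0\<^sub>v n" if "v \<in> carrier_vec 0" for v :: "complex vec"
    using that by (intro eq_vecI) (auto simp: scalar_prod_def)
  ultimately show ?thesis
    by (auto simp: orthonormal_in_def vec_subspace_def intro!: eq_matI)
qed

text \<open>The dimension of \<open>U\<close>, taken as the largest size of an orthonormal system; a
  system of that size cannot be extended and therefore spans.\<close>

definition orth_dim :: "nat \<Rightarrow> complex vec set \<Rightarrow> nat" where
  "orth_dim n U = Max {b. \<exists>W. orthonormal_in n b U W}"

lemma finite_orthonormal_in: "finite {b. \<exists>W. orthonormal_in n b U W}"
  by (rule finite_subset[of _ "{..n}"]) (auto simp: orthonormal_in_def dest: orthonormal_le)

lemma orthonormal_in_le_orth_dim: "orthonormal_in n b U W \<Longrightarrow> b \<le> orth_dim n U"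
  unfolding orth_dim_def by (rule Max_ge[OF finite_orthonormal_in]) auto

lemma orth_dim_attained:
  assumes "vec_subspace n U"
  obtains W where "orthonormal_in n (orth_dim n U) U W"
proof -
  have "orth_dim n U \<in> {b. \<exists>W. orthonormal_in n b U W}"
    unfolding orth_dim_def
    by (rule Max_in[OF finite_orthonormal_in]) (use orthonormal_in_0[OF assms] in blast)
  then show ?thesis using that by blast
qed

lemma orth_dim_le: "vec_subspace n U \<Longrightarrow> orth_dim n U \<le> n"
  by (meson orth_dim_attained orthonormal_in_def orthonormal_le)

lemma orthonormal_residual:
  fixes W :: "complex mat"
  assumes W: "W \<in> carrier_mat n b" "mat_adjoint W * W = 1\<^sub>m b" and u: "u \<in> carrier_vec n"
  shows "mat_adjoint W *\<^sub>v (u + (-1) \<cdot>\<^sub>v (W *\<^sub>v (mat_adjoint W *\<^sub>v u))) = 0\<^sub>v b"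
proof -
  have "mat_adjoint W *\<^sub>v (W *\<^sub>v (mat_adjoint W *\<^sub>v u)) = mat_adjoint W *\<^sub>v u"
    using mat_assoc_vec[of "mat_adjoint W" W "mat_adjoint W *\<^sub>v u"] W u
    by (simp add: carrier_matD[OF W(1)] one_mult_mat_vec[of _ b] mult_mat_vec_carrier[OF mat_adjoint_carrier[OF W(1)] u])
  moreover have w: "W *\<^sub>v (mat_adjoint W *\<^sub>v u) \<in> carrier_vec n"
    by (intro mult_mat_vec_carrier[OF W(1)] mult_mat_vec_carrier[OF mat_adjoint_carrier[OF W(1)]] u)
  ultimately show ?thesis
    using mult_add_distrib_mat_vec[OF mat_adjoint_carrier[OF W(1)] u iffD2[OF smult_carrier_vec w]]
      mult_mat_vec[OF mat_adjoint_carrier[OF W(1)] w] carrier_matD[OF W(1)]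
    by (intro eq_vecI) (simp_all del: index_mult_mat_vec)
qed

text \<open>A nonzero remainder of \<open>u\<close> after projection to the columns of
  \<open>W\<close> would be orthogonal to them and extend a system of maximal size.\<close>

lemma orth_dim_basis:
  assumes U: "vec_subspace n U" and W: "orthonormal_in n (orth_dim n U) U W" and u: "u \<in> U"
  shows "W *\<^sub>v (mat_adjoint W *\<^sub>v u) = u"
proof (rule ccontr)
  assume neq: "W *\<^sub>v (mat_adjoint W *\<^sub>v u) \<noteq> u"
  let ?b = "orth_dim n U"
  have Wc: "W \<in> carrier_mat n ?b" "mat_adjoint W * W = 1\<^sub>m ?b"
    using W by (auto simp: orthonormal_in_def)
  have uc: "u \<in> carrier_vec n" using U u by (auto simp: vec_subspace_def)
  define r where "r = u + (-1) \<cdot>\<^sub>v (W *\<^sub>v (mat_adjoint W *\<^sub>v u))"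
  have "W *\<^sub>v (mat_adjoint W *\<^sub>v u) \<in> U"
    using W mult_mat_vec_carrier[OF mat_adjoint_carrier[OF Wc(1)] uc] by (auto simp: orthonormal_in_def)
  then have "r \<in> U" using U u by (auto simp: r_def vec_subspace_def)
  moreover have "r \<noteq> 0\<^sub>v n"
  proof
    assume "r = 0\<^sub>v n"
    then have "r $ i = 0" if "i < n" for i using that by simp
    then have "W *\<^sub>v (mat_adjoint W *\<^sub>v u) = u"
      using uc Wc by (intro eq_vecI) (auto simp: r_def)
    with neq show False by blast
  qed
  moreover have "mat_adjoint W *\<^sub>v r = 0\<^sub>v ?b"
    unfolding r_def by (rule orthonormal_residual[OF Wc uc])
  ultimately obtain W' where "orthonormal_in n (Suc ?b) U W'"
    using orthonormal_in_extend[OF W U] by blast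
  then show False using orthonormal_in_le_orth_dim by fastforce
qed

text \<open>A maximal system of \<open>U\<close> is extended inside \<open>U'\<close> by the
  remainder of a vector outside \<open>U\<close>. This strictness drives the choice of a minimal
  projection, the termination of the block decomposition and the count of orthogonal
  projections.\<close>

lemma orth_dim_strict_mono:
  assumes U: "vec_subspace n U" and U': "vec_subspace n U'" and sub: "U \<subset> U'"
  shows "orth_dim n U < orth_dim n U'"
proof -
  let ?b = "orth_dim n U"
  obtain W where W: "orthonormal_in n ?b U W" using orth_dim_attained[OF U] by blast
  have Wc: "W \<in> carrier_mat n ?b" "mat_adjoint W * W = 1\<^sub>m ?b"
    using W by (auto simp: orthonormal_in_def)
  obtain u where u: "u \<in> U'" "u \<notin> U" using sub by blast
  have uc: "u \<in> carrier_vec n" using U' u by (auto simp: vec_subspace_def)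
  define w where "w = W *\<^sub>v (mat_adjoint W *\<^sub>v u)"
  have w: "w \<in> U"
    using W mult_mat_vec_carrier[OF mat_adjoint_carrier[OF Wc(1)] uc] by (auto simp: orthonormal_in_def w_def)
  define r where "r = u + (-1) \<cdot>\<^sub>v w"
  have "r \<in> U'" using U' u w sub by (auto simp: r_def vec_subspace_def)
  moreover have "r \<noteq> 0\<^sub>v n"
  proof
    assume "r = 0\<^sub>v n"
    then have "r $ i = 0" if "i < n" for i using that by simp
    then have "w = u"
      using uc Wc by (intro eq_vecI) (auto simp: r_def w_def)
    with u w show False by blast
  qed
  moreover have "mat_adjoint W *\<^sub>v r = 0\<^sub>v ?b"
    unfolding r_def w_def by (rule orthonormal_residual[OF Wc uc])
  moreover have "orthonormal_in n ?b U' W" using W sub by (auto simp: orthonormal_in_def)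
  ultimately obtain W' where "orthonormal_in n (Suc ?b) U' W'"
    using orthonormal_in_extend[OF _ U'] by blast
  then show ?thesis using orthonormal_in_le_orth_dim by fastforce
qed

text \<open>Take for \<open>V\<close> an orthonormal basis \<open>W\<close> of the fixed space of
  \<open>P\<close>. Maximality gives \<open>W * mat_adjoint W * P = P\<close>, and the adjoint of
  \<open>P * W = W\<close> absorbs the last factor on the left.\<close>

lemma projection_range_inclusion:
  assumes P: "P \<in> carrier_mat n n" "P * P = P" "mat_adjoint P = P"
  obtains k V where "range_inclusion n k P V"
proof -
  define U where "U = {u \<in> carrier_vec n. P *\<^sub>v u = u}"
  have U: "vec_subspace n U"
    using P by (auto simp: vec_subspace_def U_def mult_add_distrib_mat_vec[of _ n n] mult_mat_vec[of _ n n])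
  obtain W where W: "orthonormal_in n (orth_dim n U) U W" using orth_dim_attained[OF U] by blast
  let ?b = "orth_dim n U"
  have Wc: "W \<in> carrier_mat n ?b" and WW [simp]: "mat_adjoint W * W = 1\<^sub>m ?b"
    using W by (auto simp: orthonormal_in_def)
  have dims [simp]: "dim_row W = n" "dim_col W = ?b" "dim_row P = n" "dim_col P = n"
    using Wc P by auto
  have PW: "P * W = W"
    by (rule mat_eq_by_mult_vec[of _ n ?b])
       (use P W in \<open>auto simp: mat_assoc_vec orthonormal_in_def U_def\<close>)
  have "W * mat_adjoint W * P = P"
  proof (rule mat_eq_by_mult_vec[of _ n n])
    fix v :: "complex vec" assume v: "v \<in> carrier_vec n"
    have "P *\<^sub>v v \<in> U" using P v by (auto simp: U_def simp flip: mat_assoc_vec)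
    from orth_dim_basis[OF U W this] show "W * mat_adjoint W * P *\<^sub>v v = P *\<^sub>v v"
      using v P by (simp add: mat_assoc_vec)
  qed (use P in auto)
  moreover have "mat_adjoint W * P = mat_adjoint W"
    using arg_cong[OF PW, of mat_adjoint] P by (simp add: mat_adjoint_mult)
  ultimately have "W * mat_adjoint W = P" by (simp add: mat_assoc)
  then show ?thesis using that[of ?b W] Wc by (simp add: range_inclusion_def)
qed

text \<open>In an orthonormal basis \<open>W\<close> of \<open>U\<close> the operator becomes the
  square matrix \<open>Y\<close>, which has an eigenvector because \<open>U\<close> is not zero; by
  invariance \<open>W\<close> carries it back to an eigenvector of \<open>y\<close>.\<close>

lemma invariant_subspace_eigenvector:
  assumes U: "vec_subspace n U" and u0: "u0 \<in> U" "u0 \<noteq> 0\<^sub>v n" and y: "y \<in> carrier_mat n n"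
    and inv: "\<And>u. u \<in> U \<Longrightarrow> y *\<^sub>v u \<in> U"
  obtains u \<mu> where "u \<in> U" "u \<noteq> 0\<^sub>v n" "y *\<^sub>v u = \<mu> \<cdot>\<^sub>v u"
proof -
  let ?b = "orth_dim n U"
  obtain W where W: "orthonormal_in n ?b U W" using orth_dim_attained[OF U] by blast
  have Wc: "W \<in> carrier_mat n ?b" and WW [simp]: "mat_adjoint W * W = 1\<^sub>m ?b"
    using W by (auto simp: orthonormal_in_def)
  have dims [simp]: "dim_row W = n" "dim_col W = ?b" "dim_row y = n" "dim_col y = n"
    using Wc y by auto
  have "?b > 0"
  proof (rule ccontr)
    assume "\<not> ?b > 0"
    then have "W *\<^sub>v (mat_adjoint W *\<^sub>v u0) = 0\<^sub>v n"
      by (intro eq_vecI) (auto simp: scalar_prod_def)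
    then show False using orth_dim_basis[OF U W u0(1)] u0 by simp
  qed
  define Y where "Y = mat_adjoint W * y * W"
  have Y: "Y \<in> carrier_mat ?b ?b" using y by (auto simp: Y_def)
  obtain \<mu> where "eigenvalue Y \<mu>"
    using spectrum_non_empty[OF Y \<open>?b > 0\<close>] by (auto simp: spectrum_def)
  then obtain v where v: "v \<in> carrier_vec ?b" "v \<noteq> 0\<^sub>v ?b" "Y *\<^sub>v v = \<mu> \<cdot>\<^sub>v v"
    using Y by (auto simp: eigenvalue_def eigenvector_def)
  have dv [simp]: "dim_vec v = ?b" using v by simp
  have Wv: "W *\<^sub>v v \<in> U" using W v by (auto simp: orthonormal_in_def)
  have "mat_adjoint W *\<^sub>v (W *\<^sub>v v) = v" using v by (simp flip: mat_assoc_vec)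
  then have "W *\<^sub>v v \<noteq> 0\<^sub>v n" using v(2) by auto
  moreover have "y *\<^sub>v (W *\<^sub>v v) = W *\<^sub>v (mat_adjoint W *\<^sub>v (y *\<^sub>v (W *\<^sub>v v)))"
    using orth_dim_basis[OF U W inv[OF Wv]] by simp
  moreover have "mat_adjoint W *\<^sub>v (y *\<^sub>v (W *\<^sub>v v)) = \<mu> \<cdot>\<^sub>v v"
    using v by (simp add: Y_def mat_assoc_vec)
  ultimately show ?thesis using that[OF Wv] mult_mat_vec[OF Wc v(1)] by simp
qed

lemma add_mult_mat_vec:
  fixes A B :: "complex mat"
  shows "dim_row A = dim_row B \<Longrightarrow> dim_col A = dim_vec v \<Longrightarrow> dim_col B = dim_vec v \<Longrightarrow>
    (A + B) *\<^sub>v v = A *\<^sub>v v + B *\<^sub>v v"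
  by (rule add_mult_distrib_mat_vec[of _ "dim_row A" "dim_vec v"]) auto

lemma smult_mult_mat_vec:
  fixes A :: "complex mat"
  shows "dim_col A = dim_vec v \<Longrightarrow> (c \<cdot>\<^sub>m A) *\<^sub>v v = c \<cdot>\<^sub>v (A *\<^sub>v v)"
  by (rule eq_vecI) (auto simp: scalar_prod_def sum_distrib_left mult_ac)

lemma mult_mat_vec_smult:
  fixes A :: "complex mat"
  shows "dim_col A = dim_vec v \<Longrightarrow> A *\<^sub>v (c \<cdot>\<^sub>v v) = c \<cdot>\<^sub>v (A *\<^sub>v v)"
  by (rule eq_vecI) (auto simp: scalar_prod_def sum_distrib_left mult_ac)

lemma mult_mat_vec_add:
  fixes A :: "complex mat"
  shows "dim_vec v = dim_vec w \<Longrightarrow> dim_col A = dim_vec w \<Longrightarrow> A *\<^sub>v (v + w) = A *\<^sub>v v + A *\<^sub>v w"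
  by (rule mult_add_distrib_mat_vec[of _ "dim_row A" "dim_vec w"]) (auto intro: carrier_vecI)

lemmas mat_vec_distribs = add_mult_mat_vec smult_mult_mat_vec mult_mat_vec_smult mult_mat_vec_add

section \<open>Algebras of matrices closed under the adjoint\<close>

text \<open>Unlike \<open>star_subalgebra\<close> this admits the zero algebra, at which the
  successive splitting off of blocks ends.\<close>

definition star_closed :: "nat \<Rightarrow> complex mat set \<Rightarrow> bool" where
  "star_closed n S \<longleftrightarrow> S \<subseteq> carrier_mat n n \<and> 0\<^sub>m n n \<in> S \<and>
     (\<forall>X\<in>S. \<forall>Y\<in>S. X + Y \<in> S \<and> X * Y \<in> S) \<and> (\<forall>c. \<forall>X\<in>S. c \<cdot>\<^sub>m X \<in> S) \<and>
     (\<forall>X\<in>S. mat_adjoint X \<in> S)"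

lemma star_closedD:
  assumes "star_closed n S"
  shows "X \<in> S \<Longrightarrow> X \<in> carrier_mat n n" "0\<^sub>m n n \<in> S"
    "X \<in> S \<Longrightarrow> Y \<in> S \<Longrightarrow> X + Y \<in> S" "X \<in> S \<Longrightarrow> Y \<in> S \<Longrightarrow> X * Y \<in> S"
    "X \<in> S \<Longrightarrow> c \<cdot>\<^sub>m X \<in> S" "X \<in> S \<Longrightarrow> mat_adjoint X \<in> S"
  using assms by (auto simp: star_closed_def)

lemma star_closed_dims:
  assumes "star_closed n S" "X \<in> S"
  shows "dim_row X = n" "dim_col X = n"
  using star_closedD(1)[OF assms] by auto

lemma kernel_subspace:
  "X \<in> carrier_mat n n \<Longrightarrow> vec_subspace n {v \<in> carrier_vec n. X *\<^sub>v v = 0\<^sub>v n}"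
  by (auto simp: vec_subspace_def mat_vec_distribs)

lemma smult_mat_left_cancel:
  fixes X :: "complex mat"
  assumes "a \<cdot>\<^sub>m X = b \<cdot>\<^sub>m X" "X \<in> carrier_mat n m" "X \<noteq> 0\<^sub>m n m"
  shows "a = b"
proof (rule ccontr)
  assume "a \<noteq> b"
  have "X $$ (i, j) = 0" if "i < n" "j < m" for i j
  proof -
    have "(a \<cdot>\<^sub>m X) $$ (i, j) = (b \<cdot>\<^sub>m X) $$ (i, j)" using assms(1) by simp
    then show ?thesis using that assms(2) \<open>a \<noteq> b\<close> by auto
  qed
  then have "X = 0\<^sub>m n m" using assms(2) by (intro eq_matI) auto
  with assms(3) show False by blast
qed

text \<open>Differences are written as sums with a negative multiple, the form for which
  \<open>star_closed\<close> yields membership.\<close>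

lemma add_smult_neg_zero:
  fixes X Y :: "complex mat"
  assumes "X + (-c) \<cdot>\<^sub>m Y = 0\<^sub>m n m" "X \<in> carrier_mat n m" "Y \<in> carrier_mat n m"
  shows "X = c \<cdot>\<^sub>m Y"
proof (rule eq_matI)
  fix i j assume "i < dim_row (c \<cdot>\<^sub>m Y)" "j < dim_col (c \<cdot>\<^sub>m Y)"
  then have ij: "i < n" "j < m" using assms by auto
  have "(X + (-c) \<cdot>\<^sub>m Y) $$ (i, j) = 0" using assms(1) ij by simp
  then have "X $$ (i, j) + (-c) * Y $$ (i, j) = 0" using ij assms(2,3) by auto
  then show "X $$ (i, j) = (c \<cdot>\<^sub>m Y) $$ (i, j)" using ij assms(2,3) by auto
qed (use assms in auto)

text \<open>Take \<open>x \<noteq> 0\<close> with maximal kernel and a nonzero eigenvalue \<open>l\<close> of \<open>h = x\<^sup>* x\<close>.  The kernel of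
  \<open>h\<^sup>2 - l h\<close> is strictly larger, so \<open>h\<^sup>2 = l h\<close> and \<open>p = h / l\<close> is a projection; the same argument
  applied to \<open>p x p - \<mu> p\<close>, with \<open>\<mu>\<close> an eigenvalue of \<open>p x p\<close> on the range of \<open>p\<close>, shows that it vanishes.\<close>

lemma star_closed_minimal_projection:
  assumes S: "star_closed n S" and S0: "S \<noteq> {0\<^sub>m n n}"
  obtains p where "p \<in> S" "p \<noteq> 0\<^sub>m n n" "p * p = p" "mat_adjoint p = p"
    "\<And>x. x \<in> S \<Longrightarrow> \<exists>\<mu>. p * x * p = \<mu> \<cdot>\<^sub>m p"
proof -
  note SD = star_closedD[OF S] and SC = star_closed_dims[OF S]
  define ker where "ker X = {v \<in> carrier_vec n. X *\<^sub>v v = 0\<^sub>v n}" for X :: "complex mat"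
  have ker: "vec_subspace n (ker X)" if "X \<in> S" for X
    unfolding ker_def using SD(1)[OF that] by (rule kernel_subspace)
  obtain x0 where "x0 \<in> S \<and> x0 \<noteq> 0\<^sub>m n n" using S0 SD(2) by blast
  then have "\<exists>x. (x \<in> S \<and> x \<noteq> 0\<^sub>m n n) \<and>
      (\<forall>y. y \<in> S \<and> y \<noteq> 0\<^sub>m n n \<longrightarrow> orth_dim n (ker y) \<le> orth_dim n (ker x))"
    using orth_dim_le[OF ker] by (intro ex_has_greatest_nat[of _ _ _ "Suc n"]) (auto simp: less_Suc_eq_le)
  then obtain x where x: "x \<in> S" "x \<noteq> 0\<^sub>m n n"
    and xmax: "\<And>y. y \<in> S \<Longrightarrow> y \<noteq> 0\<^sub>m n n \<Longrightarrow> orth_dim n (ker y) \<le> orth_dim n (ker x)" by blast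
  define h where "h = mat_adjoint x * x"
  have hS: "h \<in> S" using x SD by (auto simp: h_def)
  have hc: "h \<in> carrier_mat n n" by (rule SD(1)[OF hS])
  have [simp]: "dim_row h = n" "dim_col h = n" using hc by auto
  have h0: "h \<noteq> 0\<^sub>m n n"
    using adjoint_mult_self_zero[OF SD(1)[OF x(1)]] x(2) by (auto simp: h_def)
  have hh: "mat_adjoint h = h"
    using SC[OF x(1)] by (simp add: h_def mat_adjoint_mult)
  \<comment> \<open>The maximality of \<open>x\<close> in usable form: \<open>ker x\<close> lies in
    the kernel of \<open>h\<close>, so an element of \<open>S\<close> that kills everything
    \<open>h\<close> kills, and in addition a vector that \<open>h\<close> does not kill, has a
    strictly larger kernel than \<open>x\<close> and must vanish.\<close>
  have hmax: "y = 0\<^sub>m n n"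
    if y: "y \<in> S" and sub: "\<And>v. v \<in> carrier_vec n \<Longrightarrow> h *\<^sub>v v = 0\<^sub>v n \<Longrightarrow> y *\<^sub>v v = 0\<^sub>v n"
      and u: "u \<in> carrier_vec n" "y *\<^sub>v u = 0\<^sub>v n" "h *\<^sub>v u \<noteq> 0\<^sub>v n" for y u
  proof (rule ccontr)
    assume "y \<noteq> 0\<^sub>m n n"
    from xmax[OF y this] have le: "orth_dim n (ker y) \<le> orth_dim n (ker x)" .
    have hx: "h *\<^sub>v v = 0\<^sub>v n" if "v \<in> carrier_vec n" "x *\<^sub>v v = 0\<^sub>v n" for v
      using that SC[OF x(1)] by (simp add: h_def mat_assoc_vec)
    have "ker x \<subseteq> ker y" using sub hx by (auto simp: ker_def)
    moreover have "u \<in> ker y" "u \<notin> ker x" using u hx by (auto simp: ker_def)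
    ultimately have "ker x \<subset> ker y" by blast
    from orth_dim_strict_mono[OF ker[OF x(1)] ker[OF y] this] le show False by simp
  qed
  \<comment> \<open>The eigenvector is sought in the range of \<open>h\<close>: as \<open>h\<close>
    is self-adjoint, its range meets its kernel only in zero, so the eigenvalue is not zero.\<close>
  define U where "U = {h *\<^sub>v v | v. v \<in> carrier_vec n}"
  have U: "vec_subspace n U"
    unfolding vec_subspace_def
  proof (intro conjI ballI allI)
    show "U \<subseteq> carrier_vec n" using hc by (auto simp: U_def)
    show "0\<^sub>v n \<in> U" by (auto simp: U_def intro!: exI[of _ "0\<^sub>v n"])
    show "a + b \<in> U" if ab: "a \<in> U" "b \<in> U" for a b
    proof -
      obtain v w where "v \<in> carrier_vec n" "w \<in> carrier_vec n" "a = h *\<^sub>v v" "b = h *\<^sub>v w"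
        using ab by (auto simp: U_def)
      then show ?thesis by (auto simp: U_def mat_vec_distribs intro!: exI[of _ "v + w"])
    qed
    show "c \<cdot>\<^sub>v a \<in> U" if a: "a \<in> U" for c a
    proof -
      obtain v where "v \<in> carrier_vec n" "a = h *\<^sub>v v" using a by (auto simp: U_def)
      then show ?thesis by (auto simp: U_def mat_vec_distribs intro!: exI[of _ "c \<cdot>\<^sub>v v"])
    qed
  qed
  obtain w0 where w0: "w0 \<in> carrier_vec n" "h *\<^sub>v w0 \<noteq> 0\<^sub>v n" using mat_nonzero_mult_vec[OF hc h0] .
  have hw0: "h *\<^sub>v w0 \<in> U" using w0 by (auto simp: U_def)
  have hU: "h *\<^sub>v u \<in> U" if "u \<in> U" for u
  proof -
    have "u \<in> carrier_vec n" using that U by (auto simp: vec_subspace_def)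
    then show ?thesis unfolding U_def by blast
  qed
  obtain u l where u: "u \<in> U" "u \<noteq> 0\<^sub>v n" "h *\<^sub>v u = l \<cdot>\<^sub>v u"
    by (rule invariant_subspace_eigenvector[OF U hw0 w0(2) hc hU])
  obtain w where w: "w \<in> carrier_vec n" "u = h *\<^sub>v w" using u(1) by (auto simp: U_def)
  have uc: "u \<in> carrier_vec n" using w hc by auto
  have hu: "h *\<^sub>v u \<noteq> 0\<^sub>v n"
  proof
    assume "h *\<^sub>v u = 0\<^sub>v n"
    then have "(mat_adjoint h * h) *\<^sub>v w = 0\<^sub>v n" using w by (simp add: hh mat_assoc_vec)
    from adjoint_mult_self_vec_zero[OF hc w(1) this] u w show False by simp
  qed
  have l0: "l \<noteq> 0" using hu u uc by auto
  have "h * h + (-l) \<cdot>\<^sub>m h = 0\<^sub>m n n"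
  proof (rule hmax[OF _ _ uc _ hu])
    show "h * h + (-l) \<cdot>\<^sub>m h \<in> S" using SD hS by auto
    show "(h * h + (-l) \<cdot>\<^sub>m h) *\<^sub>v v = 0\<^sub>v n" if "v \<in> carrier_vec n" "h *\<^sub>v v = 0\<^sub>v n" for v
      using that by (auto simp: mat_vec_distribs mat_assoc_vec intro!: eq_vecI)
    show "(h * h + (-l) \<cdot>\<^sub>m h) *\<^sub>v u = 0\<^sub>v n"
      using uc u(3) by (auto simp: mat_vec_distribs mat_assoc_vec intro!: eq_vecI)
  qed
  then have sq: "h * h = l \<cdot>\<^sub>m h" using hc by (intro add_smult_neg_zero[of _ _ _ n n]) auto
  \<comment> \<open>Comparing \<open>sq\<close> with its adjoint shows that \<open>l\<close> is
    real, so that \<open>p\<close> below is self-adjoint.\<close>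
  have "h * h = cnj l \<cdot>\<^sub>m h"
    using arg_cong[OF sq, of mat_adjoint] by (simp add: mat_adjoint_mult mat_adjoint_smult hh)
  then have "cnj l \<cdot>\<^sub>m h = l \<cdot>\<^sub>m h" using sq by simp
  then have cl: "cnj l = l" using smult_mat_left_cancel[OF _ hc h0] by blast
  define p where "p = (1 / l) \<cdot>\<^sub>m h"
  have hp: "h = l \<cdot>\<^sub>m p" using l0 hc by (auto simp: p_def intro!: eq_matI)
  have pS: "p \<in> S" using SD hS by (auto simp: p_def)
  have pc: "p \<in> carrier_mat n n" by (rule SD(1)[OF pS])
  have [simp]: "dim_row p = n" "dim_col p = n" using pc by auto
  have p0: "p \<noteq> 0\<^sub>m n n" using h0 hp by auto
  have pp: "p * p = p" using l0 by (auto simp: p_def mat_distribs sq intro!: eq_matI)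
  have ph: "mat_adjoint p = p" using cl by (simp add: p_def mat_adjoint_smult hh)
  have "\<exists>\<mu>. p * x * p = \<mu> \<cdot>\<^sub>m p" if xS: "x \<in> S" for x
  proof -
    have [simp]: "dim_row x = n" "dim_col x = n" using SC[OF xS] by auto
    define y where "y = p * x * p"
    have yS: "y \<in> S" using SD xS pS by (auto simp: y_def)
    have yc: "y \<in> carrier_mat n n" by (rule SD(1)[OF yS])
    have [simp]: "dim_row y = n" "dim_col y = n" using yc by auto
    have py: "p * y = y" unfolding y_def by (simp add: mat_assoc pp flip: mat_assoc[of p p])
    define R where "R = {v \<in> carrier_vec n. p *\<^sub>v v = v}"
    have R: "vec_subspace n R"
      by (auto simp: vec_subspace_def R_def mat_vec_distribs)
    obtain v0 where v0: "v0 \<in> carrier_vec n" "p *\<^sub>v v0 \<noteq> 0\<^sub>v n" using mat_nonzero_mult_vec[OF pc p0] .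
    have pv0: "p *\<^sub>v v0 \<in> R" using v0 pc by (simp add: R_def pp flip: mat_assoc_vec)
    have yR: "y *\<^sub>v v \<in> R" if "v \<in> R" for v
      using that yc mat_assoc_vec[of p y v] by (auto simp: R_def py)
    obtain v \<mu> where v: "v \<in> R" "v \<noteq> 0\<^sub>v n" "y *\<^sub>v v = \<mu> \<cdot>\<^sub>v v"
      by (rule invariant_subspace_eigenvector[OF R pv0 v0(2) yc yR])
    have vc: "v \<in> carrier_vec n" "p *\<^sub>v v = v" using v by (auto simp: R_def)
    have "y + (-\<mu>) \<cdot>\<^sub>m p = 0\<^sub>m n n"
    proof (rule hmax)
      show "y + (-\<mu>) \<cdot>\<^sub>m p \<in> S" using SD yS pS by auto
      show "v \<in> carrier_vec n" by (rule vc)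
      show "(y + (-\<mu>) \<cdot>\<^sub>m p) *\<^sub>v v = 0\<^sub>v n"
        using vc v(3) by (auto simp: mat_vec_distribs intro!: eq_vecI)
      show "h *\<^sub>v v \<noteq> 0\<^sub>v n"
        using vc v(2) l0 by (simp add: hp mat_vec_distribs vec_eq_iff)
      show "(y + (-\<mu>) \<cdot>\<^sub>m p) *\<^sub>v a = 0\<^sub>v n" if a: "a \<in> carrier_vec n" "h *\<^sub>v a = 0\<^sub>v n" for a
      proof -
        have "p *\<^sub>v a = 0\<^sub>v n" using a by (auto simp: p_def mat_vec_distribs)
        then show ?thesis using a by (auto simp: y_def mat_vec_distribs mat_assoc_vec intro!: eq_vecI)
      qed
    qed
    then have "y = \<mu> \<cdot>\<^sub>m p" using yc pc by (rule add_smult_neg_zero)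
    then show ?thesis by (auto simp: y_def)
  qed
  then show ?thesis using that pS p0 pp ph by blast
qed

section \<open>Matrix units and the splitting off of a full matrix block\<close>

abbreviation mat_unit :: "nat \<Rightarrow> nat \<Rightarrow> nat \<Rightarrow> nat \<Rightarrow> complex mat" where
  "mat_unit n m i j \<equiv> mat n m (\<lambda>(a, b). if a = i \<and> b = j then 1 else 0)"

text \<open>Checks a property stable under linear operations on matrix units only. The induction
  runs over a finite set of positions outside which the matrix vanishes.\<close>

lemma mat_unit_induct:
  assumes Y: "Y \<in> carrier_mat n m"
    and zero: "Q (0\<^sub>m n m :: complex mat)"
    and add: "\<And>A B. A \<in> carrier_mat n m \<Longrightarrow> B \<in> carrier_mat n m \<Longrightarrow> Q A \<Longrightarrow> Q B \<Longrightarrow> Q (A + B)"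
    and smult: "\<And>c A. A \<in> carrier_mat n m \<Longrightarrow> Q A \<Longrightarrow> Q (c \<cdot>\<^sub>m A)"
    and unit: "\<And>i j. i < n \<Longrightarrow> j < m \<Longrightarrow> Q (mat_unit n m i j)"
  shows "Q Y"
proof -
  have "Q A" if "finite T" "T \<subseteq> {..<n} \<times> {..<m}" "A \<in> carrier_mat n m"
    "\<And>i j. i < n \<Longrightarrow> j < m \<Longrightarrow> (i, j) \<notin> T \<Longrightarrow> A $$ (i, j) = 0" for T A
    using that
  proof (induction T arbitrary: A)
    case empty
    then have "A = 0\<^sub>m n m" by (intro eq_matI) auto
    with zero show ?case by simp
  next
    case (insert t T)
    obtain i j where t: "t = (i, j)" by (cases t)
    have ij: "i < n" "j < m" using insert.prems t by auto
    let ?E = "mat_unit n m i j :: complex mat"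
    define B where "B = mat n m (\<lambda>(a, b). if a = i \<and> b = j then 0 else A $$ (a, b))"
    have "Q B"
      by (rule insert.IH) (use insert.prems t in \<open>auto simp: B_def\<close>)
    then have "Q (A $$ (i, j) \<cdot>\<^sub>m ?E + B)"
      using unit[OF ij] by (intro add smult) (auto simp: B_def)
    moreover have "A $$ (i, j) \<cdot>\<^sub>m ?E + B = A"
      using insert.prems by (intro eq_matI) (auto simp: B_def)
    ultimately show ?case by simp
  qed
  from this[of "{..<n} \<times> {..<m}"] Y show ?thesis by auto
qed

lemma mat_add_neg_self [simp]:
  fixes A :: "complex mat"
  shows "A \<in> carrier_mat n m \<Longrightarrow> A + (-1) \<cdot>\<^sub>m A = 0\<^sub>m n m"
  by (rule eq_matI) auto

text \<open>It grows when the algebra shrinks; its codimension is the measure for the block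
  decomposition.\<close>

definition common_kernel :: "nat \<Rightarrow> complex mat set \<Rightarrow> complex vec set" where
  "common_kernel n S = {v \<in> carrier_vec n. \<forall>x\<in>S. x *\<^sub>v v = 0\<^sub>v n}"

lemma common_kernel_subspace:
  assumes "S \<subseteq> carrier_mat n n"
  shows "vec_subspace n (common_kernel n S)"
proof -
  have [simp]: "dim_row x = n" "dim_col x = n" if "x \<in> S" for x
    using assms that by auto
  show ?thesis by (auto simp: vec_subspace_def common_kernel_def mat_vec_distribs)
qed

definition sub_alg :: "nat \<Rightarrow> complex mat set \<Rightarrow> complex mat star_alg" where
  "sub_alg n S = (matrix_alg n)\<lparr>elems := S\<rparr>"

lemma sub_alg_simps [simp]:
  "elems (sub_alg n S) = S" "zero_alg (sub_alg n S) = 0\<^sub>m n n" "add_alg (sub_alg n S) = (+)"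
  "scale_alg (sub_alg n S) = (\<cdot>\<^sub>m)" "mult_alg (sub_alg n S) = (*)" "star (sub_alg n S) = mat_adjoint"
  by (simp_all add: sub_alg_def matrix_alg_def)

lemma matrix_alg_simps [simp]:
  "elems (matrix_alg n) = carrier_mat n n" "zero_alg (matrix_alg n) = 0\<^sub>m n n"
  "add_alg (matrix_alg n) = (+)" "scale_alg (matrix_alg n) = (\<cdot>\<^sub>m)"
  "mult_alg (matrix_alg n) = (*)" "star (matrix_alg n) = mat_adjoint"
  by (simp_all add: matrix_alg_def)

text \<open>For a vector \<open>\<xi>\<close> in the range of a minimal projection, the algebra acts irreducibly on the
  orbit \<open>U\<close> of \<open>\<xi>\<close>.  With the columns of \<open>W\<close> an orthonormal basis of \<open>U\<close>, the ideal \<open>J\<close> of elements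
  annihilated by everything that vanishes on \<open>U\<close> is mapped isomorphically onto the full matrix
  algebra by \<open>x \<mapsto> W\<^sup>* x W\<close>.\<close>

lemma star_closed_split_matrix_block:
  assumes S: "star_closed n S" and S0: "S \<noteq> {0\<^sub>m n n}"
  obtains b \<phi> \<theta> S' where
    "b > 0" "star_closed n S'" "S' \<subseteq> S"
    "orth_dim n (common_kernel n S) < orth_dim n (common_kernel n S')"
    "star_hom (sub_alg n S) (matrix_alg b) \<phi>" "star_hom (matrix_alg b) (sub_alg n S) \<theta>"
    "\<And>y. y \<in> carrier_mat b b \<Longrightarrow> \<phi> (\<theta> y) = y"
    "\<And>s. s \<in> S' \<Longrightarrow> \<phi> s = 0\<^sub>m b b"
    "\<And>x. x \<in> S \<Longrightarrow> x + (-1) \<cdot>\<^sub>m \<theta> (\<phi> x) \<in> S'"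
    "\<And>s y. s \<in> S' \<Longrightarrow> y \<in> carrier_mat b b \<Longrightarrow> s * \<theta> y = 0\<^sub>m n n \<and> \<theta> y * s = 0\<^sub>m n n"
proof -
  note SD = star_closedD[OF S] and SC = star_closed_dims[OF S]
  obtain p where p: "p \<in> S" "p \<noteq> 0\<^sub>m n n" and pp: "p * p = p" and ph: "mat_adjoint p = p"
    and pmin: "\<And>x. x \<in> S \<Longrightarrow> \<exists>\<mu>. p * x * p = \<mu> \<cdot>\<^sub>m p"
    by (rule star_closed_minimal_projection[OF S S0]) blast
  have pc: "p \<in> carrier_mat n n" by (rule SD(1)[OF p(1)])
  note [simp] = SC[OF p(1)]
  obtain v0 where v0: "v0 \<in> carrier_vec n" "p *\<^sub>v v0 \<noteq> 0\<^sub>v n"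
    by (rule mat_nonzero_mult_vec[OF pc p(2)])
  define \<xi> where "\<xi> = p *\<^sub>v v0"
  have xic: "\<xi> \<in> carrier_vec n" using v0 pc by (auto simp: \<xi>_def)
  have [simp]: "dim_vec \<xi> = n" using xic by auto
  have pxi: "p *\<^sub>v \<xi> = \<xi>" using v0 mat_assoc_vec[of p p v0] by (simp add: \<xi>_def pp)
  have xi0: "\<xi> \<noteq> 0\<^sub>v n" using v0 by (simp add: \<xi>_def)
  define N where "N = \<xi> \<bullet>c \<xi>"
  have N0: "N \<noteq> 0" using conjugate_square_eq_0_vec[OF xic] xi0 by (simp add: N_def)
  \<comment> \<open>The scalar that minimality provides is found by applying both sides to
    \<open>\<xi>\<close>, which \<open>p\<close> fixes, and pairing with
    \<open>\<xi>\<close>.\<close>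
  have mu: "p * x * p = (((x *\<^sub>v \<xi>) \<bullet>c \<xi>) / N) \<cdot>\<^sub>m p" if x: "x \<in> S" for x
  proof -
    obtain \<mu> where m: "p * x * p = \<mu> \<cdot>\<^sub>m p" using pmin[OF x] by blast
    note [simp] = SC[OF x]
    have "(p * x * p) *\<^sub>v \<xi> = p *\<^sub>v (x *\<^sub>v \<xi>)" by (simp add: mat_assoc_vec pxi)
    then have "p *\<^sub>v (x *\<^sub>v \<xi>) = \<mu> \<cdot>\<^sub>v \<xi>" by (simp add: m mat_vec_distribs pxi)
    then have "(p *\<^sub>v (x *\<^sub>v \<xi>)) \<bullet>c \<xi> = \<mu> * N" using xic by (simp add: N_def)
    moreover have "(p *\<^sub>v (x *\<^sub>v \<xi>)) \<bullet>c \<xi> = (x *\<^sub>v \<xi>) \<bullet>c \<xi>"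
      using inner_mat_adjoint[OF pc mult_mat_vec_carrier[OF SD(1)[OF x] xic] xic]
      by (simp add: ph pxi)
    ultimately show ?thesis using m N0 by simp
  qed
  define U where "U = {x *\<^sub>v \<xi> | x. x \<in> S}"
  have U: "vec_subspace n U"
    unfolding vec_subspace_def
  proof (intro conjI ballI allI)
    show "U \<subseteq> carrier_vec n" using SD(1) xic by (auto simp: U_def intro!: mult_mat_vec_carrier[of _ n n])
    show "0\<^sub>v n \<in> U" using SD(2) by (auto simp: U_def intro!: exI[of _ "0\<^sub>m n n"])
    show "u + v \<in> U" if uv: "u \<in> U" "v \<in> U" for u v
    proof -
      obtain x y where "x \<in> S" "y \<in> S" "u = x *\<^sub>v \<xi>" "v = y *\<^sub>v \<xi>" using uv by (auto simp: U_def)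
      then show ?thesis
        using SD(3)[of x y] SC by (auto simp: U_def mat_vec_distribs intro!: exI[of _ "x + y"])
    qed
    show "c \<cdot>\<^sub>v u \<in> U" if u: "u \<in> U" for c u
    proof -
      obtain x where "x \<in> S" "u = x *\<^sub>v \<xi>" using u by (auto simp: U_def)
      then show ?thesis
        using SD(5)[of x] SC by (auto simp: U_def mat_vec_distribs intro!: exI[of _ "c \<cdot>\<^sub>m x"])
    qed
  qed
  have SU: "x *\<^sub>v u \<in> U" if xu: "x \<in> S" "u \<in> U" for x u
  proof -
    obtain y where y: "y \<in> S" "u = y *\<^sub>v \<xi>" using xu by (auto simp: U_def)
    then have "x *\<^sub>v u = (x * y) *\<^sub>v \<xi>" using SC xu by (simp add: mat_assoc_vec)
    then show ?thesis using SD(4)[OF xu(1) y(1)] by (auto simp: U_def)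
  qed
  have xiU: "\<xi> \<in> U" using p pxi by (auto simp: U_def intro!: exI[of _ p])
  define b where "b = orth_dim n U"
  obtain W where W: "orthonormal_in n b U W" unfolding b_def by (rule orth_dim_attained[OF U])
  have Wc: "W \<in> carrier_mat n b" and WW: "mat_adjoint W * W = 1\<^sub>m b"
    and WU: "\<And>v. v \<in> carrier_vec b \<Longrightarrow> W *\<^sub>v v \<in> U"
    using W by (auto simp: orthonormal_in_def)
  have [simp]: "dim_row W = n" "dim_col W = b" using Wc by auto
  have basis: "W *\<^sub>v (mat_adjoint W *\<^sub>v u) = u" if "u \<in> U" for u
    using orth_dim_basis[OF U _ that] W by (simp add: b_def)
  have b0: "b > 0"
  proof (rule ccontr)
    assume "\<not> b > 0"
    then have "W *\<^sub>v (mat_adjoint W *\<^sub>v \<xi>) = 0\<^sub>v n"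
      by (intro eq_vecI) (auto simp: scalar_prod_def)
    then show False using basis[OF xiU] xi0 by simp
  qed
  define \<phi> where "\<phi> x = mat_adjoint W * x * W" for x
  \<comment> \<open>Since \<open>U\<close> is invariant under \<open>S\<close>, projecting back to
    \<open>U\<close> changes nothing: \<open>W\<close> intertwines \<open>\<phi> x\<close> with
    \<open>x\<close>. Multiplicativity of \<open>\<phi>\<close> and its kernel are both read off
    from this.\<close>
  have xW: "x * W = W * \<phi> x" if x: "x \<in> S" for x
  proof (rule mat_eq_by_mult_vec[of _ n b])
    note [simp] = SC[OF x]
    show "x * W \<in> carrier_mat n b" "W * \<phi> x \<in> carrier_mat n b" by (auto simp: \<phi>_def intro!: carrier_matI)
    fix v :: "complex vec" assume v: "v \<in> carrier_vec b"
    then show "x * W *\<^sub>v v = W * \<phi> x *\<^sub>v v"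
      using basis[OF SU[OF x WU[OF v]]] by (simp add: \<phi>_def mat_assoc_vec)
  qed
  have phic: "\<phi> x \<in> carrier_mat b b" if "x \<in> S" for x using SC[OF that] by (auto simp: \<phi>_def intro!: carrier_matI)
  have phi_adj: "\<phi> (mat_adjoint x) = mat_adjoint (\<phi> x)" if "x \<in> S" for x
    using SC[OF that] by (simp add: \<phi>_def mat_adjoint_mult mat_assoc)
  have phi_eq: "\<phi> x = y" if "x \<in> S" "x * W = W * y" "y \<in> carrier_mat b b" for x y
  proof -
    have "\<phi> x = mat_adjoint W * (W * y)" using that SC[OF that(1)] by (simp add: \<phi>_def mat_assoc)
    also have "\<dots> = y" using that(3) mat_assoc[of "mat_adjoint W" W y] WW by simp
    finally show ?thesis .
  qed
  have adj0: "mat_adjoint x * W = 0\<^sub>m n b" if "x \<in> S" "x * W = 0\<^sub>m n b" for x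
  proof -
    have "\<phi> x = 0\<^sub>m b b" using that by (intro phi_eq) auto
    then show ?thesis using xW[OF SD(6)[OF that(1)]] phi_adj[OF that(1)] by simp
  qed
  \<comment> \<open>The elements with \<open>x * W = 0\<close> form the kernel of
    \<open>\<phi>\<close>, and \<open>J\<close> is its annihilator. Imposing the condition on the
    adjoint of \<open>t\<close> too makes \<open>J\<close> closed under adjoints by
    construction.\<close>
  define J where "J = {t \<in> S. \<forall>x\<in>S. x * W = 0\<^sub>m n b \<longrightarrow> x * t = 0\<^sub>m n n \<and> x * mat_adjoint t = 0\<^sub>m n n}"
  have JS: "t \<in> S" if "t \<in> J" for t using that by (simp add: J_def)
  have J0: "0\<^sub>m n n \<in> J" using SD(2) SC by (auto simp: J_def)
  have Jadd: "s + t \<in> J" if "s \<in> J" "t \<in> J" for s t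
    using that SC SD(3) by (auto simp: J_def mat_distribs mat_adjoint_add)
  have Jsmult: "c \<cdot>\<^sub>m t \<in> J" if "t \<in> J" for c t
    using that SC SD(5) by (auto simp: J_def mat_distribs mat_adjoint_smult)
  have Jadj: "mat_adjoint t \<in> J" if "t \<in> J" for t using that SD(6) by (auto simp: J_def)
  have Jideal: "x * t \<in> J" if x: "x \<in> S" and t: "t \<in> J" for x t
  proof -
    note [simp] = SC[OF x] SC[OF JS[OF t]]
    have "y * (x * t) = 0\<^sub>m n n \<and> y * mat_adjoint (x * t) = 0\<^sub>m n n"
      if y: "y \<in> S" "y * W = 0\<^sub>m n b" for y
    proof -
      note [simp] = SC[OF y(1)]
      have "(y * x) * W = (y * W) * \<phi> x" using xW[OF x] phic[OF x] by (simp add: mat_assoc)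
      then have "(y * x) * W = 0\<^sub>m n b" using y phic[OF x] by simp
      moreover have "y * x \<in> S" using SD x y by auto
      ultimately have "(y * x) * t = 0\<^sub>m n n" using t by (auto simp: J_def)
      moreover have "y * mat_adjoint t = 0\<^sub>m n n" using t y by (auto simp: J_def)
      ultimately show ?thesis
        using mat_assoc[of y "mat_adjoint t" "mat_adjoint x"] by (simp add: mat_assoc mat_adjoint_mult)
    qed
    then show ?thesis using SD(4)[OF x JS[OF t]] by (auto simp: J_def)
  qed
  \<comment> \<open>The difference \<open>d\<close> lies in \<open>J\<close> and in the kernel of
    \<open>\<phi>\<close>, so the condition defining \<open>J\<close> can be applied to
    \<open>d\<close> itself and gives \<open>d * mat_adjoint d = 0\<close>.\<close>
  have Juniq: "s = t" if st: "s \<in> J" "t \<in> J" "s * W = t * W" for s t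
  proof -
    note [simp] = SC[OF JS[OF st(1)]] SC[OF JS[OF st(2)]]
    define d where "d = s + (-1) \<cdot>\<^sub>m t"
    have dJ: "d \<in> J" using Jadd Jsmult st by (auto simp: d_def)
    note [simp] = SC[OF JS[OF dJ]]
    have "d * W = 0\<^sub>m n b" using st(3) by (auto simp: d_def mat_distribs)
    then have "d * mat_adjoint d = 0\<^sub>m n n" using dJ by (auto simp: J_def)
    then have "mat_adjoint d = 0\<^sub>m n n"
      using adjoint_mult_self_zero[of "mat_adjoint d" n n] SD(1)[OF SD(6)[OF JS[OF dJ]]] by simp
    from arg_cong[OF this, of mat_adjoint] have "d = 0\<^sub>m n n" by simp
    then show ?thesis
      using add_smult_neg_zero[of s 1 t n n] SD(1) JS st by (auto simp: d_def)
  qed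
  have Junit: "\<exists>t\<in>J. t * W = W * mat_unit b b i j"
    (is "\<exists>t\<in>J. t * W = W * ?E") if ij: "i < b" "j < b" for i j
  proof -
    have "\<exists>x. x \<in> S \<and> W *\<^sub>v unit_vec b k = x *\<^sub>v \<xi>" if "k < b" for k
      using WU[of "unit_vec b k"] by (auto simp: U_def)
    then obtain X where X: "\<And>k. k < b \<Longrightarrow> X k \<in> S" "\<And>k. k < b \<Longrightarrow> W *\<^sub>v unit_vec b k = X k *\<^sub>v \<xi>"
      by metis
    \<comment> \<open>\<open>V k\<close> still sends \<open>\<xi>\<close> to the k-th basis vector
      of \<open>U\<close>; the factor \<open>p\<close> brings products
      \<open>mat_adjoint (V j) * V k\<close> into the form that \<open>mu\<close> evaluates.\<close>
    define V where "V k = X k * p" for k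
    have VS: "V k \<in> S" if "k < b" for k using X(1)[OF that] p SD by (auto simp: V_def)
    have Vdim [simp]: "dim_row (V k) = n" "dim_col (V k) = n" if "k < b" for k
      using SC[OF VS[OF that]] by auto
    have Xdim [simp]: "dim_row (X k) = n" "dim_col (X k) = n" if "k < b" for k
      using SC[OF X(1)[OF that]] by auto
    have Vxi: "V k *\<^sub>v \<xi> = W *\<^sub>v unit_vec b k" if "k < b" for k
      using that X(2)[OF that] by (simp add: V_def mat_assoc_vec pxi)
    have Wunit: "W *\<^sub>v unit_vec b k \<in> carrier_vec n" for k using Wc by auto
    \<comment> \<open>\<open>x * X k\<close> kills \<open>\<xi>\<close>, so \<open>mu\<close> gives
      \<open>p * Z * p = 0\<close>, and this product is \<open>x * V k\<close> multiplied on the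
      left by its adjoint.\<close>
    have xV: "x * V k = 0\<^sub>m n n" if x: "x \<in> S" "x * W = 0\<^sub>m n b" and k: "k < b" for x k
    proof -
      note [simp] = SC[OF x(1)] Xdim[OF k] Vdim[OF k]
      define Z where "Z = mat_adjoint (x * X k) * (x * X k)"
      have xX: "x * X k \<in> S" using SD x X k by auto
      have Z: "Z \<in> S" using SD xX by (auto simp: Z_def)
      have "x *\<^sub>v (X k *\<^sub>v \<xi>) = x * W *\<^sub>v unit_vec b k" using X(2)[OF k] by (simp add: mat_assoc_vec)
      also have "\<dots> = 0\<^sub>v n" using x by (intro eq_vecI) auto
      finally have "Z *\<^sub>v \<xi> = 0\<^sub>v n" by (simp add: Z_def mat_assoc_vec)
      then have "p * Z * p = 0\<^sub>m n n" using mu[OF Z] xic by (auto intro!: eq_matI)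
      then have "mat_adjoint (x * V k) * (x * V k) = 0\<^sub>m n n"
        by (simp add: Z_def V_def mat_adjoint_mult mat_assoc ph)
      then show ?thesis using adjoint_mult_self_zero[of "x * V k" n n] SD VS[OF k] x by auto
    qed
    \<comment> \<open>The adjoint of \<open>V j\<close> sends the j-th basis vector to
      \<open>\<xi>\<close> divided by \<open>N\<close> and the others to zero, and
      \<open>V i\<close> sends \<open>\<xi>\<close> to the i-th one. The factor \<open>N\<close>,
      the squared length of \<open>\<xi>\<close>, makes this exactly the matrix unit.\<close>
    define t where "t = N \<cdot>\<^sub>m (V i * mat_adjoint (V j))"
    have tS: "t \<in> S" using SD VS ij by (auto simp: t_def)
    note [simp] = SC[OF tS]
    have "x * t = 0\<^sub>m n n \<and> x * mat_adjoint t = 0\<^sub>m n n" if x: "x \<in> S" "x * W = 0\<^sub>m n b" for x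
    proof -
      note [simp] = SC[OF x(1)]
      have "x * (V i * mat_adjoint (V j)) = 0\<^sub>m n n"
        using xV[OF x ij(1)] ij by (simp flip: mat_assoc)
      moreover have "x * (V j * mat_adjoint (V i)) = 0\<^sub>m n n"
        using xV[OF x ij(2)] ij by (simp flip: mat_assoc)
      ultimately show ?thesis
        using ij by (simp add: t_def mat_distribs mat_adjoint_smult mat_adjoint_mult)
    qed
    then have "t \<in> J" using tS by (auto simp: J_def)
    moreover have "t * W = W * ?E"
    proof (rule mat_eq_by_unit_vec[of _ n b])
      show "t * W \<in> carrier_mat n b" "W * ?E \<in> carrier_mat n b" using Wc SD(1)[OF tS] by auto
      fix k assume k: "k < b"
      note [simp] = ij k
      have Y: "mat_adjoint (X j) * X k \<in> S" using SD X ij k by auto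
      have "((mat_adjoint (X j) * X k) *\<^sub>v \<xi>) \<bullet>c \<xi> = (W *\<^sub>v unit_vec b k) \<bullet>c (W *\<^sub>v unit_vec b j)"
      proof -
        have "X k *\<^sub>v \<xi> \<in> carrier_vec n" using Wunit[of k] X(2)[OF k] by simp
        from inner_mat_adjoint[OF SD(1)[OF SD(6)[OF X(1)[OF ij(2)]]] this xic] show ?thesis
          by (simp add: mat_assoc_vec X(2))
      qed
      also have "\<dots> = unit_vec b k \<bullet>c unit_vec b j"
      proof -
        have "mat_adjoint W *\<^sub>v (W *\<^sub>v unit_vec b j) = unit_vec b j"
          using mat_assoc_vec[of "mat_adjoint W" W "unit_vec b j"] WW by simp
        then show ?thesis using inner_mat_adjoint[OF Wc unit_vec_carrier Wunit, of k j] by simp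
      qed
      also have "\<dots> = (if k = j then 1 else 0)" by auto
      finally have in1: "((mat_adjoint (X j) * X k) *\<^sub>v \<xi>) \<bullet>c \<xi> = (if k = j then 1 else 0)" .
      have "mat_adjoint (V j) *\<^sub>v (W *\<^sub>v unit_vec b k) = (p * (mat_adjoint (X j) * X k) * p) *\<^sub>v \<xi>"
        by (simp add: X(2) V_def mat_adjoint_mult ph mat_assoc_vec pxi)
      also have "\<dots> = ((if k = j then 1 else 0) / N) \<cdot>\<^sub>v \<xi>"
        by (simp add: mu[OF Y] in1 mat_vec_distribs pxi)
      finally have 1: "mat_adjoint (V j) *\<^sub>v (W *\<^sub>v unit_vec b k) = ((if k = j then 1 else 0) / N) \<cdot>\<^sub>v \<xi>" .
      have "t * W *\<^sub>v unit_vec b k = (if k = j then 1 else 0) \<cdot>\<^sub>v (W *\<^sub>v unit_vec b i)"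
        using N0 by (simp add: t_def mat_assoc_vec mat_vec_distribs 1 Vxi smult_smult_assoc)
      moreover have "?E *\<^sub>v unit_vec b k = (if k = j then 1 else 0) \<cdot>\<^sub>v unit_vec b i"
        by (rule eq_vecI) auto
      then have "W * ?E *\<^sub>v unit_vec b k = (if k = j then 1 else 0) \<cdot>\<^sub>v (W *\<^sub>v unit_vec b i)"
        by (simp add: mat_assoc_vec mat_vec_distribs)
      ultimately show "t * W *\<^sub>v unit_vec b k = W * ?E *\<^sub>v unit_vec b k" by simp
    qed
    ultimately show ?thesis by blast
  qed
  have Jex: "\<exists>t\<in>J. t * W = W * y" if "y \<in> carrier_mat b b" for y
    using that
  proof (rule mat_unit_induct[where Q = "\<lambda>y. \<exists>t\<in>J. t * W = W * y"])
    show "\<exists>t\<in>J. t * W = W * 0\<^sub>m b b" using J0 by (intro bexI[of _ "0\<^sub>m n n"]) simp_all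
    show "\<exists>t\<in>J. t * W = W * (A + B)" if AB: "A \<in> carrier_mat b b" "B \<in> carrier_mat b b"
      "\<exists>t\<in>J. t * W = W * A" "\<exists>t\<in>J. t * W = W * B" for A B
    proof -
      obtain s t where "s \<in> J" "s * W = W * A" "t \<in> J" "t * W = W * B" using AB by blast
      then show ?thesis
        using Jadd[of s t] AB(1,2) SC[OF JS[of s]] SC[OF JS[of t]]
        by (intro bexI[of _ "s + t"]) (auto simp: mat_distribs)
    qed
    show "\<exists>t\<in>J. t * W = W * (c \<cdot>\<^sub>m A)" if A: "A \<in> carrier_mat b b" "\<exists>t\<in>J. t * W = W * A" for c A
    proof -
      obtain t where "t \<in> J" "t * W = W * A" using A by blast
      then show ?thesis
        using Jsmult[of t c] A(1) SC[OF JS[of t]] by (intro bexI[of _ "c \<cdot>\<^sub>m t"]) (auto simp: mat_distribs)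
    qed
  qed (rule Junit)
  \<comment> \<open>\<open>\<theta>\<close> inverts \<open>\<phi>\<close> on \<open>J\<close>. Each
    of its homomorphism laws holds because both sides lie in \<open>J\<close> and agree after
    multiplication by \<open>W\<close>, which \<open>thu\<close> turns into equality.\<close>
  then obtain \<theta> where th: "\<And>y. y \<in> carrier_mat b b \<Longrightarrow> \<theta> y \<in> J" "\<And>y. y \<in> carrier_mat b b \<Longrightarrow> \<theta> y * W = W * y"
    by metis
  have thS: "\<theta> y \<in> S" if "y \<in> carrier_mat b b" for y using JS[OF th(1)[OF that]] .
  have thu: "t = \<theta> y" if "t \<in> J" "t * W = W * y" "y \<in> carrier_mat b b" for t y
    using Juniq[OF that(1) th(1)[OF that(3)]] th(2)[OF that(3)] that by simp
  have hom1: "star_hom (sub_alg n S) (matrix_alg b) \<phi>"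
    unfolding star_hom_def sub_alg_simps matrix_alg_simps
  proof (intro conjI ballI allI)
    fix x y assume xy: "x \<in> S" "y \<in> S"
    note [simp] = SC[OF xy(1)] SC[OF xy(2)]
    show "\<phi> (x + y) = \<phi> x + \<phi> y" by (simp add: \<phi>_def mat_distribs)
    have "\<phi> (x * y) = mat_adjoint W * x * (y * W)" by (simp add: \<phi>_def mat_assoc)
    also have "\<dots> = mat_adjoint W * x * (W * \<phi> y)" by (simp only: xW[OF xy(2)])
    also have "\<dots> = \<phi> x * \<phi> y" using phic[OF xy(2)] by (simp add: \<phi>_def mat_assoc)
    finally show "\<phi> (x * y) = \<phi> x * \<phi> y" .
  next
    fix c x assume x: "x \<in> S"
    show "\<phi> (c \<cdot>\<^sub>m x) = c \<cdot>\<^sub>m \<phi> x" using SC[OF x] by (simp add: \<phi>_def mat_distribs)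
  qed (auto simp: phic phi_adj)
  have hom2: "star_hom (matrix_alg b) (sub_alg n S) \<theta>"
    unfolding star_hom_def sub_alg_simps matrix_alg_simps
  proof (intro conjI ballI allI)
    fix x y :: "complex mat" assume x: "x \<in> carrier_mat b b" and y: "y \<in> carrier_mat b b"
    note [simp] = SC[OF thS[OF x]] SC[OF thS[OF y]] carrier_matD[OF x] carrier_matD[OF y]
    show "\<theta> (x + y) = \<theta> x + \<theta> y"
      using th x y by (intro thu[symmetric] Jadd) (auto simp: mat_distribs)
    have "\<theta> x * \<theta> y * W = \<theta> x * W * y" using th(2)[OF y] by (simp add: mat_assoc)
    also have "\<dots> = W * (x * y)" using th(2)[OF x] by (simp add: mat_assoc)
    finally show "\<theta> (x * y) = \<theta> x * \<theta> y"
      using th x y thS by (intro thu[symmetric] Jideal) auto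
  next
    fix c and x :: "complex mat" assume x: "x \<in> carrier_mat b b"
    note [simp] = SC[OF thS[OF x]] carrier_matD[OF x]
    show "\<theta> (c \<cdot>\<^sub>m x) = c \<cdot>\<^sub>m \<theta> x"
      using th x by (intro thu[symmetric] Jsmult) (auto simp: mat_distribs)
    have "\<phi> (\<theta> x) = x" using thS[OF x] th(2)[OF x] x by (rule phi_eq)
    then have "mat_adjoint (\<theta> x) * W = W * mat_adjoint x"
      using xW[OF SD(6)[OF thS[OF x]]] phi_adj[OF thS[OF x]] by simp
    then show "\<theta> (mat_adjoint x) = mat_adjoint (\<theta> x)"
      using th x by (intro thu[symmetric] Jadj) auto
  qed (auto simp: thS)
  define S' where "S' = {x \<in> S. x * W = 0\<^sub>m n b}"
  have S'S: "S' \<subseteq> S" by (auto simp: S'_def)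
  have S': "star_closed n S'"
    unfolding star_closed_def
  proof (intro conjI ballI allI)
    fix x y assume xy: "x \<in> S'" "y \<in> S'"
    then have "x \<in> S" "y \<in> S" "x * W = 0\<^sub>m n b" "y * W = 0\<^sub>m n b" by (auto simp: S'_def)
    moreover note SC[OF \<open>x \<in> S\<close>] SC[OF \<open>y \<in> S\<close>]
    ultimately show "x + y \<in> S'" "x * y \<in> S'"
      using SD(3,4)[of x y] by (auto simp: S'_def mat_distribs mat_assoc)
  next
    fix c x assume "x \<in> S'"
    then show "c \<cdot>\<^sub>m x \<in> S'" using SD(5)[of x c] SC[of x] by (auto simp: S'_def mat_distribs)
  next
    fix x assume "x \<in> S'"
    then show "mat_adjoint x \<in> S'" using SD(6) adj0 by (auto simp: S'_def)
  qed (use SD(1,2) in \<open>auto simp: S'_def\<close>)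
  \<comment> \<open>The vector \<open>\<xi>\<close> witnesses strict growth of the common kernel: it
    lies in the range of \<open>W\<close>, hence is killed by \<open>S'\<close>, but is fixed by
    \<open>p\<close>, an element of \<open>S\<close>.\<close>
  have "\<xi> \<in> common_kernel n S'"
  proof -
    have "x *\<^sub>v \<xi> = 0\<^sub>v n" if "x \<in> S'" for x
    proof -
      have x: "x \<in> S" "x * W = 0\<^sub>m n b" using that by (auto simp: S'_def)
      note [simp] = SC[OF x(1)]
      have "x *\<^sub>v \<xi> = x *\<^sub>v (W *\<^sub>v (mat_adjoint W *\<^sub>v \<xi>))" by (simp add: basis[OF xiU])
      also have "\<dots> = (x * W) *\<^sub>v (mat_adjoint W *\<^sub>v \<xi>)" by (simp add: mat_assoc_vec)
      also have "\<dots> = 0\<^sub>v n" unfolding x(2) by (intro eq_vecI) (auto simp: scalar_prod_def)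
      finally show ?thesis .
    qed
    then show ?thesis using xic by (auto simp: common_kernel_def)
  qed
  moreover have "\<xi> \<notin> common_kernel n S" using p(1) pxi xi0 by (auto simp: common_kernel_def)
  moreover have "common_kernel n S \<subseteq> common_kernel n S'" using S'S by (auto simp: common_kernel_def)
  ultimately have "common_kernel n S \<subset> common_kernel n S'" by blast
  then have dim: "orth_dim n (common_kernel n S) < orth_dim n (common_kernel n S')"
    by (intro orth_dim_strict_mono common_kernel_subspace subsetI SD(1) star_closedD(1)[OF S'])
  have 1: "\<phi> (\<theta> y) = y" if "y \<in> carrier_mat b b" for y
    using thS[OF that] th(2)[OF that] that by (rule phi_eq)
  have 2: "\<phi> s = 0\<^sub>m b b" if "s \<in> S'" for s
    using that by (intro phi_eq) (auto simp: S'_def)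
  have 3: "x + (-1) \<cdot>\<^sub>m \<theta> (\<phi> x) \<in> S'" if x: "x \<in> S" for x
  proof -
    note t = thS[OF phic[OF x]]
    note [simp] = SC[OF x] SC[OF t]
    have "(x + (-1) \<cdot>\<^sub>m \<theta> (\<phi> x)) * W = 0\<^sub>m n b"
      using xW[OF x] th(2)[OF phic[OF x]] Wc phic[OF x] by (simp add: mat_distribs)
    then show ?thesis using SD(3)[OF x SD(5)[OF t]] by (auto simp: S'_def)
  qed
  have 4: "s * \<theta> y = 0\<^sub>m n n \<and> \<theta> y * s = 0\<^sub>m n n" if s: "s \<in> S'" and y: "y \<in> carrier_mat b b" for s y
  proof -
    have *: "s * \<theta> y = 0\<^sub>m n n \<and> s * mat_adjoint (\<theta> y) = 0\<^sub>m n n" if "s \<in> S'" for s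
      using that th(1)[OF y] by (auto simp: J_def S'_def)
    note s2 = star_closedD(6)[OF S' s]
    note [simp] = star_closed_dims[OF S' s] SC[OF thS[OF y]]
    have "mat_adjoint (mat_adjoint s * mat_adjoint (\<theta> y)) = 0\<^sub>m n n" using *[OF s2] by simp
    then have "\<theta> y * s = 0\<^sub>m n n" by (simp add: mat_adjoint_mult)
    then show ?thesis using *[OF s] by blast
  qed
  show ?thesis by (rule that[OF b0 S' S'S dim hom1 hom2 1 2 3 4])
qed

section \<open>Star homomorphisms and direct sums\<close>

lemma star_homD:
  assumes "star_hom A B f"
  shows "x \<in> elems A \<Longrightarrow> f x \<in> elems B"
    "x \<in> elems A \<Longrightarrow> y \<in> elems A \<Longrightarrow> f (add_alg A x y) = add_alg B (f x) (f y)"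
    "x \<in> elems A \<Longrightarrow> f (scale_alg A c x) = scale_alg B c (f x)"
    "x \<in> elems A \<Longrightarrow> y \<in> elems A \<Longrightarrow> f (mult_alg A x y) = mult_alg B (f x) (f y)"
    "x \<in> elems A \<Longrightarrow> f (star A x) = star B (f x)"
  using assms unfolding star_hom_def by blast+

lemma star_hom_comp:
  assumes "star_hom A B f" "star_hom B C g"
  shows "star_hom A C (g \<circ> f)"
  using assms unfolding star_hom_def by simp

lemma embedsI: "star_hom A B f \<Longrightarrow> inj_on f (elems A) \<Longrightarrow> embeds A B"
  unfolding embeds_def by blast

lemma embeds_trans:
  assumes "embeds A B" "embeds B C"
  shows "embeds A C"
proof -
  obtain f g where fg: "star_hom A B f" "inj_on f (elems A)" "star_hom B C g" "inj_on g (elems B)"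
    using assms by (auto simp: embeds_def)
  have "f ` elems A \<subseteq> elems B" using star_homD(1)[OF fg(1)] by auto
  then have "inj_on (g \<circ> f) (elems A)"
    using fg by (intro comp_inj_on) (auto intro: inj_on_subset)
  then show ?thesis using star_hom_comp[OF fg(1,3)] by (auto simp: embeds_def)
qed

lemma star_algebraD:
  assumes "is_star_algebra A"
  shows "zero_alg A \<in> elems A"
    "x \<in> elems A \<Longrightarrow> y \<in> elems A \<Longrightarrow> add_alg A x y \<in> elems A"
    "x \<in> elems A \<Longrightarrow> y \<in> elems A \<Longrightarrow> mult_alg A x y \<in> elems A"
    "x \<in> elems A \<Longrightarrow> scale_alg A c x \<in> elems A"
    "x \<in> elems A \<Longrightarrow> star A x \<in> elems A"
    "x \<in> elems A \<Longrightarrow> scale_alg A 1 x = x"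
    "x \<in> elems A \<Longrightarrow> scale_alg A a (scale_alg A c x) = scale_alg A (a * c) x"
    "x \<in> elems A \<Longrightarrow> scale_alg A (a + c) x = add_alg A (scale_alg A a x) (scale_alg A c x)"
    "x \<in> elems A \<Longrightarrow> y \<in> elems A \<Longrightarrow>
       scale_alg A a (add_alg A x y) = add_alg A (scale_alg A a x) (scale_alg A a y)"
    "x \<in> elems A \<Longrightarrow> y \<in> elems A \<Longrightarrow> z \<in> elems A \<Longrightarrow>
       mult_alg A (mult_alg A x y) z = mult_alg A x (mult_alg A y z)"
    "x \<in> elems A \<Longrightarrow> y \<in> elems A \<Longrightarrow> z \<in> elems A \<Longrightarrow>
       mult_alg A (add_alg A x y) z = add_alg A (mult_alg A x z) (mult_alg A y z)"
    "x \<in> elems A \<Longrightarrow> y \<in> elems A \<Longrightarrow> z \<in> elems A \<Longrightarrow>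
       mult_alg A z (add_alg A x y) = add_alg A (mult_alg A z x) (mult_alg A z y)"
    "x \<in> elems A \<Longrightarrow> y \<in> elems A \<Longrightarrow>
       mult_alg A (scale_alg A a x) y = scale_alg A a (mult_alg A x y)"
    "x \<in> elems A \<Longrightarrow> y \<in> elems A \<Longrightarrow>
       mult_alg A x (scale_alg A a y) = scale_alg A a (mult_alg A x y)"
    "x \<in> elems A \<Longrightarrow> star A (star A x) = x"
    "x \<in> elems A \<Longrightarrow> y \<in> elems A \<Longrightarrow> star A (add_alg A x y) = add_alg A (star A x) (star A y)"
    "x \<in> elems A \<Longrightarrow> star A (scale_alg A a x) = scale_alg A (cnj a) (star A x)"
    "x \<in> elems A \<Longrightarrow> y \<in> elems A \<Longrightarrow> star A (mult_alg A x y) = mult_alg A (star A y) (star A x)"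
  by (use assms[unfolded is_star_algebra_def] in simp_all)

lemma star_algebra_add_commute:
  "is_star_algebra A \<Longrightarrow> x \<in> elems A \<Longrightarrow> y \<in> elems A \<Longrightarrow> add_alg A x y = add_alg A y x"
  unfolding is_star_algebra_def by simp

lemma star_algebra_add_zero:
  assumes "is_star_algebra A" "x \<in> elems A"
  shows "add_alg A (zero_alg A) x = x"
proof -
  have "\<forall>x\<in>elems A. add_alg A (zero_alg A) x = x"
    using assms(1) unfolding is_star_algebra_def by (elim conjE)
  then show ?thesis using assms(2) by blast
qed

lemma star_algebra_add_assoc:
  assumes "is_star_algebra A" "x \<in> elems A" "y \<in> elems A" "z \<in> elems A"
  shows "add_alg A (add_alg A x y) z = add_alg A x (add_alg A y z)"
proof -
  have "\<forall>x\<in>elems A. \<forall>y\<in>elems A. \<forall>z\<in>elems A.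
      add_alg A (add_alg A x y) z = add_alg A x (add_alg A y z)"
    using assms(1) unfolding is_star_algebra_def by (elim conjE)
  then show ?thesis using assms by blast
qed

lemma star_algebra_inverse:
  assumes "is_star_algebra A" "x \<in> elems A"
  obtains y where "y \<in> elems A" "add_alg A x y = zero_alg A"
proof -
  have "\<forall>x\<in>elems A. \<exists>y\<in>elems A. add_alg A x y = zero_alg A"
    using assms(1) unfolding is_star_algebra_def by simp
  then show ?thesis using assms(2) that by blast
qed

lemma star_algebra_scale_zero:
  assumes A: "is_star_algebra A" and x: "x \<in> elems A"
  shows "scale_alg A 0 x = zero_alg A"
proof -
  let ?z = "scale_alg A 0 x"
  have zc: "?z \<in> elems A" using star_algebraD(4)[OF A x] .
  have 1: "add_alg A ?z ?z = ?z"
    using star_algebraD(8)[OF A x, of 0 0] by simp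
  obtain y where y: "y \<in> elems A" "add_alg A ?z y = zero_alg A"
    using star_algebra_inverse[OF A zc] .
  have "add_alg A (add_alg A ?z ?z) y = add_alg A ?z (add_alg A ?z y)"
    using star_algebra_add_assoc[OF A zc zc y(1)] .
  then have "zero_alg A = add_alg A ?z (zero_alg A)" using 1 y by simp
  also have "\<dots> = add_alg A (zero_alg A) ?z"
    using star_algebra_add_commute[OF A zc star_algebraD(1)[OF A]] .
  also have "\<dots> = ?z" using star_algebra_add_zero[OF A zc] .
  finally show ?thesis by simp
qed

text \<open>\<open>star_hom\<close> does not mention zero, but zero is the multiple of any element
  by the scalar 0.\<close>

lemma star_hom_zero:
  assumes A: "is_star_algebra A" and B: "is_star_algebra B" and f: "star_hom A B f"
  shows "f (zero_alg A) = zero_alg B"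
proof -
  have z: "zero_alg A \<in> elems A" using star_algebraD(1)[OF A] .
  have "f (zero_alg A) = f (scale_alg A 0 (zero_alg A))" using star_algebra_scale_zero[OF A z] by simp
  also have "\<dots> = scale_alg B 0 (f (zero_alg A))" using star_homD(3)[OF f z] .
  also have "\<dots> = zero_alg B" using star_algebra_scale_zero[OF B star_homD(1)[OF f z]] .
  finally show ?thesis .
qed

lemma star_algebra_sub_alg:
  assumes S: "star_closed n S"
  shows "is_star_algebra (sub_alg n S)"
  unfolding is_star_algebra_def sub_alg_simps
proof (intro conjI ballI allI)
  fix x assume x: "x \<in> S"
  show "\<exists>y\<in>S. x + y = 0\<^sub>m n n"
    using star_closedD(5)[OF S x, of "-1"] star_closedD(1)[OF S x]
    by (intro bexI[of _ "(-1) \<cdot>\<^sub>m x"]) auto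
next
  fix x y assume xy: "x \<in> S" "y \<in> S"
  then show "x + y = y + x" using star_closedD(1)[OF S] by (intro comm_add_mat[of _ n n]) auto
  fix z assume "z \<in> S"
  then show "x + y + z = x + (y + z)" using star_closedD(1)[OF S] xy by (intro assoc_add_mat[of _ n n]) auto
next
  fix a b x assume x: "x \<in> S"
  show "(a + b) \<cdot>\<^sub>m x = a \<cdot>\<^sub>m x + b \<cdot>\<^sub>m x" by (rule add_smult_distrib_right_mat[OF star_closedD(1)[OF S x]])
next
  fix a x y assume xy: "x \<in> S" "y \<in> S"
  show "a \<cdot>\<^sub>m (x + y) = a \<cdot>\<^sub>m x + a \<cdot>\<^sub>m y"
    by (rule add_smult_distrib_left_mat[OF star_closedD(1)[OF S xy(1)] star_closedD(1)[OF S xy(2)]])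
qed (use star_closed_dims[OF S] star_closedD[OF S] in
      \<open>auto simp: mat_assoc mat_distribs mat_adjoint_mult mat_adjoint_add mat_adjoint_smult
        intro!: eq_matI\<close>)

lemma star_closed_carrier: "star_closed n (carrier_mat n n)"
  by (auto simp: star_closed_def)

lemma matrix_alg_eq_sub_alg: "matrix_alg n = sub_alg n (carrier_mat n n)"
  by (simp add: matrix_alg_def sub_alg_def)

lemma star_algebra_matrix_alg: "is_star_algebra (matrix_alg n)"
  unfolding matrix_alg_eq_sub_alg by (rule star_algebra_sub_alg[OF star_closed_carrier])

lemma direct_sum_simps:
  "elems (direct_sum As) = {xs. length xs = length As \<and> (\<forall>i<length As. xs ! i \<in> elems (As ! i))}"
  "zero_alg (direct_sum As) = map zero_alg As"
  "add_alg (direct_sum As) xs ys = map (\<lambda>i. add_alg (As ! i) (xs ! i) (ys ! i)) [0..<length As]"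
  "scale_alg (direct_sum As) c xs = map (\<lambda>i. scale_alg (As ! i) c (xs ! i)) [0..<length As]"
  "mult_alg (direct_sum As) xs ys = map (\<lambda>i. mult_alg (As ! i) (xs ! i) (ys ! i)) [0..<length As]"
  "star (direct_sum As) xs = map (\<lambda>i. star (As ! i) (xs ! i)) [0..<length As]"
  by (simp_all add: direct_sum_def)

lemma star_algebra_direct_sum:
  assumes A: "\<And>i. i < length As \<Longrightarrow> is_star_algebra (As ! i)"
  shows "is_star_algebra (direct_sum As)"
  unfolding is_star_algebra_def
proof (intro conjI ballI allI)
  fix xs assume xs: "xs \<in> elems (direct_sum As)"
  have "\<exists>y. i < length As \<longrightarrow> y \<in> elems (As ! i) \<and> add_alg (As ! i) (xs ! i) y = zero_alg (As ! i)" for i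
    using xs star_algebra_inverse[OF A, of i "xs ! i"] by (auto simp: direct_sum_simps)
  then obtain y where y: "\<And>i. i < length As \<Longrightarrow> y i \<in> elems (As ! i) \<and> add_alg (As ! i) (xs ! i) (y i) = zero_alg (As ! i)"
    by metis
  then show "\<exists>ys\<in>elems (direct_sum As). add_alg (direct_sum As) xs ys = zero_alg (direct_sum As)"
    by (intro bexI[of _ "map y [0..<length As]"]) (auto simp: direct_sum_simps intro!: nth_equalityI)
next
  fix xs ys assume xys: "xs \<in> elems (direct_sum As)" "ys \<in> elems (direct_sum As)"
  then show "add_alg (direct_sum As) xs ys = add_alg (direct_sum As) ys xs"
    using star_algebra_add_commute[OF A] by (auto simp: direct_sum_simps)
  fix zs assume "zs \<in> elems (direct_sum As)"
  show "add_alg (direct_sum As) (add_alg (direct_sum As) xs ys) zs =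
      add_alg (direct_sum As) xs (add_alg (direct_sum As) ys zs)"
    using star_algebra_add_assoc[OF A] xys \<open>zs \<in> elems (direct_sum As)\<close>
    by (auto simp: direct_sum_simps)
qed (auto simp: direct_sum_simps star_algebraD[OF A] star_algebra_add_zero[OF A] intro!: nth_equalityI)

section \<open>Sums of full matrix algebras and the block structure of matrix algebras\<close>

definition block_alg :: "nat list \<Rightarrow> complex mat list star_alg" where
  "block_alg bs = direct_sum (map matrix_alg bs)"

lemma star_algebra_block_alg: "is_star_algebra (block_alg bs)"
  unfolding block_alg_def by (rule star_algebra_direct_sum) (simp add: star_algebra_matrix_alg)

lemma block_alg_elems:
  "xs \<in> elems (block_alg bs) \<longleftrightarrow>
     length xs = length bs \<and> (\<forall>i<length bs. xs ! i \<in> carrier_mat (bs ! i) (bs ! i))"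
  by (auto simp: block_alg_def direct_sum_simps)

lemma block_alg_length [simp]:
  "length (zero_alg (block_alg bs)) = length bs"
  "length (add_alg (block_alg bs) xs ys) = length bs"
  "length (scale_alg (block_alg bs) c xs) = length bs"
  "length (mult_alg (block_alg bs) xs ys) = length bs"
  "length (star (block_alg bs) xs) = length bs"
  by (auto simp: block_alg_def direct_sum_simps)

lemma block_alg_nth [simp]:
  assumes "i < length bs"
  shows "zero_alg (block_alg bs) ! i = 0\<^sub>m (bs ! i) (bs ! i)"
    "add_alg (block_alg bs) xs ys ! i = xs ! i + ys ! i"
    "scale_alg (block_alg bs) c xs ! i = c \<cdot>\<^sub>m xs ! i"
    "mult_alg (block_alg bs) xs ys ! i = xs ! i * ys ! i"
    "star (block_alg bs) xs ! i = mat_adjoint (xs ! i)"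
  using assms by (auto simp: block_alg_def direct_sum_simps)

lemma block_alg_Nil_elems [simp]: "elems (block_alg []) = {[]}"
  by (auto simp: block_alg_elems)

lemma block_alg_Nil [simp]:
  "zero_alg (block_alg []) = []" "add_alg (block_alg []) xs ys = []" "scale_alg (block_alg []) c xs = []"
  "mult_alg (block_alg []) xs ys = []" "star (block_alg []) xs = []"
  by (auto simp: block_alg_def direct_sum_simps)

lemma block_alg_Cons_elems [simp]:
  "x # xs \<in> elems (block_alg (b # bs)) \<longleftrightarrow> x \<in> carrier_mat b b \<and> xs \<in> elems (block_alg bs)"
  by (auto simp: block_alg_elems nth_Cons less_Suc_eq_0_disj)

lemma block_alg_ConsE:
  assumes "zs \<in> elems (block_alg (b # bs))"
  obtains x xs where "zs = x # xs" "x \<in> carrier_mat b b" "xs \<in> elems (block_alg bs)"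
  using assms by (cases zs) (auto simp: block_alg_elems[of "[]"] simp del: block_alg_Nil_elems)

lemma block_alg_Cons [simp]:
  "zero_alg (block_alg (b # bs)) = 0\<^sub>m b b # zero_alg (block_alg bs)"
  "add_alg (block_alg (b # bs)) (x # xs) (y # ys) = (x + y) # add_alg (block_alg bs) xs ys"
  "scale_alg (block_alg (b # bs)) c (x # xs) = (c \<cdot>\<^sub>m x) # scale_alg (block_alg bs) c xs"
  "mult_alg (block_alg (b # bs)) (x # xs) (y # ys) = (x * y) # mult_alg (block_alg bs) xs ys"
  "star (block_alg (b # bs)) (x # xs) = mat_adjoint x # star (block_alg bs) xs"
  by (auto simp: nth_Cons split: nat.split intro!: nth_equalityI)

lemma smult_neg_add_cancel:
  fixes A B :: "complex mat"
  assumes "A \<in> carrier_mat n m" "B \<in> carrier_mat n m"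
  shows "A + (B + (-1) \<cdot>\<^sub>m A) = B" "(A + B) + (-1) \<cdot>\<^sub>m A = B"
  using assms by (auto intro!: eq_matI)

text \<open>Wedderburn decomposition up to mutual embedding: a block is split off, the complement
  \<open>S'\<close> has a common kernel of smaller codimension, and the two embeddings for
  \<open>S'\<close> are extended by one coordinate each.\<close>

lemma star_closed_structure:
  assumes "star_closed n S"
  shows "\<exists>bs. (\<forall>b\<in>set bs. b > 0) \<and> embeds (sub_alg n S) (block_alg bs) \<and>
    embeds (block_alg bs) (sub_alg n S)"
  using assms
proof (induction "n - orth_dim n (common_kernel n S)" arbitrary: S rule: less_induct)
  case less
  note S = less.prems
  note SD = star_closedD[OF S] and SC = star_closed_dims[OF S]
  show ?case
  proof (cases "S = {0\<^sub>m n n}")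
    case True
    have "star_hom (sub_alg n S) (block_alg []) (\<lambda>_. [])" by (auto simp: star_hom_def True)
    moreover have "star_hom (block_alg []) (sub_alg n S) (\<lambda>_. 0\<^sub>m n n)"
      by (auto simp: star_hom_def True intro!: eq_matI)
    ultimately show ?thesis
      using True by (intro exI[of _ "[]"]) (auto simp: embeds_def inj_on_def)
  next
    case False
    obtain b \<phi> \<theta> S' where b: "b > 0" and S': "star_closed n S'" and S'S: "S' \<subseteq> S"
      and dim: "orth_dim n (common_kernel n S) < orth_dim n (common_kernel n S')"
      and phi: "star_hom (sub_alg n S) (matrix_alg b) \<phi>"
      and theta: "star_hom (matrix_alg b) (sub_alg n S) \<theta>"
      and phi_theta: "\<And>y. y \<in> carrier_mat b b \<Longrightarrow> \<phi> (\<theta> y) = y"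
      and phi_S': "\<And>s. s \<in> S' \<Longrightarrow> \<phi> s = 0\<^sub>m b b"
      and rest: "\<And>x. x \<in> S \<Longrightarrow> x + (-1) \<cdot>\<^sub>m \<theta> (\<phi> x) \<in> S'"
      and orth: "\<And>s y. s \<in> S' \<Longrightarrow> y \<in> carrier_mat b b \<Longrightarrow> s * \<theta> y = 0\<^sub>m n n \<and> \<theta> y * s = 0\<^sub>m n n"
      by (rule star_closed_split_matrix_block[OF S False]) blast
    note SD' = star_closedD[OF S'] and SC' = star_closed_dims[OF S']
    note ph = star_homD[OF phi, simplified] and th = star_homD[OF theta, simplified]
    have "orth_dim n (common_kernel n S') \<le> n"
      by (intro orth_dim_le common_kernel_subspace subsetI SD'(1))
    then have "n - orth_dim n (common_kernel n S') < n - orth_dim n (common_kernel n S)"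
      using dim by simp
    from less.hyps[OF this S'] obtain bs f g where bs: "\<forall>b\<in>set bs. b > 0"
      and f: "star_hom (sub_alg n S') (block_alg bs) f" "inj_on f S'"
      and g: "star_hom (block_alg bs) (sub_alg n S') g" "inj_on g (elems (block_alg bs))"
      by (auto simp: embeds_def)
    note fh = star_homD[OF f(1), simplified] and gh = star_homD[OF g(1), simplified]
    \<comment> \<open>The component of \<open>x\<close> in the complement \<open>S'\<close>. Sums,
      products, multiples and adjoints of decompositions are again decompositions, so by
      \<open>duniq\<close> the map \<open>d\<close> respects all operations; for products the mixed
      terms vanish by \<open>orth\<close>.\<close>
    define d where "d x = x + (-1) \<cdot>\<^sub>m \<theta> (\<phi> x)" for x
    have dS: "d x \<in> S'" if "x \<in> S" for x using rest[OF that] by (simp add: d_def)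
    have tS: "\<theta> (\<phi> x) \<in> S" if "x \<in> S" for x using th(1)[OF ph(1)[OF that]] .
    have split: "x = \<theta> (\<phi> x) + d x" if "x \<in> S" for x
      using smult_neg_add_cancel(1)[OF SD(1)[OF tS[OF that]] SD(1)[OF that]] by (simp add: d_def)
    have duniq: "d x = s" if "x \<in> S" "x = \<theta> (\<phi> x) + s" "s \<in> S'" for x s
      using smult_neg_add_cancel(2)[OF SD(1)[OF tS[OF that(1)]] SD'(1)[OF that(3)]] that(2) by (simp add: d_def)
    have "star_hom (sub_alg n S) (block_alg (b # bs)) (\<lambda>x. \<phi> x # f (d x))"
      unfolding star_hom_def sub_alg_simps
    proof (intro conjI ballI allI)
      fix x y assume xy: "x \<in> S" "y \<in> S"
      note [simp] = SC[OF tS[OF xy(1)]] SC[OF tS[OF xy(2)]] SC'[OF dS[OF xy(1)]] SC'[OF dS[OF xy(2)]]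
      have "x + y = (\<theta> (\<phi> x) + d x) + (\<theta> (\<phi> y) + d y)" using split xy by simp
      also have "\<dots> = (\<theta> (\<phi> x) + \<theta> (\<phi> y)) + (d x + d y)" by (rule eq_matI) auto
      also have "\<theta> (\<phi> x) + \<theta> (\<phi> y) = \<theta> (\<phi> (x + y))" using ph th xy by simp
      finally have "d (x + y) = d x + d y"
        using xy SD SD' dS by (intro duniq) auto
      then show "\<phi> (x + y) # f (d (x + y)) = add_alg (block_alg (b # bs)) (\<phi> x # f (d x)) (\<phi> y # f (d y))"
        using ph fh dS xy by simp
      have "x * y = (\<theta> (\<phi> x) + d x) * (\<theta> (\<phi> y) + d y)" using split xy by simp
      also have "\<dots> = \<theta> (\<phi> x) * \<theta> (\<phi> y) + d x * d y"
        using orth[OF dS[OF xy(1)] ph(1)[OF xy(2)]] orth[OF dS[OF xy(2)] ph(1)[OF xy(1)]]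
        by (auto simp: mat_distribs intro!: eq_matI)
      also have "\<theta> (\<phi> x) * \<theta> (\<phi> y) = \<theta> (\<phi> (x * y))" using ph th xy by simp
      finally have "d (x * y) = d x * d y"
        using xy SD SD' dS by (intro duniq) auto
      then show "\<phi> (x * y) # f (d (x * y)) = mult_alg (block_alg (b # bs)) (\<phi> x # f (d x)) (\<phi> y # f (d y))"
        using ph fh dS xy by simp
    next
      fix c x assume x: "x \<in> S"
      note [simp] = SC[OF tS[OF x]] SC'[OF dS[OF x]]
      have "c \<cdot>\<^sub>m x = c \<cdot>\<^sub>m (\<theta> (\<phi> x) + d x)" using split x by simp
      also have "\<dots> = c \<cdot>\<^sub>m \<theta> (\<phi> x) + c \<cdot>\<^sub>m d x" by (rule eq_matI) (auto simp: algebra_simps)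
      also have "c \<cdot>\<^sub>m \<theta> (\<phi> x) = \<theta> (\<phi> (c \<cdot>\<^sub>m x))" using ph th x by simp
      finally have "d (c \<cdot>\<^sub>m x) = c \<cdot>\<^sub>m d x" using x SD SD' dS by (intro duniq) auto
      then show "\<phi> (c \<cdot>\<^sub>m x) # f (d (c \<cdot>\<^sub>m x)) = scale_alg (block_alg (b # bs)) c (\<phi> x # f (d x))"
        using ph fh dS x by simp
      have "mat_adjoint x = mat_adjoint (\<theta> (\<phi> x) + d x)" using split x by simp
      also have "\<dots> = mat_adjoint (\<theta> (\<phi> x)) + mat_adjoint (d x)" by (rule mat_adjoint_add) auto
      also have "mat_adjoint (\<theta> (\<phi> x)) = \<theta> (\<phi> (mat_adjoint x))" using ph th x by simp
      finally have "d (mat_adjoint x) = mat_adjoint (d x)" using x SD SD' dS by (intro duniq) auto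
      then show "\<phi> (mat_adjoint x) # f (d (mat_adjoint x)) = star (block_alg (b # bs)) (\<phi> x # f (d x))"
        using ph fh dS x by simp
    qed (use ph fh dS in auto)
    moreover have "inj_on (\<lambda>x. \<phi> x # f (d x)) S"
    proof (rule inj_onI)
      fix x y assume xy: "x \<in> S" "y \<in> S" "\<phi> x # f (d x) = \<phi> y # f (d y)"
      then have "d x = d y" using inj_onD[OF f(2) _ dS[OF xy(1)] dS[OF xy(2)]] by simp
      then show "x = y" using split[OF xy(1)] split[OF xy(2)] xy by simp
    qed
    ultimately have 1: "embeds (sub_alg n S) (block_alg (b # bs))"
      by (intro embedsI) simp_all
    define G where "G zs = \<theta> (hd zs) + g (tl zs)" for zs
    have "star_hom (block_alg (b # bs)) (sub_alg n S) G"
      unfolding star_hom_def sub_alg_simps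
    proof (intro conjI ballI allI)
      fix ys zs assume ys: "ys \<in> elems (block_alg (b # bs))" and zs: "zs \<in> elems (block_alg (b # bs))"
      obtain x xs where x: "ys = x # xs" "x \<in> carrier_mat b b" "xs \<in> elems (block_alg bs)"
        using ys by (rule block_alg_ConsE)
      obtain w ws where w: "zs = w # ws" "w \<in> carrier_mat b b" "ws \<in> elems (block_alg bs)"
        using zs by (rule block_alg_ConsE)
      note t = th(1)[OF x(2)] th(1)[OF w(2)] gh(1)[OF x(3)] gh(1)[OF w(3)]
      note [simp] = SC[OF t(1)] SC[OF t(2)] SC'[OF t(3)] SC'[OF t(4)]
      have "G (add_alg (block_alg (b # bs)) ys zs) = (\<theta> x + \<theta> w) + (g xs + g ws)"
        using x w th gh by (simp add: G_def)
      also have "\<dots> = (\<theta> x + g xs) + (\<theta> w + g ws)" by (rule eq_matI) auto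
      finally show "G (add_alg (block_alg (b # bs)) ys zs) = G ys + G zs" using x w by (simp add: G_def)
      have "G (mult_alg (block_alg (b # bs)) ys zs) = \<theta> x * \<theta> w + g xs * g ws"
        using x w th gh by (simp add: G_def)
      also have "\<dots> = (\<theta> x + g xs) * (\<theta> w + g ws)"
        using orth[OF t(3) w(2)] orth[OF t(4) x(2)]
        by (auto simp: mat_distribs intro!: eq_matI)
      finally show "G (mult_alg (block_alg (b # bs)) ys zs) = G ys * G zs" using x w by (simp add: G_def)
    next
      fix c ys assume ys: "ys \<in> elems (block_alg (b # bs))"
      obtain x xs where x: "ys = x # xs" "x \<in> carrier_mat b b" "xs \<in> elems (block_alg bs)"
        using ys by (rule block_alg_ConsE)
      note t = th(1)[OF x(2)] gh(1)[OF x(3)]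
      note [simp] = SC[OF t(1)] SC'[OF t(2)]
      show "G ys \<in> S" using SD(3)[OF t(1) subsetD[OF S'S t(2)]] x by (simp add: G_def)
      have "G (scale_alg (block_alg (b # bs)) c ys) = c \<cdot>\<^sub>m \<theta> x + c \<cdot>\<^sub>m g xs"
        using x th gh by (simp add: G_def)
      also have "\<dots> = c \<cdot>\<^sub>m (\<theta> x + g xs)" by (rule eq_matI) (auto simp: algebra_simps)
      finally show "G (scale_alg (block_alg (b # bs)) c ys) = c \<cdot>\<^sub>m G ys" using x by (simp add: G_def)
      show "G (star (block_alg (b # bs)) ys) = mat_adjoint (G ys)"
        using x th gh by (simp add: G_def mat_adjoint_add)
    qed
    moreover have "inj_on G (elems (block_alg (b # bs)))"
    proof (rule inj_onI)
      fix ys zs assume ys: "ys \<in> elems (block_alg (b # bs))" and zs: "zs \<in> elems (block_alg (b # bs))"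
        and eq: "G ys = G zs"
      obtain x xs where x: "ys = x # xs" "x \<in> carrier_mat b b" "xs \<in> elems (block_alg bs)"
        using ys by (rule block_alg_ConsE)
      obtain w ws where w: "zs = w # ws" "w \<in> carrier_mat b b" "ws \<in> elems (block_alg bs)"
        using zs by (rule block_alg_ConsE)
      \<comment> \<open>Both summands can be recovered from the sum, since \<open>\<phi>\<close>
        vanishes on \<open>S'\<close> and inverts \<open>\<theta>\<close>; this makes
        \<open>G\<close> injective.\<close>
      have *: "\<phi> (\<theta> x + g xs) = x \<and> d (\<theta> x + g xs) = g xs"
        if x: "x \<in> carrier_mat b b" "xs \<in> elems (block_alg bs)" for x xs
      proof -
        note t = th(1)[OF x(1)] gh(1)[OF x(2)]
        have "\<phi> (\<theta> x + g xs) = \<phi> (\<theta> x) + \<phi> (g xs)" using ph(2) t S'S by auto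
        then have 1: "\<phi> (\<theta> x + g xs) = x" using phi_theta phi_S' t x by simp
        moreover have "d (\<theta> x + g xs) = g xs"
          using t S'S SD(3) 1 by (intro duniq) auto
        ultimately show ?thesis by blast
      qed
      have eq': "\<theta> x + g xs = \<theta> w + g ws" using eq x(1) w(1) by (simp add: G_def)
      have "x = w" using *[OF x(2,3)] *[OF w(2,3)] eq' by metis
      moreover have "g xs = g ws" using *[OF x(2,3)] *[OF w(2,3)] eq' by metis
      then have "xs = ws" by (rule inj_onD[OF g(2) _ x(3) w(3)])
      ultimately show "ys = zs" using x(1) w(1) by metis
    qed
    ultimately have 2: "embeds (block_alg (b # bs)) (sub_alg n S)"
      by (rule embedsI)
    show ?thesis using 1 2 b bs by (intro exI[of _ "b # bs"]) auto
  qed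
qed

section \<open>Embeddings between sums of matrix algebras\<close>

lemma block_alg_append [simp]:
  "zero_alg (block_alg (as @ bs)) = zero_alg (block_alg as) @ zero_alg (block_alg bs)"
  "length xs = length as \<Longrightarrow> length xs' = length as \<Longrightarrow>
     add_alg (block_alg (as @ bs)) (xs @ ys) (xs' @ ys') =
     add_alg (block_alg as) xs xs' @ add_alg (block_alg bs) ys ys'"
  "length xs = length as \<Longrightarrow>
     scale_alg (block_alg (as @ bs)) c (xs @ ys) = scale_alg (block_alg as) c xs @ scale_alg (block_alg bs) c ys"
  "length xs = length as \<Longrightarrow> length xs' = length as \<Longrightarrow>
     mult_alg (block_alg (as @ bs)) (xs @ ys) (xs' @ ys') =
     mult_alg (block_alg as) xs xs' @ mult_alg (block_alg bs) ys ys'"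
  "length xs = length as \<Longrightarrow>
     star (block_alg (as @ bs)) (xs @ ys) = star (block_alg as) xs @ star (block_alg bs) ys"
  by (auto intro!: nth_equalityI simp: nth_append)

lemma block_alg_append_elems:
  assumes "length xs = length as"
  shows "xs @ ys \<in> elems (block_alg (as @ bs)) \<longleftrightarrow> xs \<in> elems (block_alg as) \<and> ys \<in> elems (block_alg bs)"
  using assms
proof (induction as arbitrary: xs)
  case (Cons a as)
  then show ?case by (cases xs) auto
qed auto

lemma block_alg_appendE:
  assumes "zs \<in> elems (block_alg (as @ bs))"
  obtains xs ys where "zs = xs @ ys" "xs \<in> elems (block_alg as)" "ys \<in> elems (block_alg bs)"
    "length xs = length as"
proof -
  have "length zs = length as + length bs" using assms by (simp add: block_alg_elems)
  then show ?thesis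
    using that[of "take (length as) zs" "drop (length as) zs"] assms
      block_alg_append_elems[of "take (length as) zs" as "drop (length as) zs" bs] by simp
qed

lemma block_alg_length_elems: "xs \<in> elems (block_alg bs) \<Longrightarrow> length xs = length bs"
  by (simp add: block_alg_elems)

lemma embeds_block_append_Cons:
  assumes "embeds (block_alg as) (matrix_alg b)" "embeds (block_alg cs) (block_alg bs)"
  shows "embeds (block_alg (as @ cs)) (block_alg (b # bs))"
proof -
  obtain f where f: "star_hom (block_alg as) (matrix_alg b) f" "inj_on f (elems (block_alg as))"
    using assms(1) by (auto simp: embeds_def)
  obtain g where g: "star_hom (block_alg cs) (block_alg bs) g" "inj_on g (elems (block_alg cs))"
    using assms(2) by (auto simp: embeds_def)
  note fh = star_homD[OF f(1), simplified] and gh = star_homD[OF g(1)]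
  let ?k = "length as"
  define F where "F zs = f (take ?k zs) # g (drop ?k zs)" for zs
  have F [simp]: "F (xs @ ys) = f xs # g ys" if "length xs = ?k" for xs ys using that by (simp add: F_def)
  show ?thesis
  proof (rule embedsI)
    show "star_hom (block_alg (as @ cs)) (block_alg (b # bs)) F"
      unfolding star_hom_def
    proof (intro conjI ballI allI)
      fix zs c assume zs: "zs \<in> elems (block_alg (as @ cs))"
      obtain xs ys where z: "zs = xs @ ys" "xs \<in> elems (block_alg as)" "ys \<in> elems (block_alg cs)"
        "length xs = ?k" by (rule block_alg_appendE[OF zs])
      show "F zs \<in> elems (block_alg (b # bs))" using z fh gh by simp
      show "F (scale_alg (block_alg (as @ cs)) c zs) = scale_alg (block_alg (b # bs)) c (F zs)"
        using z fh gh by simp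
      show "F (star (block_alg (as @ cs)) zs) = star (block_alg (b # bs)) (F zs)"
        using z fh gh by simp
      fix zs' assume zs': "zs' \<in> elems (block_alg (as @ cs))"
      obtain xs' ys' where z': "zs' = xs' @ ys'" "xs' \<in> elems (block_alg as)" "ys' \<in> elems (block_alg cs)"
        "length xs' = ?k" by (rule block_alg_appendE[OF zs'])
      show "F (add_alg (block_alg (as @ cs)) zs zs') = add_alg (block_alg (b # bs)) (F zs) (F zs')"
        using z z' fh gh by simp
      show "F (mult_alg (block_alg (as @ cs)) zs zs') = mult_alg (block_alg (b # bs)) (F zs) (F zs')"
        using z z' fh gh by simp
    qed
    show "inj_on F (elems (block_alg (as @ cs)))"
    proof (rule inj_onI)
      fix zs zs' assume zs: "zs \<in> elems (block_alg (as @ cs))" "zs' \<in> elems (block_alg (as @ cs))"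
        and eq: "F zs = F zs'"
      obtain xs ys where z: "zs = xs @ ys" "xs \<in> elems (block_alg as)" "ys \<in> elems (block_alg cs)"
        "length xs = ?k" by (rule block_alg_appendE[OF zs(1)])
      obtain xs' ys' where z': "zs' = xs' @ ys'" "xs' \<in> elems (block_alg as)" "ys' \<in> elems (block_alg cs)"
        "length xs' = ?k" by (rule block_alg_appendE[OF zs(2)])
      have e: "f xs = f xs'" "g ys = g ys'" using eq z z' by auto
      have "xs = xs'" by (rule inj_onD[OF f(2) e(1) z(2) z'(2)])
      moreover have "ys = ys'" by (rule inj_onD[OF g(2) e(2) z(3) z'(3)])
      ultimately show "zs = zs'" using z z' by simp
    qed
  qed
qed

definition diag2 :: "nat \<Rightarrow> nat \<Rightarrow> complex mat \<Rightarrow> complex mat \<Rightarrow> complex mat" where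
  "diag2 c d x y = four_block_mat x (0\<^sub>m c d) (0\<^sub>m d c) y"

lemma diag2_carrier [simp]:
  "x \<in> carrier_mat c c \<Longrightarrow> y \<in> carrier_mat d d \<Longrightarrow> diag2 c d x y \<in> carrier_mat (c + d) (c + d)"
  by (simp add: diag2_def)

lemma diag2:
  assumes x: "x \<in> carrier_mat c c" "x' \<in> carrier_mat c c" and y: "y \<in> carrier_mat d d" "y' \<in> carrier_mat d d"
  shows "diag2 c d x y + diag2 c d x' y' = diag2 c d (x + x') (y + y')"
    "diag2 c d x y * diag2 c d x' y' = diag2 c d (x * x') (y * y')"
    "a \<cdot>\<^sub>m diag2 c d x y = diag2 c d (a \<cdot>\<^sub>m x) (a \<cdot>\<^sub>m y)"
    "mat_adjoint (diag2 c d x y) = diag2 c d (mat_adjoint x) (mat_adjoint y)"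
    "diag2 c d x y = diag2 c d x' y' \<Longrightarrow> x = x' \<and> y = y'"
proof -
  show "diag2 c d x y + diag2 c d x' y' = diag2 c d (x + x') (y + y')"
    unfolding diag2_def using x y by (intro eq_matI) auto
  show "a \<cdot>\<^sub>m diag2 c d x y = diag2 c d (a \<cdot>\<^sub>m x) (a \<cdot>\<^sub>m y)"
    unfolding diag2_def using x y by (intro eq_matI) auto
  show "mat_adjoint (diag2 c d x y) = diag2 c d (mat_adjoint x) (mat_adjoint y)"
    unfolding diag2_def using x y by (intro eq_matI) auto
  show "diag2 c d x y * diag2 c d x' y' = diag2 c d (x * x') (y * y')"
    unfolding diag2_def
    by (subst mult_four_block_mat[OF x(1) _ _ y(1) x(2) _ _ y(2)]) (use x y in auto)
  assume eq: "diag2 c d x y = diag2 c d x' y'"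
  have "x = x'"
  proof (rule eq_matI)
    fix i j assume ij: "i < dim_row x'" "j < dim_col x'"
    have "diag2 c d x y $$ (i, j) = diag2 c d x' y' $$ (i, j)" using eq by simp
    then show "x $$ (i, j) = x' $$ (i, j)" using ij x y by (simp add: diag2_def)
  qed (use x in auto)
  moreover have "y = y'"
  proof (rule eq_matI)
    fix i j assume ij: "i < dim_row y'" "j < dim_col y'"
    have "diag2 c d x y $$ (c + i, c + j) = diag2 c d x' y' $$ (c + i, c + j)" using eq by simp
    then show "y $$ (i, j) = y' $$ (i, j)" using ij x y by (simp add: diag2_def)
  qed (use y in auto)
  ultimately show "x = x' \<and> y = y'" by blast
qed

lemma embeds_block_matrix_alg:
  assumes "sum_list cs \<le> b"
  shows "embeds (block_alg cs) (matrix_alg b)"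
  using assms
proof (induction cs arbitrary: b)
  case Nil
  have "star_hom (block_alg []) (matrix_alg b) (\<lambda>_. 0\<^sub>m b b)"
    by (auto simp: star_hom_def intro!: eq_matI)
  then show ?case by (rule embedsI) simp
next
  case (Cons c cs)
  define d where "d = b - c"
  have b: "b = c + d" using Cons.prems by (simp add: d_def)
  have "embeds (block_alg cs) (matrix_alg d)" using Cons by (auto simp: d_def)
  then obtain f where f: "star_hom (block_alg cs) (matrix_alg d) f" "inj_on f (elems (block_alg cs))"
    by (auto simp: embeds_def)
  note fh = star_homD[OF f(1), simplified]
  define F where "F zs = diag2 c d (hd zs) (f (tl zs))" for zs
  show ?case
    unfolding b
  proof (rule embedsI)
    show "star_hom (block_alg (c # cs)) (matrix_alg (c + d)) F"
      unfolding star_hom_def matrix_alg_simps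
    proof (intro conjI ballI allI)
      fix zs a assume zs: "zs \<in> elems (block_alg (c # cs))"
      obtain x xs where z: "zs = x # xs" "x \<in> carrier_mat c c" "xs \<in> elems (block_alg cs)"
        by (rule block_alg_ConsE[OF zs])
      show "F zs \<in> carrier_mat (c + d) (c + d)" using z fh(1) by (simp add: F_def)
      show "F (scale_alg (block_alg (c # cs)) a zs) = a \<cdot>\<^sub>m F zs"
        using z fh diag2(3)[OF z(2) z(2) fh(1)[OF z(3)] fh(1)[OF z(3)]] by (simp add: F_def)
      show "F (star (block_alg (c # cs)) zs) = mat_adjoint (F zs)"
        using z fh diag2(4)[OF z(2) z(2) fh(1)[OF z(3)] fh(1)[OF z(3)]] by (simp add: F_def)
      fix zs' assume zs': "zs' \<in> elems (block_alg (c # cs))"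
      obtain x' xs' where z': "zs' = x' # xs'" "x' \<in> carrier_mat c c" "xs' \<in> elems (block_alg cs)"
        by (rule block_alg_ConsE[OF zs'])
      show "F (add_alg (block_alg (c # cs)) zs zs') = F zs + F zs'"
        using z z' fh diag2(1)[OF z(2) z'(2) fh(1)[OF z(3)] fh(1)[OF z'(3)]] by (simp add: F_def)
      show "F (mult_alg (block_alg (c # cs)) zs zs') = F zs * F zs'"
        using z z' fh diag2(2)[OF z(2) z'(2) fh(1)[OF z(3)] fh(1)[OF z'(3)]] by (simp add: F_def)
    qed
    show "inj_on F (elems (block_alg (c # cs)))"
    proof (rule inj_onI)
      fix zs zs' assume zs: "zs \<in> elems (block_alg (c # cs))" "zs' \<in> elems (block_alg (c # cs))"
        and eq: "F zs = F zs'"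
      obtain x xs where z: "zs = x # xs" "x \<in> carrier_mat c c" "xs \<in> elems (block_alg cs)"
        by (rule block_alg_ConsE[OF zs(1)])
      obtain x' xs' where z': "zs' = x' # xs'" "x' \<in> carrier_mat c c" "xs' \<in> elems (block_alg cs)"
        by (rule block_alg_ConsE[OF zs(2)])
      have e: "x = x'" "f xs = f xs'"
        using diag2(5)[OF z(2) z'(2) fh(1)[OF z(3)] fh(1)[OF z'(3)]] eq z(1) z'(1) by (auto simp: F_def)
      have "xs = xs'" by (rule inj_onD[OF f(2) e(2) z(3) z'(3)])
      then show "zs = zs'" using e(1) z(1) z'(1) by simp
    qed
  qed
qed

lemma embeds_block_concat:
  assumes "list_all2 (\<lambda>cs b. sum_list cs \<le> b) css bs"
  shows "embeds (block_alg (concat css)) (block_alg bs)"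
  using assms
proof (induction rule: list_all2_induct)
  case Nil
  have "star_hom (block_alg []) (block_alg []) (\<lambda>x. x)" by (simp add: star_hom_def)
  then show ?case by (auto intro: embedsI)
next
  case (Cons cs css b bs)
  then show ?case using embeds_block_append_Cons[OF embeds_block_matrix_alg] by simp
qed

lemma embeds_block_append: "embeds (block_alg as) (block_alg (as @ bs))"
proof (rule embedsI)
  let ?f = "\<lambda>xs. xs @ zero_alg (block_alg bs)"
  note Z = star_algebraD(1)[OF star_algebra_block_alg[of bs]]
  have *: "add_alg (block_alg bs) (zero_alg (block_alg bs)) (zero_alg (block_alg bs)) = zero_alg (block_alg bs)"
    "mult_alg (block_alg bs) (zero_alg (block_alg bs)) (zero_alg (block_alg bs)) = zero_alg (block_alg bs)"
    "scale_alg (block_alg bs) c (zero_alg (block_alg bs)) = zero_alg (block_alg bs)"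
    "star (block_alg bs) (zero_alg (block_alg bs)) = zero_alg (block_alg bs)" for c
    by (auto intro!: nth_equalityI eq_matI)
  show "star_hom (block_alg as) (block_alg (as @ bs)) ?f"
    using Z by (auto simp: star_hom_def block_alg_append_elems block_alg_length_elems *)
qed (auto simp: inj_on_def)

lemma embeds_block_permute:
  assumes "mset as = mset bs"
  shows "embeds (block_alg bs) (block_alg as)"
proof -
  obtain p where p: "p permutes {..<length bs}" "permute_list p bs = as"
    using mset_eq_permutation[OF assms] by blast
  have len: "length as = length bs" using p by (auto simp flip: p(2))
  have p_lt: "p i < length bs \<longleftrightarrow> i < length bs" for i
    using permutes_in_image[OF p(1), of i] by simp
  have as_nth: "as ! i = bs ! p i" if "i < length bs" for i
    using p that by (auto simp: permute_list_nth simp flip: p(2))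
  define f where "f xs = map (\<lambda>i. xs ! p i) [0..<length bs]" for xs :: "complex mat list"
  have fl [simp]: "length (f xs) = length bs" for xs by (simp add: f_def)
  have fn [simp]: "f xs ! i = xs ! p i" if "i < length bs" for xs i using that by (simp add: f_def)
  show ?thesis
  proof (rule embedsI)
    show "star_hom (block_alg bs) (block_alg as) f"
      unfolding star_hom_def
      by (auto simp: block_alg_elems len as_nth p_lt intro!: nth_equalityI)
    show "inj_on f (elems (block_alg bs))"
    proof (rule inj_onI)
      fix xs ys assume xs: "xs \<in> elems (block_alg bs)" "ys \<in> elems (block_alg bs)" and eq: "f xs = f ys"
      show "xs = ys"
      proof (rule nth_equalityI)
        show "length xs = length ys" using xs by (simp add: block_alg_elems)
        fix i assume "i < length xs"
        then have i: "i < length bs" using xs by (simp add: block_alg_elems)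
        obtain k where k: "p k = i" using permutes_surj[OF p(1)] by (metis surjD)
        then have "k < length bs" using i p_lt by blast
        then show "xs ! i = ys ! i" using arg_cong[OF eq, of "\<lambda>l. l ! k"] k by simp
      qed
    qed
  qed
qed

text \<open>\<open>css\<close> is a packing plan whose i-th list goes into the i-th block of
  \<open>bs\<close>. The plan may offer more places than \<open>as\<close> occupies; the surplus
  \<open>rs\<close> receives zeros.\<close>

lemma embeds_block_packing:
  assumes "list_all2 (\<lambda>cs b. sum_list cs \<le> b) css bs" and "mset as \<subseteq># mset (concat css)"
  shows "embeds (block_alg as) (block_alg bs)"
proof -
  obtain rs where "mset (concat css) = mset as + mset rs"
    using assms(2) by (metis ex_mset mset_subset_eq_exists_conv)
  then have "embeds (block_alg (as @ rs)) (block_alg (concat css))"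
    by (intro embeds_block_permute) simp
  then show ?thesis
    using embeds_trans[OF embeds_block_append] embeds_trans embeds_block_concat[OF assms(1)] by blast
qed

lemma embeds_matrix_block_single:
  "embeds (matrix_alg d) (block_alg [d])" "embeds (block_alg [d]) (matrix_alg d)"
proof -
  have "star_hom (matrix_alg d) (block_alg [d]) (\<lambda>x. [x])" by (auto simp: star_hom_def)
  then show "embeds (matrix_alg d) (block_alg [d])" by (rule embedsI) (auto simp: inj_on_def)
  show "embeds (block_alg [d]) (matrix_alg d)" by (rule embeds_block_matrix_alg) simp
qed

section \<open>Orthogonal projections and the upper bound on copies of a block\<close>

text \<open>Each projection strictly shrinks the common kernel of the preceding ones.\<close>

lemma card_orthogonal_projections:
  fixes P :: "'k \<Rightarrow> complex mat"
  assumes "finite K"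
    and P: "\<And>k. k \<in> K \<Longrightarrow> P k \<in> carrier_mat n n" "\<And>k. k \<in> K \<Longrightarrow> P k * P k = P k"
      "\<And>k. k \<in> K \<Longrightarrow> P k \<noteq> 0\<^sub>m n n"
    and orth: "\<And>k l. k \<in> K \<Longrightarrow> l \<in> K \<Longrightarrow> k \<noteq> l \<Longrightarrow> P k * P l = 0\<^sub>m n n"
  shows "card K \<le> n"
proof -
  have "card K + orth_dim n (common_kernel n (P ` K)) \<le> n"
    using assms
  proof (induction K rule: finite_induct)
    case empty
    show ?case using orth_dim_le[OF common_kernel_subspace[of "{}" n]] by simp
  next
    case (insert k K)
    have IH: "card K + orth_dim n (common_kernel n (P ` K)) \<le> n"
      using insert.prems by (intro insert.IH) auto
    have [simp]: "dim_row (P l) = n" "dim_col (P l) = n" if "l \<in> insert k K" for l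
      using insert.prems(1)[OF that] by auto
    obtain v where v: "v \<in> carrier_vec n" "P k *\<^sub>v v \<noteq> 0\<^sub>v n"
      using mat_nonzero_mult_vec[of "P k" n n] insert.prems by (metis insertI1)
    have Pv: "P k *\<^sub>v v \<in> carrier_vec n"
      using insert.prems(1)[of k] v by auto
    have "P l *\<^sub>v (P k *\<^sub>v v) = 0\<^sub>v n" if "l \<in> K" for l
    proof -
      have "l \<noteq> k" using insert.hyps that by blast
      then have "P l * P k = 0\<^sub>m n n" using insert.prems(4)[of l k] that by blast
      then show ?thesis using v that mat_assoc_vec[of "P l" "P k" v] by simp
    qed
    \<comment> \<open>This vector is killed by all previous projections but fixed by
      \<open>P k\<close>, so adding \<open>P k\<close> lowers the dimension of the common kernel by
      at least one.\<close>
    then have "P k *\<^sub>v v \<in> common_kernel n (P ` K)" using Pv by (auto simp: common_kernel_def)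
    moreover have "P k *\<^sub>v (P k *\<^sub>v v) = P k *\<^sub>v v"
      using mat_assoc_vec[of "P k" "P k" v] insert.prems(2)[of k] v by simp
    then have "P k *\<^sub>v v \<notin> common_kernel n (P ` insert k K)" using v by (auto simp: common_kernel_def)
    moreover have "common_kernel n (P ` insert k K) \<subseteq> common_kernel n (P ` K)"
      by (auto simp: common_kernel_def)
    ultimately have "common_kernel n (P ` insert k K) \<subset> common_kernel n (P ` K)" by blast
    then have "orth_dim n (common_kernel n (P ` insert k K)) < orth_dim n (common_kernel n (P ` K))"
      using insert.prems(1) by (intro orth_dim_strict_mono common_kernel_subspace) auto
    then show ?case using IH insert.hyps by simp
  qed
  then show ?thesis by simp
qed

definition block_unit :: "nat \<Rightarrow> nat \<Rightarrow> nat \<Rightarrow> nat \<Rightarrow> nat \<Rightarrow> complex mat list" where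
  "block_unit c d i a a' =
     map (\<lambda>k. if k = i then mat_unit d d a a' else 0\<^sub>m d d) [0..<c]"

lemma matrix_unit_mult:
  fixes a a' e e' :: nat
  assumes "a' < d" "e < d"
  shows "mat_unit d d a a' *
      mat_unit d d e e' =
    (if a' = e then mat_unit d d a e' else 0\<^sub>m d d)"
proof (rule eq_matI)
  fix p q assume "p < dim_row (if a' = e then mat_unit d d a e' else 0\<^sub>m d d :: complex mat)"
    "q < dim_col (if a' = e then mat_unit d d a e' else 0\<^sub>m d d :: complex mat)"
  then have pq: "p < d" "q < d" by (auto split: if_splits)
  have "(\<Sum>k = 0..<d. (if p = a \<and> k = a' then 1 else 0) * (if k = e \<and> q = e' then 1 else (0::complex))) =
      (\<Sum>k = 0..<d. if k = a' then (if p = a \<and> a' = e \<and> q = e' then 1 else 0) else 0)"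
    by (rule sum.cong) auto
  then show "(mat_unit d d a a' *
      mat_unit d d e e') $$ (p, q) =
    (if a' = e then mat_unit d d a e' else 0\<^sub>m d d) $$ (p, q)"
    using pq assms by (simp add: scalar_prod_def)
qed (auto)

lemma block_unit_elems: "block_unit c d i a a' \<in> elems (block_alg (replicate c d))"
  by (auto simp: block_alg_elems block_unit_def)

lemma block_unit_mult:
  assumes "a' < d" "e < d"
  shows "mult_alg (block_alg (replicate c d)) (block_unit c d i a a') (block_unit c d k e e') =
    (if i = k \<and> a' = e then block_unit c d i a e' else zero_alg (block_alg (replicate c d)))"
  using matrix_unit_mult[OF assms] by (auto simp: block_unit_def intro!: nth_equalityI)

lemma block_unit_neq_zero:
  assumes "i < c" "a < d"
  shows "block_unit c d i a a \<noteq> zero_alg (block_alg (replicate c d))"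
proof
  assume "block_unit c d i a a = zero_alg (block_alg (replicate c d))"
  then have "block_unit c d i a a ! i $$ (a, a) = zero_alg (block_alg (replicate c d)) ! i $$ (a, a)" by simp
  then show False using assms by (simp add: block_unit_def)
qed

text \<open>Each copy \<open>i\<close> of M_d has a nonzero component in some target block
  \<open>\<sigma> i\<close>. There the images of all its \<open>d\<close> diagonal units are
  nonzero, and for copies sent to the same block they are mutually orthogonal. A block of size
  \<open>b\<close> thus receives at most \<open>b div d\<close> copies.\<close>

lemma embeds_replicate_block_bound:
  assumes emb: "embeds (block_alg (replicate c d)) (block_alg bs)" and d: "d > 0"
  shows "c \<le> (\<Sum>b\<leftarrow>bs. b div d)"
proof -
  let ?A = "block_alg (replicate c d)" and ?u = "block_unit c d"
  obtain f where f: "star_hom ?A (block_alg bs) f" "inj_on f (elems ?A)"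
    using emb by (auto simp: embeds_def)
  note fh = star_homD[OF f(1)]
  have f0: "f (zero_alg ?A) = zero_alg (block_alg bs)"
    by (rule star_hom_zero[OF star_algebra_block_alg star_algebra_block_alg f(1)])
  define e where "e i a a' j = f (?u i a a') ! j" for i a a' j
  have ec: "e i a a' j \<in> carrier_mat (bs ! j) (bs ! j)" if "j < length bs" for i a a' j
    using fh(1)[OF block_unit_elems] that by (auto simp: e_def block_alg_elems)
  have em: "e i a a' j * e k b b' j = (if i = k \<and> a' = b then e i a b' j else 0\<^sub>m (bs ! j) (bs ! j))"
    if "j < length bs" "a' < d" "b < d" for i a a' j k b b'
  proof -
    have "e i a a' j * e k b b' j = f (mult_alg ?A (?u i a a') (?u k b b')) ! j"
      using that by (simp add: e_def fh(4)[OF block_unit_elems block_unit_elems])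
    then show ?thesis using that by (simp add: block_unit_mult f0 e_def)
  qed
  have "\<exists>j<length bs. e i 0 0 j \<noteq> 0\<^sub>m (bs ! j) (bs ! j)" if i: "i < c" for i
  proof (rule ccontr)
    assume "\<not> ?thesis"
    then have "f (?u i 0 0) = zero_alg (block_alg bs)"
      using block_alg_length_elems[OF fh(1)[OF block_unit_elems]]
      by (intro nth_equalityI) (auto simp: e_def)
    then have "f (?u i 0 0) = f (zero_alg ?A)" using f0 by simp
    then have "?u i 0 0 = zero_alg ?A"
      by (rule inj_onD[OF f(2) _ block_unit_elems star_algebraD(1)[OF star_algebra_block_alg]])
    then show False using block_unit_neq_zero[OF i d] by blast
  qed
  then obtain \<sigma> where sg: "\<And>i. i < c \<Longrightarrow> \<sigma> i < length bs"
    "\<And>i. i < c \<Longrightarrow> e i 0 0 (\<sigma> i) \<noteq> 0\<^sub>m (bs ! \<sigma> i) (bs ! \<sigma> i)" by metis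
  \<comment> \<open>One nonvanishing diagonal unit forces the others not to vanish, because the unit
    at (0, 0) factors through the one at (a, a).\<close>
  have ne: "e i a a (\<sigma> i) \<noteq> 0\<^sub>m (bs ! \<sigma> i) (bs ! \<sigma> i)" if i: "i < c" and a: "a < d" for i a
  proof
    assume 0: "e i a a (\<sigma> i) = 0\<^sub>m (bs ! \<sigma> i) (bs ! \<sigma> i)"
    note j = sg(1)[OF i]
    have "e i 0 0 (\<sigma> i) = e i 0 a (\<sigma> i) * (e i a a (\<sigma> i) * e i a 0 (\<sigma> i))"
      using em[OF j] a d by simp
    then show False
      using 0 sg(2)[OF i] carrier_matD[OF ec[OF j, of i 0 a]] carrier_matD[OF ec[OF j, of i a 0]] by simp
  qed
  have card: "card {i. i < c \<and> \<sigma> i = j} \<le> bs ! j div d" if j: "j < length bs" for j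
  proof -
    let ?I = "{i. i < c \<and> \<sigma> i = j}"
    have "card (?I \<times> {..<d}) \<le> bs ! j"
    proof (rule card_orthogonal_projections[where P = "\<lambda>(i, a). e i a a j"])
      show "finite (?I \<times> {..<d})" by auto
      show "(case k of (i, a) \<Rightarrow> e i a a j) \<in> carrier_mat (bs ! j) (bs ! j)" for k
        using ec[OF j] by (auto split: prod.split)
      show "(case k of (i, a) \<Rightarrow> e i a a j) * (case k of (i, a) \<Rightarrow> e i a a j) = (case k of (i, a) \<Rightarrow> e i a a j)"
        if "k \<in> ?I \<times> {..<d}" for k using that em[OF j] by auto
      show "(case k of (i, a) \<Rightarrow> e i a a j) \<noteq> 0\<^sub>m (bs ! j) (bs ! j)" if "k \<in> ?I \<times> {..<d}" for k
        using that ne by auto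
      show "(case k of (i, a) \<Rightarrow> e i a a j) * (case l of (i, a) \<Rightarrow> e i a a j) = 0\<^sub>m (bs ! j) (bs ! j)"
        if "k \<in> ?I \<times> {..<d}" "l \<in> ?I \<times> {..<d}" "k \<noteq> l" for k l
        using that em[OF j] by auto
    qed
    then have "card ?I * d \<le> bs ! j" by (simp add: card_cartesian_product)
    then show ?thesis using d by (simp add: less_eq_div_iff_mult_less_eq)
  qed
  have "c = card {..<c}" by simp
  also have "{..<c} = (\<Union>j\<in>{..<length bs}. {i. i < c \<and> \<sigma> i = j})" using sg by auto
  also have "card \<dots> \<le> (\<Sum>j<length bs. card {i. i < c \<and> \<sigma> i = j})" by (rule card_UN_le) simp
  also have "\<dots> \<le> (\<Sum>j<length bs. bs ! j div d)" using card by (intro sum_mono) auto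
  also have "\<dots> = (\<Sum>b\<leftarrow>bs. b div d)" by (simp add: sum_list_sum_nth lessThan_atLeast0)
  finally show ?thesis .
qed

section \<open>Finite dimension and C*-norms\<close>

text \<open>An inductive span, easy to transport along homomorphisms and to enlarge;
  \<open>alg_span_lin_comb\<close> converts it into the coefficient lists that
  \<open>finite_dimensional\<close> demands.\<close>

inductive_set alg_span :: "'a star_alg \<Rightarrow> 'a set \<Rightarrow> 'a set" for A B where
  zero: "zero_alg A \<in> alg_span A B"
| base: "b \<in> B \<Longrightarrow> b \<in> alg_span A B"
| add: "x \<in> alg_span A B \<Longrightarrow> y \<in> alg_span A B \<Longrightarrow> add_alg A x y \<in> alg_span A B"
| scale: "x \<in> alg_span A B \<Longrightarrow> scale_alg A c x \<in> alg_span A B"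

lemma alg_span_mono: "x \<in> alg_span A B \<Longrightarrow> B \<subseteq> C \<Longrightarrow> x \<in> alg_span A C"
  by (induction rule: alg_span.induct) (auto intro: alg_span.intros)

lemma alg_span_elems:
  "x \<in> alg_span A B \<Longrightarrow> is_star_algebra A \<Longrightarrow> B \<subseteq> elems A \<Longrightarrow> x \<in> elems A"
  by (induction rule: alg_span.induct) (auto intro: star_algebraD)

lemma alg_span_hom:
  assumes "x \<in> alg_span A B" "is_star_algebra A" "is_star_algebra A'" "star_hom A A' f" "B \<subseteq> elems A"
  shows "f x \<in> alg_span A' (f ` B)"
  using assms(1)
proof (induction rule: alg_span.induct)
  case zero
  then show ?case by (simp add: star_hom_zero[OF assms(2-4)] alg_span.zero)
next
  case (add x y)
  then show ?case
    using star_homD(2)[OF assms(4), of x y] alg_span_elems[OF _ assms(2,5)] by (simp add: alg_span.add)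
next
  case (scale x c)
  then show ?case
    using star_homD(3)[OF assms(4), of x c] alg_span_elems[OF _ assms(2,5)] by (simp add: alg_span.scale)
qed (auto intro: alg_span.base)

lemma star_algebra_add_rearrange:
  assumes A: "is_star_algebra A" and e: "a \<in> elems A" "b \<in> elems A" "x \<in> elems A" "y \<in> elems A"
  shows "add_alg A (add_alg A a x) (add_alg A b y) = add_alg A (add_alg A a b) (add_alg A x y)"
proof -
  note assoc = star_algebra_add_assoc[OF A] and comm = star_algebra_add_commute[OF A]
    and cl = star_algebraD(2)[OF A]
  have "add_alg A (add_alg A a x) (add_alg A b y) = add_alg A a (add_alg A (add_alg A x b) y)"
    using e cl assoc by simp
  also have "add_alg A x b = add_alg A b x" using e comm by blast
  finally show ?thesis using e cl assoc by simp
qed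

lemma lin_comb_elems:
  assumes A: "is_star_algebra A" and "length cs = length L" "set L \<subseteq> elems A"
  shows "lin_comb A (zip cs L) \<in> elems A"
  using assms(2,3) by (induction cs L rule: list_induct2) (auto intro: star_algebraD[OF A])

lemma lin_comb_replicate_zero:
  assumes A: "is_star_algebra A" and "set L \<subseteq> elems A"
  shows "lin_comb A (zip (replicate (length L) 0) L) = zero_alg A"
  using assms(2)
  by (induction L)
    (auto simp: star_algebra_scale_zero[OF A] star_algebra_add_zero[OF A] star_algebraD(1)[OF A])

text \<open>Coefficient lists must have the length of \<open>L\<close>, so absent generators get the
  coefficient 0, and sums and multiples act on the lists entry by entry.\<close>

lemma alg_span_lin_comb:
  assumes A: "is_star_algebra A" and L: "set L \<subseteq> elems A" and x: "x \<in> alg_span A (set L)"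
  shows "\<exists>cs. length cs = length L \<and> x = lin_comb A (zip cs L)"
  using x
proof (induction rule: alg_span.induct)
  case zero
  then show ?case using lin_comb_replicate_zero[OF A L] by (metis length_replicate)
next
  case (base b)
  then show ?case
    using L
  proof (induction L)
    case (Cons l L)
    show ?case
    proof (cases "b = l")
      case True
      have "add_alg A b (zero_alg A) = b"
        using star_algebra_add_zero[OF A, of b] star_algebra_add_commute[OF A, of b "zero_alg A"]
          Cons.prems True star_algebraD(1)[OF A] by simp
      then have "b = lin_comb A (zip (1 # replicate (length L) 0) (l # L))"
        using Cons.prems True star_algebraD(6)[OF A] by (simp add: lin_comb_replicate_zero[OF A])
      then show ?thesis by (intro exI[of _ "1 # replicate (length L) 0"]) simp
    next
      case False
      then obtain cs where "length cs = length L" "b = lin_comb A (zip cs L)" using Cons by auto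
      then show ?thesis
        using Cons.prems False
        by (intro exI[of _ "0 # cs"])
          (auto simp: star_algebra_scale_zero[OF A] star_algebra_add_zero[OF A])
    qed
  qed simp
next
  case (add x y)
  then obtain cs ds where cd: "length cs = length L" "x = lin_comb A (zip cs L)"
    "length ds = length L" "y = lin_comb A (zip ds L)" by blast
  have "add_alg A (lin_comb A (zip cs L)) (lin_comb A (zip ds L)) =
      lin_comb A (zip (map2 (+) cs ds) L)"
    if "length cs = length ds" "length ds = length L" "set L \<subseteq> elems A" for cs ds L
    using that
  proof (induction cs ds L rule: list_induct3)
    case Nil
    then show ?case by (simp add: star_algebra_add_zero[OF A] star_algebraD(1)[OF A])
  next
    case (Cons c cs d ds l L)
    then show ?case
      using star_algebra_add_rearrange[OF A, of "scale_alg A c l" "scale_alg A d l"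
          "lin_comb A (zip cs L)" "lin_comb A (zip ds L)"]
        lin_comb_elems[OF A, of cs L] lin_comb_elems[OF A, of ds L]
        star_algebraD(4)[OF A] star_algebraD(8)[OF A, of l c d]
      by simp
  qed
  from this[of cs ds L] show ?case
    using cd L by (intro exI[of _ "map2 (+) cs ds"]) simp
next
  case (scale x c)
  then obtain cs where cs: "length cs = length L" "x = lin_comb A (zip cs L)" by blast
  have "scale_alg A c (lin_comb A (zip cs L)) = lin_comb A (zip (map ((*) c) cs) L)"
    if "length cs = length L" "set L \<subseteq> elems A" for cs L
    using that
  proof (induction cs L rule: list_induct2)
    case Nil
    have "scale_alg A c (scale_alg A 0 (zero_alg A)) = scale_alg A (c * 0) (zero_alg A)"
      using star_algebraD(1,7)[OF A] by simp
    then show ?case by (simp add: star_algebra_scale_zero[OF A] star_algebraD(1)[OF A])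
  next
    case (Cons d cs l L)
    then show ?case
      using star_algebraD(9)[OF A, of "scale_alg A d l" "lin_comb A (zip cs L)" c]
        lin_comb_elems[OF A, of cs L] star_algebraD(4)[OF A] star_algebraD(7)[OF A, of l c d]
      by simp
  qed
  from this[of cs L] show ?case using cs L by (intro exI[of _ "map ((*) c) cs"]) simp
qed

lemma alg_span_matrix_alg:
  assumes "x \<in> carrier_mat b b"
  shows "x \<in> alg_span (matrix_alg b)
    (set (map (\<lambda>(i, j). mat_unit b b i j) (List.product [0..<b] [0..<b])))"
    (is "_ \<in> ?S")
  using assms
proof (rule mat_unit_induct)
  show "0\<^sub>m b b \<in> ?S" using alg_span.zero[of "matrix_alg b"] by simp
  show "A + B \<in> ?S" if "A \<in> ?S" "B \<in> ?S" for A B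
    using alg_span.add[OF that] by simp
  show "c \<cdot>\<^sub>m A \<in> ?S" if "A \<in> ?S" for A c
    using alg_span.scale[OF that] by simp
qed (auto intro!: alg_span.base)

lemma finite_dimensional_block_alg: "finite_dimensional (block_alg bs)"
proof -
  have "\<exists>L. set L \<subseteq> elems (block_alg bs) \<and> elems (block_alg bs) \<subseteq> alg_span (block_alg bs) (set L)"
  proof (induction bs)
    case Nil
    show ?case using alg_span.zero[of "block_alg []"] by (intro exI[of _ "[]"]) simp
  next
    case (Cons b bs)
    then obtain L where L: "set L \<subseteq> elems (block_alg bs)"
      "elems (block_alg bs) \<subseteq> alg_span (block_alg bs) (set L)" by blast
    define E :: "complex mat list" where
      "E = map (\<lambda>(i, j). mat_unit b b i j) (List.product [0..<b] [0..<b])"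
    have E: "set E \<subseteq> carrier_mat b b" by (auto simp: E_def)
    let ?z = "zero_alg (block_alg bs)"
    \<comment> \<open>The two coordinate inclusions are homomorphisms and carry spans to spans;
      every element of the sum is of the form \<open>f x\<close> plus \<open>g xs\<close>.\<close>
    define f where "f x = x # ?z" for x
    define g where "g xs = 0\<^sub>m b b # xs" for xs :: "complex mat list"
    note Z = star_algebraD(1)[OF star_algebra_block_alg[of bs]]
    have z: "add_alg (block_alg bs) ?z ?z = ?z" "scale_alg (block_alg bs) c ?z = ?z"
      "mult_alg (block_alg bs) ?z ?z = ?z" "star (block_alg bs) ?z = ?z" for c
      by (auto intro!: nth_equalityI eq_matI)
    have f: "star_hom (matrix_alg b) (block_alg (b # bs)) f"
      using Z by (auto simp: star_hom_def f_def z)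
    have g: "star_hom (block_alg bs) (block_alg (b # bs)) g"
      by (auto simp: star_hom_def g_def star_algebraD[OF star_algebra_block_alg] intro!: eq_matI)
    show ?case
    proof (intro exI[of _ "map f E @ map g L"] conjI subsetI)
      fix x assume "x \<in> set (map f E @ map g L)"
      then show "x \<in> elems (block_alg (b # bs))"
        using E L(1) star_homD(1)[OF f] star_homD(1)[OF g] by auto
    next
      fix zs assume "zs \<in> elems (block_alg (b # bs))"
      then obtain x xs where x: "zs = x # xs" "x \<in> carrier_mat b b" "xs \<in> elems (block_alg bs)"
        by (rule block_alg_ConsE)
      have "x \<in> alg_span (matrix_alg b) (set E)"
        using alg_span_matrix_alg[OF x(2)] by (simp add: E_def)
      then have "f x \<in> alg_span (block_alg (b # bs)) (f ` set E)"
        by (rule alg_span_hom[OF _ star_algebra_matrix_alg star_algebra_block_alg f]) (use E in simp)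
      moreover have "g xs \<in> alg_span (block_alg (b # bs)) (g ` set L)"
        using subsetD[OF L(2) x(3)]
        by (rule alg_span_hom[OF _ star_algebra_block_alg star_algebra_block_alg g]) (rule L(1))
      ultimately have "add_alg (block_alg (b # bs)) (f x) (g xs) \<in>
          alg_span (block_alg (b # bs)) (set (map f E @ map g L))"
        by (intro alg_span.add) (auto elim: alg_span_mono)
      then show "zs \<in> alg_span (block_alg (b # bs)) (set (map f E @ map g L))"
        using x by (simp add: f_def g_def star_algebra_add_zero[OF star_algebra_block_alg])
    qed
  qed
  then obtain L where L: "set L \<subseteq> elems (block_alg bs)"
    "elems (block_alg bs) \<subseteq> alg_span (block_alg bs) (set L)" by blast
  then show ?thesis
    using alg_span_lin_comb[OF star_algebra_block_alg L(1)] unfolding finite_dimensional_def by blast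
qed

text \<open>Norms of embedded algebras are inherited from the algebra around them, whose norm comes
  with its transmittability; thus no operator norm is constructed.\<close>

lemma cstar_norm_pullback:
  assumes A: "is_star_algebra A" and B: "is_star_algebra B" and f: "star_hom A B f" "inj_on f (elems A)"
    and N: "is_cstar_norm B N"
  shows "is_cstar_norm A (N \<circ> f)"
proof -
  have "N (f x) = 0 \<longleftrightarrow> x = zero_alg A" if x: "x \<in> elems A" for x
  proof -
    have "N (f x) = 0 \<longleftrightarrow> f x = f (zero_alg A)"
      using N star_homD(1)[OF f(1) x] by (simp add: is_cstar_norm_def star_hom_zero[OF A B f(1)])
    then show ?thesis using inj_onD[OF f(2) _ x star_algebraD(1)[OF A]] by auto
  qed
  moreover have "N (f (mult_alg A (star A x) x)) = (N (f x))\<^sup>2" if "x \<in> elems A" for x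
    using N star_homD[OF f(1)] star_algebraD(5)[OF A] that by (simp add: is_cstar_norm_def)
  ultimately show ?thesis
    using N star_homD[OF f(1)] by (simp add: is_cstar_norm_def)
qed

lemma finite_dimensional_image:
  assumes f: "star_hom A B f" "f ` elems A = elems B" and A: "is_star_algebra A" and B: "is_star_algebra B"
    and fd: "finite_dimensional A"
  shows "finite_dimensional B"
proof -
  obtain L where L: "set L \<subseteq> elems A" and
    span: "\<And>x. x \<in> elems A \<Longrightarrow> \<exists>cs. length cs = length L \<and> x = lin_comb A (zip cs L)"
    using fd by (auto simp: finite_dimensional_def)
  have hom: "f (lin_comb A (zip cs L)) = lin_comb B (zip cs (map f L))"
    if "length cs = length L" "set L \<subseteq> elems A" for cs L
    using that
  proof (induction cs L rule: list_induct2)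
    case Nil
    then show ?case by (simp add: star_hom_zero[OF A B f(1)])
  next
    case (Cons c cs l L)
    then show ?case
      using star_homD(2)[OF f(1), of "scale_alg A c l" "lin_comb A (zip cs L)"]
        star_homD(3)[OF f(1), of l c] lin_comb_elems[OF A, of cs L] star_algebraD(4)[OF A] by simp
  qed
  show ?thesis
    unfolding finite_dimensional_def
  proof (intro exI[of _ "map f L"] conjI ballI)
    show "set (map f L) \<subseteq> elems B" using L star_homD(1)[OF f(1)] by auto
    fix y assume "y \<in> elems B"
    then obtain x where x: "x \<in> elems A" "y = f x" using f(2) by blast
    obtain cs where "length cs = length L" "x = lin_comb A (zip cs L)" using span[OF x(1)] by blast
    then show "\<exists>cs. length cs = length (map f L) \<and> y = lin_comb B (zip cs (map f L))"
      using hom[OF _ L] x(2) by auto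
  qed
qed

section \<open>Traces and adjoint maps\<close>

lemma mat_trace_add:
  "A \<in> carrier_mat n n \<Longrightarrow> B \<in> carrier_mat n n \<Longrightarrow> mat_trace (A + B) = mat_trace A + mat_trace B"
  by (simp add: mat_trace_def sum.distrib)

lemma mat_trace_smult: "A \<in> carrier_mat n n \<Longrightarrow> mat_trace (c \<cdot>\<^sub>m A) = c * mat_trace A"
  by (simp add: mat_trace_def sum_distrib_left)

lemma mat_trace_commute:
  assumes "A \<in> carrier_mat n m" "B \<in> carrier_mat m n"
  shows "mat_trace (A * B) = mat_trace (B * A)"
proof -
  have "mat_trace (A * B) = (\<Sum>i<n. \<Sum>j<m. A $$ (i, j) * B $$ (j, i))"
    using assms by (auto simp: mat_trace_def scalar_prod_def lessThan_atLeast0 intro!: sum.cong)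
  also have "\<dots> = (\<Sum>j<m. \<Sum>i<n. A $$ (i, j) * B $$ (j, i))" by (rule sum.swap)
  also have "\<dots> = mat_trace (B * A)"
    using assms by (auto simp: mat_trace_def scalar_prod_def lessThan_atLeast0 mult.commute intro!: sum.cong)
  finally show ?thesis .
qed

lemma mat_trace_mult_unit:
  assumes Z: "Z \<in> carrier_mat n n" and ij: "i < n" "j < n"
  shows "mat_trace (Z * mat_unit n n i j) = Z $$ (j, i)"
proof -
  have "mat_trace (Z * mat_unit n n i j) =
      (\<Sum>k<n. \<Sum>a<n. Z $$ (k, a) * (if a = i \<and> k = j then 1 else 0))"
    using Z by (auto simp: mat_trace_def scalar_prod_def lessThan_atLeast0 intro!: sum.cong)
  also have "\<dots> = (\<Sum>k<n. \<Sum>a<n. if a = i then (if k = j then Z $$ (j, i) else 0) else 0)"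
    by (intro sum.cong) auto
  also have "\<dots> = Z $$ (j, i)" using ij by simp
  finally show ?thesis .
qed

lemma mat_eq_by_trace:
  assumes Z: "Z \<in> carrier_mat n n" "Z' \<in> carrier_mat n n"
    and eq: "\<And>X. X \<in> carrier_mat n n \<Longrightarrow> mat_trace (Z * X) = mat_trace (Z' * X)"
  shows "Z = Z'"
proof (rule eq_matI)
  fix j i assume "j < dim_row Z'" "i < dim_col Z'"
  then have ij: "i < n" "j < n" using Z by auto
  have "mat_trace (Z * mat_unit n n i j) =
      mat_trace (Z' * mat_unit n n i j)" by (rule eq) simp
  then show "Z $$ (j, i) = Z' $$ (j, i)"
    by (simp add: mat_trace_mult_unit[OF Z(1) ij] mat_trace_mult_unit[OF Z(2) ij])
qed (use Z in auto)

text \<open>The trace pairing represents every functional: the value at the unit (i, j) has to be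
  the entry (j, i) of \<open>Z\<close>, hence the transposed indices.\<close>

lemma linear_functional_trace:
  fixes F :: "complex mat \<Rightarrow> complex"
  assumes add: "\<And>A B. A \<in> carrier_mat n n \<Longrightarrow> B \<in> carrier_mat n n \<Longrightarrow> F (A + B) = F A + F B"
    and smult: "\<And>c A. A \<in> carrier_mat n n \<Longrightarrow> F (c \<cdot>\<^sub>m A) = c * F A"
  obtains Z where "Z \<in> carrier_mat n n" "\<And>X. X \<in> carrier_mat n n \<Longrightarrow> F X = mat_trace (Z * X)"
proof
  define Z where "Z = mat n n (\<lambda>(j, i). F (mat_unit n n i j))"
  show Z: "Z \<in> carrier_mat n n" by (simp add: Z_def)
  note [simp] = carrier_matD[OF Z]
  fix X :: "complex mat" assume "X \<in> carrier_mat n n"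
  then show "F X = mat_trace (Z * X)"
  proof (rule mat_unit_induct)
    show "F (0\<^sub>m n n) = mat_trace (Z * 0\<^sub>m n n)"
    proof -
      have "F (0 \<cdot>\<^sub>m 0\<^sub>m n n) = 0 * F (0\<^sub>m n n)" by (rule smult) simp
      moreover have "0 \<cdot>\<^sub>m 0\<^sub>m n n = (0\<^sub>m n n :: complex mat)" by (intro eq_matI) auto
      ultimately show ?thesis by (simp add: mat_trace_def)
    qed
    show "F (A + B) = mat_trace (Z * (A + B))"
      if A: "A \<in> carrier_mat n n" and B: "B \<in> carrier_mat n n"
        and "F A = mat_trace (Z * A)" "F B = mat_trace (Z * B)" for A B
      using that carrier_matD[OF A] carrier_matD[OF B]
        mat_trace_add[OF mult_carrier_mat[OF Z A] mult_carrier_mat[OF Z B]]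
      by (simp add: add mat_distribs)
    show "F (c \<cdot>\<^sub>m A) = mat_trace (Z * (c \<cdot>\<^sub>m A))"
      if A: "A \<in> carrier_mat n n" and "F A = mat_trace (Z * A)" for c A
      using that carrier_matD[OF A] mat_trace_smult[OF mult_carrier_mat[OF Z A]]
      by (simp add: smult mat_distribs)
    show "F (mat_unit n n i j) =
        mat_trace (Z * mat_unit n n i j)"
      if "i < n" "j < n" for i j
      using mat_trace_mult_unit[OF Z that] that by (simp add: Z_def)
  qed
qed

lemma adjoint_map_eqI:
  assumes "X \<in> carrier_mat k k"
    and "\<And>Z. Z \<in> carrier_mat k k \<Longrightarrow> mat_trace (Y * \<Psi> Z) = mat_trace (X * Z)"
  shows "adjoint_map k \<Psi> Y = X"
  unfolding adjoint_map_def
proof (rule the_equality)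
  show "X \<in> carrier_mat k k \<and> (\<forall>Z\<in>carrier_mat k k. mat_trace (Y * \<Psi> Z) = mat_trace (X * Z))"
    using assms by blast
  fix X' assume X': "X' \<in> carrier_mat k k \<and> (\<forall>Z\<in>carrier_mat k k. mat_trace (Y * \<Psi> Z) = mat_trace (X' * Z))"
  show "X' = X"
  proof (rule mat_eq_by_trace[of _ k])
    show "mat_trace (X' * Z) = mat_trace (X * Z)" if "Z \<in> carrier_mat k k" for Z
      using X' assms(2)[OF that] that by metis
  qed (use X' assms in blast)+
qed

text \<open>With \<open>adjoint_map_eqI\<close> this replaces the definite description in
  \<open>adjoint_map\<close> by a trace identity: here the existence of the adjoint is supplied,
  there its uniqueness.\<close>

lemma adjoint_map_trace:
  assumes \<Psi>: "linear_map k l \<Psi>" and Y: "Y \<in> carrier_mat l l" and Z: "Z \<in> carrier_mat k k"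
  shows "mat_trace (Y * \<Psi> Z) = mat_trace (adjoint_map k \<Psi> Y * Z)"
proof -
  have c: "\<Psi> A \<in> carrier_mat l l" if "A \<in> carrier_mat k k" for A using \<Psi> that by (simp add: linear_map_def)
  obtain X where X: "X \<in> carrier_mat k k" "\<And>A. A \<in> carrier_mat k k \<Longrightarrow> mat_trace (Y * \<Psi> A) = mat_trace (X * A)"
  proof (rule linear_functional_trace[of k "\<lambda>A. mat_trace (Y * \<Psi> A)"])
    show "mat_trace (Y * \<Psi> (A + B)) = mat_trace (Y * \<Psi> A) + mat_trace (Y * \<Psi> B)"
      if A: "A \<in> carrier_mat k k" and B: "B \<in> carrier_mat k k" for A B
      using \<Psi> A B mult_add_distrib_mat[OF Y c[OF A] c[OF B]]
        mat_trace_add[OF mult_carrier_mat[OF Y c[OF A]] mult_carrier_mat[OF Y c[OF B]]]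
      by (simp add: linear_map_def)
    show "mat_trace (Y * \<Psi> (a \<cdot>\<^sub>m A)) = a * mat_trace (Y * \<Psi> A)" if A: "A \<in> carrier_mat k k" for a A
      using \<Psi> A mult_smult_distrib[OF Y c[OF A]] mat_trace_smult[OF mult_carrier_mat[OF Y c[OF A]]]
      by (simp add: linear_map_def)
  qed blast
  have "adjoint_map k \<Psi> Y = X" by (rule adjoint_map_eqI) (use X in auto)
  then show ?thesis using X(2)[OF Z] by simp
qed

section \<open>Channels\<close>

lemma linear_map_comp:
  "linear_map n m f \<Longrightarrow> linear_map m k g \<Longrightarrow> linear_map n k (g \<circ> f)"
  by (simp add: linear_map_def)

lemma linear_map_restrict:
  assumes "linear_map n m \<Phi>" "V \<in> carrier_mat n k"
  shows "linear_map k m (restrict_map V \<Phi>)"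
proof -
  have [simp]: "dim_row V = n" "dim_col V = k" using assms by auto
  have c: "V * Y * mat_adjoint V \<in> carrier_mat n n" for Y by (rule carrier_matI) auto
  have "V * (X + Y) * mat_adjoint V = V * X * mat_adjoint V + V * Y * mat_adjoint V"
    if "X \<in> carrier_mat k k" "Y \<in> carrier_mat k k" for X Y
    using carrier_matD[OF that(1)] carrier_matD[OF that(2)] by (simp add: mat_distribs)
  moreover have "V * (a \<cdot>\<^sub>m X) * mat_adjoint V = a \<cdot>\<^sub>m (V * X * mat_adjoint V)"
    if "X \<in> carrier_mat k k" for a X
    using carrier_matD[OF that] by (simp add: mat_distribs)
  ultimately show ?thesis using assms(1) c by (simp add: linear_map_def restrict_map_def)
qed

lemma block_index_less:
  fixes i a r k :: nat
  assumes "i < r" "a < k"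
  shows "i * k + a < r * k"
proof -
  have "i * k + a < i * k + k" using assms by simp
  also have "\<dots> = Suc i * k" by simp
  also have "\<dots> \<le> r * k" using assms by (intro mult_le_mono1) simp
  finally show ?thesis .
qed

lemma mat_block_ampliation:
  assumes D: "\<And>Y. Y \<in> carrier_mat m m \<Longrightarrow> D Y \<in> carrier_mat k k" and ij: "i < r" "j < r"
  shows "mat_block k (ampliation r m k D X) i j = D (mat_block m X i j)"
proof -
  have [simp]: "dim_row (D (mat_block m X i j)) = k" "dim_col (D (mat_block m X i j)) = k"
    using D[of "mat_block m X i j"] by (auto simp: mat_block_def)
  show ?thesis
    by (rule eq_matI) (use block_index_less ij in \<open>auto simp: mat_block_def[of k] ampliation_def\<close>)
qed

text \<open>Complete positivity composes because ampliation does: the blocks of an ampliated matrix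
  are the images of the blocks.\<close>

lemma channel_comp:
  assumes D: "channel m k D" and R: "channel k l R"
  shows "channel m l (R \<circ> D)"
proof -
  have Dc: "D Y \<in> carrier_mat k k" if "Y \<in> carrier_mat m m" for Y
    using D that by (simp add: channel_def linear_map_def)
  have "ampliation r m l (R \<circ> D) X = ampliation r k l R (ampliation r m k D X)" for r X
  proof (rule eq_matI)
    fix a b assume "a < dim_row (ampliation r k l R (ampliation r m k D X))"
      "b < dim_col (ampliation r k l R (ampliation r m k D X))"
    then have ab: "a < r * l" "b < r * l" by (auto simp: ampliation_def)
    then have "a div l < r" "b div l < r" by (auto simp: less_mult_imp_div_less)
    then show "ampliation r m l (R \<circ> D) X $$ (a, b) = ampliation r k l R (ampliation r m k D X) $$ (a, b)"
      using ab mat_block_ampliation[of m D k "a div l" r "b div l" X] Dc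
      by (simp add: ampliation_def[of r _ l])
  qed (auto simp: ampliation_def)
  then have "completely_positive m l (R \<circ> D)"
    using D R by (simp add: channel_def completely_positive_def)
  then show ?thesis
    using D R Dc linear_map_comp[of m k D l R] by (simp add: channel_def trace_preserving_def)
qed

lemma sum_block:
  fixes h :: "nat \<Rightarrow> 'a :: comm_monoid_add"
  shows "(\<Sum>x<r * k. h x) = (\<Sum>i<r. \<Sum>a<k. h (i * k + a))"
proof -
  have "(\<Sum>x<r * k. h x) = (\<Sum>i<r. sum h {i * k..<i * k + k})" by (rule sum.nat_group[symmetric])
  also have "\<dots> = (\<Sum>i<r. \<Sum>a<k. h (i * k + a))"
  proof (rule sum.cong)
    fix i
    show "sum h {i * k..<i * k + k} = (\<Sum>a<k. h (i * k + a))"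
      using sum.shift_bounds_nat_ivl[of h 0 "i * k" k] by (simp add: lessThan_atLeast0 add.commute)
  qed simp
  finally show ?thesis .
qed

lemma quadratic_form:
  assumes "X \<in> carrier_mat n n" "v \<in> carrier_vec n"
  shows "(X *\<^sub>v v) \<bullet>c v = (\<Sum>a<n. \<Sum>b<n. X $$ (a, b) * v $ b * cnj (v $ a))"
  using assms by (auto simp: scalar_prod_def sum_distrib_right lessThan_atLeast0 intro!: sum.cong)

text \<open>A map in Kraus form is completely positive: the quadratic form of the ampliated matrix
  at \<open>v\<close> is the sum over \<open>t\<close> of the quadratic form of \<open>X\<close> at
  the vectors \<open>w t\<close>. The Kraus operators are given by their entries
  \<open>K t a q\<close>.\<close>

lemma completely_positive_kraus:
  fixes K :: "'t \<Rightarrow> nat \<Rightarrow> nat \<Rightarrow> complex"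
  assumes R: "\<And>Z a b. Z \<in> carrier_mat k k \<Longrightarrow> a < l \<Longrightarrow> b < l \<Longrightarrow>
    R Z $$ (a, b) = (\<Sum>t\<in>T. \<Sum>q<k. \<Sum>q'<k. K t a q * Z $$ (q, q') * cnj (K t b q'))"
  shows "completely_positive k l R"
  unfolding completely_positive_def
proof (intro allI impI)
  fix r X assume X: "positive_semidefinite (r * k) X"
  let ?Y = "ampliation r k l R X"
  have Y: "?Y \<in> carrier_mat (r * l) (r * l)" by (simp add: ampliation_def)
  show "positive_semidefinite (r * l) ?Y"
    unfolding positive_semidefinite_def
  proof (intro conjI ballI Y)
    fix v :: "complex vec" assume v: "v \<in> carrier_vec (r * l)"
    \<comment> \<open>The adjoint of the operator 1 \<otimes> K_t applied to \<open>v\<close>, with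
      the index split into block number and position in the block.\<close>
    define w where "w t = vec (r * k) (\<lambda>x. \<Sum>b<l. cnj (K t b (x mod k)) * v $ (x div k * l + b))" for t
    have w: "w t \<in> carrier_vec (r * k)" for t by (simp add: w_def)
    have wn: "w t $ (i * k + q) = (\<Sum>b<l. cnj (K t b q) * v $ (i * l + b))" if "i < r" "q < k" for t i q
      using block_index_less[OF that] that by (simp add: w_def)
    have Yn: "?Y $$ (i * l + a, j * l + b) =
        (\<Sum>t\<in>T. \<Sum>q<k. \<Sum>q'<k. K t a q * X $$ (i * k + q, j * k + q') * cnj (K t b q'))"
      if "i < r" "j < r" "a < l" "b < l" for i j a b
    proof -
      have "?Y $$ (i * l + a, j * l + b) = R (mat_block k X i j) $$ (a, b)"
        using that block_index_less[OF that(1,3)] block_index_less[OF that(2,4)] by (simp add: ampliation_def)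
      also have "\<dots> = (\<Sum>t\<in>T. \<Sum>q<k. \<Sum>q'<k. K t a q * mat_block k X i j $$ (q, q') * cnj (K t b q'))"
        using that by (intro R) (auto simp: mat_block_def)
      finally show ?thesis by (simp add: mat_block_def)
    qed
    define F where "F t i j a b q q' =
      K t a q * X $$ (i * k + q, j * k + q') * cnj (K t b q') * v $ (j * l + b) * cnj (v $ (i * l + a))"
      for t i j a b q q'
    have "(?Y *\<^sub>v v) \<bullet>c v = (\<Sum>i<r. \<Sum>a<l. \<Sum>j<r. \<Sum>b<l. ?Y $$ (i * l + a, j * l + b) * v $ (j * l + b) * cnj (v $ (i * l + a)))"
      by (simp add: quadratic_form[OF Y v] sum_block)
    also have "\<dots> = (\<Sum>i<r. \<Sum>a<l. \<Sum>j<r. \<Sum>b<l. \<Sum>t\<in>T. \<Sum>q<k. \<Sum>q'<k. F t i j a b q q')"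
      by (intro sum.cong refl) (simp add: Yn F_def sum_distrib_right)
    also have "\<dots> = (\<Sum>t\<in>T. \<Sum>i<r. \<Sum>j<r. \<Sum>a<l. \<Sum>b<l. \<Sum>q<k. \<Sum>q'<k. F t i j a b q q')"
    proof -
      have "(\<Sum>i<r. \<Sum>a<l. \<Sum>j<r. \<Sum>b<l. \<Sum>t\<in>T. \<Sum>q<k. \<Sum>q'<k. F t i j a b q q') =
          (\<Sum>i<r. \<Sum>a<l. \<Sum>j<r. \<Sum>t\<in>T. \<Sum>b<l. \<Sum>q<k. \<Sum>q'<k. F t i j a b q q')"
        by (intro sum.cong refl sum.swap)
      also have "\<dots> = (\<Sum>i<r. \<Sum>a<l. \<Sum>t\<in>T. \<Sum>j<r. \<Sum>b<l. \<Sum>q<k. \<Sum>q'<k. F t i j a b q q')"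
        by (intro sum.cong refl sum.swap)
      also have "\<dots> = (\<Sum>i<r. \<Sum>t\<in>T. \<Sum>a<l. \<Sum>j<r. \<Sum>b<l. \<Sum>q<k. \<Sum>q'<k. F t i j a b q q')"
        by (intro sum.cong refl sum.swap)
      also have "\<dots> = (\<Sum>t\<in>T. \<Sum>i<r. \<Sum>a<l. \<Sum>j<r. \<Sum>b<l. \<Sum>q<k. \<Sum>q'<k. F t i j a b q q')"
        by (rule sum.swap)
      also have "\<dots> = (\<Sum>t\<in>T. \<Sum>i<r. \<Sum>j<r. \<Sum>a<l. \<Sum>b<l. \<Sum>q<k. \<Sum>q'<k. F t i j a b q q')"
        by (intro sum.cong refl sum.swap)
      finally show ?thesis .
    qed
    also have "\<dots> = (\<Sum>t\<in>T. (X *\<^sub>v w t) \<bullet>c w t)"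
    proof (rule sum.cong[OF refl])
      fix t
      have Xc: "X \<in> carrier_mat (r * k) (r * k)" using X by (simp add: positive_semidefinite_def)
      have "(\<Sum>a<l. \<Sum>b<l. \<Sum>q<k. \<Sum>q'<k. F t i j a b q q') =
          (\<Sum>q<k. \<Sum>q'<k. X $$ (i * k + q, j * k + q') * w t $ (j * k + q') * cnj (w t $ (i * k + q)))"
        if ij: "i < r" "j < r" for i j
      proof -
        have "(\<Sum>a<l. \<Sum>b<l. \<Sum>q<k. \<Sum>q'<k. F t i j a b q q') =
            (\<Sum>a<l. \<Sum>q<k. \<Sum>b<l. \<Sum>q'<k. F t i j a b q q')"
          by (intro sum.cong refl sum.swap)
        also have "\<dots> = (\<Sum>q<k. \<Sum>a<l. \<Sum>b<l. \<Sum>q'<k. F t i j a b q q')" by (rule sum.swap)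
        also have "\<dots> = (\<Sum>q<k. \<Sum>a<l. \<Sum>q'<k. \<Sum>b<l. F t i j a b q q')"
          by (intro sum.cong refl sum.swap)
        also have "\<dots> = (\<Sum>q<k. \<Sum>q'<k. \<Sum>a<l. \<Sum>b<l. F t i j a b q q')"
          by (intro sum.cong refl sum.swap)
        also have "\<dots> = (\<Sum>q<k. \<Sum>q'<k. X $$ (i * k + q, j * k + q') * w t $ (j * k + q') * cnj (w t $ (i * k + q)))"
        proof (intro sum.cong refl)
          fix q q' assume "q \<in> {..<k}" "q' \<in> {..<k}"
          then have q: "q < k" "q' < k" by auto
          have "(\<Sum>a<l. \<Sum>b<l. F t i j a b q q') =
              (\<Sum>a<l. \<Sum>b<l. (X $$ (i * k + q, j * k + q') * (cnj (K t b q') * v $ (j * l + b))) * (K t a q * cnj (v $ (i * l + a))))"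
            by (intro sum.cong refl) (simp add: F_def mult_ac)
          also have "\<dots> = X $$ (i * k + q, j * k + q') * (\<Sum>b<l. cnj (K t b q') * v $ (j * l + b)) *
              (\<Sum>a<l. K t a q * cnj (v $ (i * l + a)))"
            by (simp add: sum_distrib_left sum_distrib_right)
          finally show "(\<Sum>a<l. \<Sum>b<l. F t i j a b q q') =
              X $$ (i * k + q, j * k + q') * w t $ (j * k + q') * cnj (w t $ (i * k + q))"
            using wn[OF ij(1) q(1)] wn[OF ij(2) q(2)] by simp
        qed
        finally show ?thesis .
      qed
      then have "(\<Sum>i<r. \<Sum>j<r. \<Sum>a<l. \<Sum>b<l. \<Sum>q<k. \<Sum>q'<k. F t i j a b q q') =
          (\<Sum>i<r. \<Sum>j<r. \<Sum>q<k. \<Sum>q'<k. X $$ (i * k + q, j * k + q') * w t $ (j * k + q') * cnj (w t $ (i * k + q)))"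
        by - (rule sum.cong[OF refl], rule sum.cong[OF refl], simp)
      also have "\<dots> = (\<Sum>i<r. \<Sum>q<k. \<Sum>j<r. \<Sum>q'<k. X $$ (i * k + q, j * k + q') * w t $ (j * k + q') * cnj (w t $ (i * k + q)))"
        by (intro sum.cong refl sum.swap)
      also have "\<dots> = (X *\<^sub>v w t) \<bullet>c w t"
        by (simp add: quadratic_form[OF Xc w] sum_block)
      finally show "(\<Sum>i<r. \<Sum>j<r. \<Sum>a<l. \<Sum>b<l. \<Sum>q<k. \<Sum>q'<k. F t i j a b q q') = (X *\<^sub>v w t) \<bullet>c w t" .
    qed
    finally have "(?Y *\<^sub>v v) \<bullet>c v = (\<Sum>t\<in>T. (X *\<^sub>v w t) \<bullet>c w t)" .
    moreover have "0 \<le> (X *\<^sub>v w t) \<bullet>c w t" for t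
      using X w[of t] by (simp add: positive_semidefinite_def)
    ultimately show "0 \<le> (?Y *\<^sub>v v) \<bullet>c v" by (simp add: sum_nonneg)
  qed
qed

text \<open>Compression by \<open>A\<close>; the lost weight, measured by the projection \<open>g\<close>, is sent to a fixed
  pure state so as to preserve the trace.\<close>

lemma compression_channel:
  assumes A: "A \<in> carrier_mat l k" and g: "g \<in> carrier_mat k k" "g * g = g" "mat_adjoint g = g"
    and sum: "mat_adjoint A * A + g = 1\<^sub>m k" and l: "l > 0"
  defines "E \<equiv> mat_unit l l 0 0"
  shows "channel k l (\<lambda>Z. A * Z * mat_adjoint A + mat_trace (g * Z) \<cdot>\<^sub>m E)"
proof -
  let ?R = "\<lambda>Z. A * Z * mat_adjoint A + mat_trace (g * Z) \<cdot>\<^sub>m E"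
  have [simp]: "dim_row A = l" "dim_col A = k" "dim_row g = k" "dim_col g = k" "dim_row E = l" "dim_col E = l"
    using A g by (auto simp: E_def)
  have Ec: "E \<in> carrier_mat l l" by (simp add: E_def)
  have Rc: "?R Z \<in> carrier_mat l l" for Z by (rule carrier_matI) auto
  have trE: "mat_trace E = 1" using l by (simp add: mat_trace_def E_def)
  have lin: "linear_map k l ?R"
    unfolding linear_map_def
  proof (intro conjI ballI allI Rc)
    fix X Y :: "complex mat" assume X: "X \<in> carrier_mat k k" and Y: "Y \<in> carrier_mat k k"
    note [simp] = carrier_matD[OF X] carrier_matD[OF Y]
    have "mat_trace (g * (X + Y)) = mat_trace (g * X) + mat_trace (g * Y)"
      using mat_trace_add[OF mult_carrier_mat[OF g(1) X] mult_carrier_mat[OF g(1) Y]] by (simp add: mat_distribs)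
    moreover have "A * (X + Y) * mat_adjoint A = A * X * mat_adjoint A + A * Y * mat_adjoint A"
      by (simp add: mat_distribs)
    ultimately show "?R (X + Y) = ?R X + ?R Y"
      by (intro eq_matI) (auto simp del: index_mult_mat(1) simp: algebra_simps)
  next
    fix c and X :: "complex mat" assume X: "X \<in> carrier_mat k k"
    note [simp] = carrier_matD[OF X]
    have "mat_trace (g * (c \<cdot>\<^sub>m X)) = c * mat_trace (g * X)"
      using mat_trace_smult[OF mult_carrier_mat[OF g(1) X]] by (simp add: mat_distribs)
    moreover have "A * (c \<cdot>\<^sub>m X) * mat_adjoint A = c \<cdot>\<^sub>m (A * X * mat_adjoint A)"
      by (simp add: mat_distribs)
    ultimately show "?R (c \<cdot>\<^sub>m X) = c \<cdot>\<^sub>m ?R X"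
      by (intro eq_matI) (auto simp del: index_mult_mat(1) simp: algebra_simps)
  qed
  have tp: "trace_preserving k ?R"
    unfolding trace_preserving_def
  proof
    fix Z :: "complex mat" assume Z: "Z \<in> carrier_mat k k"
    note [simp] = carrier_matD[OF Z]
    have AZ: "A * Z \<in> carrier_mat l k" using A Z by (rule mult_carrier_mat)
    have AA: "mat_adjoint A * A \<in> carrier_mat k k" by (rule carrier_matI) auto
    have "mat_trace (?R Z) = mat_trace (A * Z * mat_adjoint A) + mat_trace (mat_trace (g * Z) \<cdot>\<^sub>m E)"
      by (rule mat_trace_add[of _ l]) (auto intro!: carrier_matI)
    also have "mat_trace (mat_trace (g * Z) \<cdot>\<^sub>m E) = mat_trace (g * Z)"
      using mat_trace_smult[OF Ec] trE by simp
    also have "mat_trace (A * Z * mat_adjoint A) = mat_trace (mat_adjoint A * (A * Z))"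
      by (rule mat_trace_commute[OF AZ mat_adjoint_carrier[OF A]])
    also have "mat_adjoint A * (A * Z) = (mat_adjoint A * A) * Z" by (simp add: mat_assoc)
    also have "mat_trace ((mat_adjoint A * A) * Z) + mat_trace (g * Z) = mat_trace ((mat_adjoint A * A + g) * Z)"
      using mat_trace_add[OF mult_carrier_mat[OF AA Z] mult_carrier_mat[OF g(1) Z]]
      by (simp add: mat_distribs)
    finally show "mat_trace (?R Z) = mat_trace Z" by (simp add: sum)
  qed
  \<comment> \<open>One Kraus operator is \<open>A\<close>. The others realise the second summand:
    the operator for \<open>Some i\<close> has row \<open>i\<close> of \<open>g\<close> as its row 0
    and zeros elsewhere, so its output is supported at (0, 0), like \<open>E\<close>.\<close>
  define K where "K t a q = (case t of None \<Rightarrow> A $$ (a, q) | Some i \<Rightarrow> if a = 0 then g $$ (i, q) else 0)"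
    for t :: "nat option" and a q
  have "completely_positive k l ?R"
  proof (rule completely_positive_kraus[where K = K and T = "insert None (Some ` {..<k})"])
    fix Z :: "complex mat" and a b assume Z: "Z \<in> carrier_mat k k" and ab: "a < l" "b < l"
    note [simp] = carrier_matD[OF Z]
    have conj: "(B * Z * mat_adjoint B) $$ (a, b) = (\<Sum>q<k. \<Sum>q'<k. B $$ (a, q) * Z $$ (q, q') * cnj (B $$ (b, q')))"
      if B: "B \<in> carrier_mat c k" "a < c" "b < c" for B c a b
    proof -
      have "(B * Z * mat_adjoint B) $$ (a, b) = (\<Sum>q'<k. \<Sum>q<k. B $$ (a, q) * Z $$ (q, q') * cnj (B $$ (b, q')))"
        using B by (auto simp: scalar_prod_def sum_distrib_right lessThan_atLeast0 intro!: sum.cong)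
      also have "\<dots> = (\<Sum>q<k. \<Sum>q'<k. B $$ (a, q) * Z $$ (q, q') * cnj (B $$ (b, q')))" by (rule sum.swap)
      finally show ?thesis .
    qed
    \<comment> \<open>For the projection \<open>g\<close> the lost weight becomes a trace of
      \<open>g * Z * mat_adjoint g\<close>, hence a sum over the rows of \<open>g\<close> in Kraus
      form.\<close>
    have "mat_trace (g * Z) = mat_trace ((g * g) * Z)" by (simp add: g)
    also have "\<dots> = mat_trace (g * (g * Z))" by (simp add: mat_assoc)
    also have "\<dots> = mat_trace ((g * Z) * g)"
      by (rule mat_trace_commute[OF g(1) mult_carrier_mat[OF g(1) Z]])
    also have "\<dots> = mat_trace (g * Z * mat_adjoint g)" by (simp add: g)
    also have "\<dots> = (\<Sum>i<k. (g * Z * mat_adjoint g) $$ (i, i))" by (simp add: mat_trace_def del: index_mult_mat(1))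
    also have "\<dots> = (\<Sum>i<k. \<Sum>q<k. \<Sum>q'<k. g $$ (i, q) * Z $$ (q, q') * cnj (g $$ (i, q')))"
      using conj[OF g(1)] by (intro sum.cong) auto
    finally have tr: "mat_trace (g * Z) = \<dots>" .
    have "?R Z $$ (a, b) = (A * Z * mat_adjoint A) $$ (a, b) + mat_trace (g * Z) * E $$ (a, b)"
      using ab by (simp del: index_mult_mat(1))
    also have "mat_trace (g * Z) * E $$ (a, b) =
        (\<Sum>i<k. \<Sum>q<k. \<Sum>q'<k. K (Some i) a q * Z $$ (q, q') * cnj (K (Some i) b q'))"
      using ab tr by (simp add: K_def E_def)
    also have "(A * Z * mat_adjoint A) $$ (a, b) = (\<Sum>q<k. \<Sum>q'<k. K None a q * Z $$ (q, q') * cnj (K None b q'))"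
      using conj[OF A ab] by (simp add: K_def)
    finally show "?R Z $$ (a, b) = (\<Sum>t\<in>insert None (Some ` {..<k}). \<Sum>q<k. \<Sum>q'<k. K t a q * Z $$ (q, q') * cnj (K t b q'))"
      by (simp add: sum.reindex)
  qed
  then show ?thesis using lin tp by (simp add: channel_def)
qed

section \<open>Transmittable algebras\<close>

lemma range_inclusion_simps:
  assumes "range_inclusion n k P V"
  shows "dim_row V = n" "dim_col V = k" "mat_adjoint V * V = 1\<^sub>m k" "V * mat_adjoint V = P"
  using assms by (auto simp: range_inclusion_def)

lemma star_subalgebra_star_closed: "star_subalgebra n S \<Longrightarrow> star_closed n S"
  by (simp add: star_subalgebra_def star_closed_def)

lemma star_subalgebra_image:
  assumes B: "is_star_algebra B" and g: "star_hom B (matrix_alg n) g" "inj_on g (elems B)"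
    and nz: "elems B \<noteq> {zero_alg B}"
  shows "star_subalgebra n (g ` elems B)"
proof -
  note gh = star_homD[OF g(1), simplified] and BD = star_algebraD[OF B]
  have g0: "g (zero_alg B) = 0\<^sub>m n n"
    using star_hom_zero[OF B star_algebra_matrix_alg g(1)] by simp
  show ?thesis
    unfolding star_subalgebra_def
  proof (intro conjI ballI allI)
    show "g ` elems B \<subseteq> carrier_mat n n" using gh by auto
    show "0\<^sub>m n n \<in> g ` elems B" using BD(1) g0 by (metis imageI)
    obtain x where x: "x \<in> elems B" "x \<noteq> zero_alg B" using nz BD(1) by blast
    then have "g x \<noteq> 0\<^sub>m n n" using inj_onD[OF g(2) _ x(1) BD(1)] g0 by metis
    then show "g ` elems B \<noteq> {0\<^sub>m n n}" using x by blast
  next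
    fix X Y assume "X \<in> g ` elems B" "Y \<in> g ` elems B"
    then obtain x y where xy: "x \<in> elems B" "X = g x" "y \<in> elems B" "Y = g y" by blast
    show "X + Y \<in> g ` elems B" using gh(2)[OF xy(1,3)] BD(2)[OF xy(1,3)] xy by (metis imageI)
    show "X * Y \<in> g ` elems B" using gh(4)[OF xy(1,3)] BD(3)[OF xy(1,3)] xy by (metis imageI)
  next
    fix c X assume "X \<in> g ` elems B"
    then obtain x where x: "x \<in> elems B" "X = g x" by blast
    show "c \<cdot>\<^sub>m X \<in> g ` elems B" using gh(3)[OF x(1)] BD(4)[OF x(1)] x by (metis imageI)
  next
    fix X assume "X \<in> g ` elems B"
    then obtain x where x: "x \<in> elems B" "X = g x" by blast
    show "mat_adjoint X \<in> g ` elems B" using gh(5)[OF x(1)] BD(5)[OF x(1)] x by (metis imageI)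
  qed
qed

text \<open>The new decoder follows \<open>\<D>\<close> by compression \<open>R\<close> from the
  range of \<open>P\<close> to that of \<open>Q\<close>, with \<open>A = mat_adjoint W * V\<close>
  the change of coordinates. For inputs on the range of \<open>Q\<close> the lost weight is zero, so
  the fixed state added by \<open>R\<close> does not disturb expectations.\<close>

lemma correctable_subset:
  assumes \<Phi>: "channel n m \<Phi>" and S: "correctable n m \<Phi> S"
    and T: "star_subalgebra n T" "T \<subseteq> S" and Q: "unit_projection T Q"
  shows "correctable n m \<Phi> T"
proof -
  obtain P k V \<D> where P: "unit_projection S P" and V: "range_inclusion n k P V"
    and D: "channel m k \<D>"
    and cor: "\<And>Y. Y \<in> S \<Longrightarrow> adjoint_map k (\<D> \<circ> restrict_map V \<Phi>) (mat_adjoint V * Y * V) = mat_adjoint V * Y * V"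
    using S by (auto simp: correctable_def)
  have Sc: "star_closed n S" using S by (auto simp: correctable_def intro: star_subalgebra_star_closed)
  note SD = star_closedD[OF Sc] and SC = star_closed_dims[OF Sc]
  have QT: "Q \<in> T" "Q * Q = Q" "mat_adjoint Q = Q" "\<And>X. X \<in> T \<Longrightarrow> Q * X = X \<and> X * Q = X"
    using Q by (auto simp: unit_projection_def)
  have QS: "Q \<in> S" using QT T by blast
  have PS: "P \<in> S" "P * P = P" "mat_adjoint P = P" "\<And>X. X \<in> S \<Longrightarrow> P * X = X \<and> X * P = X"
    using P by (auto simp: unit_projection_def)
  have PQ: "P * Q = Q" "Q * P = Q" using PS(4)[OF QS] by auto
  note [simp] = SC[OF QS] SC[OF PS(1)]
  obtain l W where W: "range_inclusion n l Q W"
    by (rule projection_range_inclusion[OF SD(1)[OF QS] QT(2,3)])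
  note Vs [simp] = range_inclusion_simps(1,2)[OF V] and VV = range_inclusion_simps(3,4)[OF V]
  note Ws [simp] = range_inclusion_simps(1,2)[OF W] and WW = range_inclusion_simps(3,4)[OF W]
  have Vc: "V \<in> carrier_mat n k" and Wc: "W \<in> carrier_mat n l" by (auto intro!: carrier_matI)
  have QW: "Q * W = W" unfolding WW(2)[symmetric] by (simp add: mat_assoc WW(1))
  have WQ: "mat_adjoint W * Q = mat_adjoint W" using arg_cong[OF QW, of mat_adjoint] by (simp add: mat_adjoint_mult QT)
  have PW: "P * W = W" using QW PQ mat_assoc[of P Q W] by simp
  have WP: "mat_adjoint W * P = mat_adjoint W" using WQ PQ mat_assoc[of "mat_adjoint W" Q P] by simp
  \<comment> \<open>The fixed state of the compression needs a nonzero space. It exists because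
    \<open>T\<close> is not zero, so its unit \<open>Q\<close> is not zero either.\<close>
  have l: "l > 0"
  proof (rule ccontr)
    assume "\<not> l > 0"
    then have "Q = 0\<^sub>m n n" unfolding WW(2)[symmetric] by (intro eq_matI) (auto simp: scalar_prod_def)
    then have "X = 0\<^sub>m n n" if "X \<in> T" for X
      using QT(4)[OF that] SC[OF subsetD[OF T(2) that]] by simp
    then show False using T(1) by (auto simp: star_subalgebra_def)
  qed
  define A where "A = mat_adjoint W * V"
  have Ac: "A \<in> carrier_mat l k" by (auto simp: A_def intro!: carrier_matI)
  note [simp] = carrier_matD[OF Ac]
  \<comment> \<open>\<open>G\<close> is the part of the code space of \<open>S\<close> outside that
    of \<open>T\<close>. It belongs to \<open>S\<close>, so the old decoder preserves its
    expectation as well; \<open>g\<close> is \<open>G\<close> in the coordinates of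
    \<open>V\<close>.\<close>
  define G where "G = P + (-1) \<cdot>\<^sub>m Q"
  have GS: "G \<in> S" using SD PS QS by (auto simp: G_def)
  note [simp] = SC[OF GS]
  have GG: "G * G = G"
    by (auto simp: G_def mat_distribs PS QT PQ intro!: eq_matI simp del: index_mult_mat(1))
  have Gh: "mat_adjoint G = G" by (simp add: G_def mat_adjoint_add mat_adjoint_smult PS QT)
  define g where "g = mat_adjoint V * G * V"
  have gc: "g \<in> carrier_mat k k" by (auto simp: g_def intro!: carrier_matI)
  have "g * g = mat_adjoint V * (G * (V * mat_adjoint V) * G) * V" by (simp add: g_def mat_assoc)
  also have "G * (V * mat_adjoint V) * G = G" using PS(4)[OF GS] GG by (simp add: VV)
  finally have gg: "g * g = g" by (simp add: g_def)
  have gh: "mat_adjoint g = g" by (simp add: g_def mat_adjoint_mult Gh mat_assoc)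
  have AA: "mat_adjoint A * A = mat_adjoint V * Q * V"
    unfolding WW(2)[symmetric] by (simp add: A_def mat_adjoint_mult mat_assoc)
  have "mat_adjoint V * P * V = 1\<^sub>m k"
  proof -
    have "mat_adjoint V * P * V = (mat_adjoint V * V) * (mat_adjoint V * V)"
      unfolding VV(2)[symmetric] by (simp only: mat_assoc Vs dim_mat_adjoint index_mult_mat)
    then show ?thesis by (simp add: VV)
  qed
  moreover have "g = mat_adjoint V * P * V + (-1) \<cdot>\<^sub>m (mat_adjoint V * Q * V)"
    by (simp add: g_def G_def mat_distribs)
  ultimately have sum: "mat_adjoint A * A + g = 1\<^sub>m k"
    using AA by (auto intro!: eq_matI simp del: index_mult_mat(1))
  have AAt: "A * mat_adjoint A = 1\<^sub>m l"
  proof -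
    have "A * mat_adjoint A = mat_adjoint W * (V * mat_adjoint V) * W" by (simp add: A_def mat_adjoint_mult mat_assoc)
    also have "\<dots> = 1\<^sub>m l" by (simp add: VV WP WW)
    finally show ?thesis .
  qed
  define E :: "complex mat" where "E = mat_unit l l 0 0"
  have Ec: "E \<in> carrier_mat l l" by (simp add: E_def)
  note [simp] = carrier_matD[OF Ec]
  define R where "R Z = A * Z * mat_adjoint A + mat_trace (g * Z) \<cdot>\<^sub>m E" for Z
  have R: "channel k l R"
    using compression_channel[OF Ac gc gg gh sum l] unfolding R_def[abs_def] E_def .
  have chD': "channel m l (R \<circ> \<D>)" by (rule channel_comp[OF D R])
  let ?\<Psi> = "\<D> \<circ> restrict_map V \<Phi>"
  have lin: "linear_map k k ?\<Psi>"
    using \<Phi> D Vc by (auto simp: channel_def intro!: linear_map_comp linear_map_restrict)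
  \<comment> \<open>Correctability in terms of expectations: decoding the channel output leaves the
    trace against every element of \<open>S\<close> unchanged.\<close>
  have tr: "mat_trace (mat_adjoint V * Y * V * ?\<Psi> Z) = mat_trace (mat_adjoint V * Y * V * Z)"
    if "Y \<in> S" "Z \<in> carrier_mat k k" for Y Z
  proof -
    have "mat_adjoint V * Y * V \<in> carrier_mat k k" using SC[OF that(1)] by (auto intro!: carrier_matI)
    from adjoint_map_trace[OF lin this that(2)] show ?thesis by (simp add: cor[OF that(1)])
  qed
  have "adjoint_map l ((R \<circ> \<D>) \<circ> restrict_map W \<Phi>) (mat_adjoint W * Y * W) = mat_adjoint W * Y * W"
    if Y: "Y \<in> T" for Y
  proof (rule adjoint_map_eqI)
    have YS: "Y \<in> S" using Y T by blast
    note [simp] = SC[OF YS]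
    let ?X = "mat_adjoint W * Y * W"
    show Xc: "?X \<in> carrier_mat l l" by (auto intro!: carrier_matI)
    fix Z :: "complex mat" assume Z: "Z \<in> carrier_mat l l"
    note [simp] = carrier_matD[OF Z]
    define Z' where "Z' = mat_adjoint A * Z * A"
    have Zc: "Z' \<in> carrier_mat k k" by (auto simp: Z'_def intro!: carrier_matI)
    define M where "M = ?\<Psi> Z'"
    have Mc: "M \<in> carrier_mat k k" using lin Zc by (simp add: linear_map_def M_def)
    note [simp] = carrier_matD[OF Mc] carrier_matD[OF Zc]
    \<comment> \<open>\<open>Z'\<close> is \<open>Z\<close> in the coordinates of the larger code
      space; on H both are the same operator, so \<open>\<Phi>\<close> receives the same
      input.\<close>
    have "V * Z' * mat_adjoint V = (V * mat_adjoint V) * W * Z * mat_adjoint W * (V * mat_adjoint V)"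
      by (simp add: Z'_def A_def mat_adjoint_mult mat_assoc)
    also have "\<dots> = P * W * Z * (mat_adjoint W * P)" by (simp add: VV mat_assoc)
    also have "\<dots> = W * Z * mat_adjoint W" by (simp add: PW WP)
    finally have "((R \<circ> \<D>) \<circ> restrict_map W \<Phi>) Z = R M" by (simp add: restrict_map_def M_def)
    also have "mat_trace (?X * R M) = mat_trace (?X * (A * M * mat_adjoint A)) + mat_trace (g * M) * mat_trace (?X * E)"
    proof -
      have "?X * R M = ?X * (A * M * mat_adjoint A) + mat_trace (g * M) \<cdot>\<^sub>m (?X * E)"
        by (simp add: R_def mat_distribs)
      also have "mat_trace \<dots> = mat_trace (?X * (A * M * mat_adjoint A)) + mat_trace (mat_trace (g * M) \<cdot>\<^sub>m (?X * E))"
        by (rule mat_trace_add[of _ l]) (auto intro!: carrier_matI)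
      also have "mat_trace (mat_trace (g * M) \<cdot>\<^sub>m (?X * E)) = mat_trace (g * M) * mat_trace (?X * E)"
        by (rule mat_trace_smult[OF mult_carrier_mat[OF Xc Ec]])
      finally show ?thesis .
    qed
    \<comment> \<open>The lost weight: by \<open>tr\<close> for \<open>G\<close> it equals the trace
      of \<open>g * Z'\<close>. Since \<open>g\<close> complements \<open>mat_adjoint A * A\<close>
      and \<open>A * mat_adjoint A = 1\<^sub>m l\<close>, the projection \<open>g\<close> kills
      \<open>mat_adjoint A\<close>, the left factor of \<open>Z'\<close>.\<close>
    also have "mat_trace (g * M) = 0"
    proof -
      have Q1: "mat_adjoint A * A * mat_adjoint A = mat_adjoint A" using AAt by (simp add: mat_assoc)
      have "g * mat_adjoint A = 0\<^sub>m k l"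
      proof -
        have "mat_adjoint A = (mat_adjoint A * A + g) * mat_adjoint A" by (simp add: sum)
        also have "\<dots> = mat_adjoint A + g * mat_adjoint A" using carrier_matD[OF gc] by (simp add: mat_distribs Q1)
        finally have *: "mat_adjoint A = mat_adjoint A + g * mat_adjoint A" .
        show ?thesis
        proof (rule eq_matI)
          fix i j assume ij: "i < dim_row (0\<^sub>m k l :: complex mat)" "j < dim_col (0\<^sub>m k l :: complex mat)"
          have "mat_adjoint A $$ (i, j) = (mat_adjoint A + g * mat_adjoint A) $$ (i, j)" using * by metis
          then show "(g * mat_adjoint A) $$ (i, j) = 0\<^sub>m k l $$ (i, j)"
            using ij carrier_matD[OF gc] by (simp del: index_mult_mat(1))
        qed (use carrier_matD[OF gc] in auto)
      qed
      then have "g * Z' = 0\<^sub>m k k"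
        using carrier_matD[OF gc] by (simp add: Z'_def flip: mat_assoc)
      then show ?thesis using tr[OF GS Zc] by (simp add: M_def g_def mat_trace_def)
    qed
    also have "mat_trace (?X * (A * M * mat_adjoint A)) = mat_trace (?X * A * M * mat_adjoint A)"
      by (simp add: mat_assoc)
    also have "\<dots> = mat_trace (mat_adjoint A * (?X * A * M))"
      by (rule mat_trace_commute[of _ l k]) (auto intro!: carrier_matI)
    also have "mat_adjoint A * (?X * A * M) = mat_adjoint V * (Q * Y * Q) * V * M"
      unfolding WW(2)[symmetric] by (simp add: A_def mat_adjoint_mult mat_assoc)
    also have "Q * Y * Q = Y" using QT(4)[OF Y] by simp
    also have "mat_trace (mat_adjoint V * Y * V * M) = mat_trace (mat_adjoint V * Y * V * Z')"
      using tr[OF YS Zc] by (simp add: M_def)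
    also have "mat_adjoint V * Y * V * Z' = mat_adjoint V * Y * V * mat_adjoint A * Z * A" by (simp add: Z'_def mat_assoc)
    also have "mat_trace \<dots> = mat_trace (A * (mat_adjoint V * Y * V * mat_adjoint A * Z))"
      by (rule mat_trace_commute[of _ k l]) (auto intro!: carrier_matI)
    also have "A * (mat_adjoint V * Y * V * mat_adjoint A * Z) = (mat_adjoint W * P) * Y * (P * W) * Z"
      unfolding VV(2)[symmetric] by (simp add: A_def mat_adjoint_mult mat_assoc)
    also have "\<dots> = ?X * Z" by (simp add: WP PW)
    finally show "mat_trace (?X * ((R \<circ> \<D>) \<circ> restrict_map W \<Phi>) Z) = mat_trace (?X * Z)" by simp
  qed
  then show ?thesis
    unfolding correctable_def using T(1) Q W chD' by blast
qed

text \<open>The image of \<open>B\<close> lies in the correctable image of \<open>A\<close>, and the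
  image of \<open>e\<close> serves as its unit projection.\<close>

lemma transmittable_embeds:
  assumes \<Phi>: "channel n m \<Phi>" and A: "transmittable n m \<Phi> A" and emb: "embeds B A"
    and B: "is_star_algebra B" "finite_dimensional B" "elems B \<noteq> {zero_alg B}"
    and e: "e \<in> elems B" "\<And>x. x \<in> elems B \<Longrightarrow> mult_alg B e x = x \<and> mult_alg B x e = x"
  shows "transmittable n m \<Phi> B"
proof -
  obtain \<pi> where fdA: "fd_cstar_algebra A" and pi: "star_hom A (matrix_alg n) \<pi>" "inj_on \<pi> (elems A)"
    and cor: "correctable n m \<Phi> (\<pi> ` elems A)"
    using A by (auto simp: transmittable_def)
  obtain f where f: "star_hom B A f" "inj_on f (elems B)" using emb by (auto simp: embeds_def)
  have Aalg: "is_star_algebra A" using fdA by (simp add: fd_cstar_algebra_def)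
  obtain N where "is_cstar_norm A N" using fdA by (auto simp: fd_cstar_algebra_def)
  from cstar_norm_pullback[OF B(1) Aalg f this] have fdB: "fd_cstar_algebra B"
    using B by (auto simp: fd_cstar_algebra_def)
  define g where "g = \<pi> \<circ> f"
  have g: "star_hom B (matrix_alg n) g" unfolding g_def by (rule star_hom_comp[OF f(1) pi(1)])
  have sub: "f ` elems B \<subseteq> elems A" using star_homD(1)[OF f(1)] by blast
  have ginj: "inj_on g (elems B)"
    unfolding g_def using comp_inj_on[OF f(2) inj_on_subset[OF pi(2) sub]] .
  note gh = star_homD[OF g, simplified]
  \<comment> \<open>A two-sided unit is self-adjoint: the product of \<open>e\<close> and its
    adjoint equals the adjoint of \<open>e\<close> and is also its own adjoint.\<close>
  have "star B e = e"
  proof -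
    have s: "star B e \<in> elems B" using star_algebraD(5)[OF B(1) e(1)] .
    have 1: "mult_alg B e (star B e) = star B e" using e(2)[OF s] by blast
    have "e = star B (star B e)" using star_algebraD(15)[OF B(1) e(1)] by simp
    also have "\<dots> = star B (mult_alg B e (star B e))" using 1 by simp
    also have "\<dots> = mult_alg B (star B (star B e)) (star B e)" using star_algebraD(18)[OF B(1) e(1) s] .
    also have "\<dots> = mult_alg B e (star B e)" using star_algebraD(15)[OF B(1) e(1)] by simp
    finally show ?thesis using 1 by simp
  qed
  then have "unit_projection (g ` elems B) (g e)"
    unfolding unit_projection_def
    using gh(4)[OF e(1) e(1)] gh(5)[OF e(1)] e gh(4)[OF e(1)] gh(4)[OF _ e(1)] by auto
  moreover have "g ` elems B \<subseteq> \<pi> ` elems A" using sub by (auto simp: g_def)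
  ultimately have "correctable n m \<Phi> (g ` elems B)"
    using correctable_subset[OF \<Phi> cor star_subalgebra_image[OF B(1) g ginj B(3)]] by blast
  then show ?thesis using fdB g ginj by (auto simp: transmittable_def)
qed

lemma block_alg_nonzero:
  assumes "b \<in> set bs" "b > 0"
  shows "elems (block_alg bs) \<noteq> {zero_alg (block_alg bs)}"
proof
  assume *: "elems (block_alg bs) = {zero_alg (block_alg bs)}"
  obtain i where i: "i < length bs" "bs ! i = b" using assms(1) by (auto simp: in_set_conv_nth)
  have "map (\<lambda>b. 1\<^sub>m b) bs \<in> elems (block_alg bs)" by (auto simp: block_alg_elems)
  then have "map (\<lambda>b. 1\<^sub>m b) bs ! i = zero_alg (block_alg bs) ! i" using * by auto
  then have "(1\<^sub>m b :: complex mat) $$ (0, 0) = 0\<^sub>m b b $$ (0, 0)" using i by simp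
  then show False using assms(2) by simp
qed

lemma transmittable_block_alg:
  assumes "channel n m \<Phi>" "transmittable n m \<Phi> A" "embeds (block_alg bs) A" "b \<in> set bs" "b > 0"
  shows "transmittable n m \<Phi> (block_alg bs)"
proof (rule transmittable_embeds[OF assms(1-3) star_algebra_block_alg finite_dimensional_block_alg
      block_alg_nonzero[OF assms(4,5)]])
  show "map (\<lambda>b. 1\<^sub>m b) bs \<in> elems (block_alg bs)" by (auto simp: block_alg_elems)
  show "mult_alg (block_alg bs) (map (\<lambda>b. 1\<^sub>m b) bs) xs = xs \<and> mult_alg (block_alg bs) xs (map (\<lambda>b. 1\<^sub>m b) bs) = xs"
    if "xs \<in> elems (block_alg bs)" for xs
    using that by (auto simp: block_alg_elems intro!: nth_equalityI)
qed

text \<open>Replaces an algebra of any element type by a transmittable copy of type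
  \<open>complex mat star_alg\<close>, over which \<open>dominating_transmittable\<close>
  quantifies, and attaches a list of block sizes to it.\<close>

lemma transmittable_structure:
  assumes "transmittable n m \<Phi> A"
  obtains S bs where "transmittable n m \<Phi> (sub_alg n S)" "embeds A (sub_alg n S)" "embeds (sub_alg n S) A"
    "embeds (sub_alg n S) (block_alg bs)" "embeds (block_alg bs) (sub_alg n S)" "\<forall>b\<in>set bs. b > 0" "bs \<noteq> []"
    "embeds (sub_alg n S) (matrix_alg n)"
proof -
  obtain \<pi> where fdA: "fd_cstar_algebra A" and pi: "star_hom A (matrix_alg n) \<pi>" "inj_on \<pi> (elems A)"
    and cor: "correctable n m \<Phi> (\<pi> ` elems A)"
    using assms by (auto simp: transmittable_def)
  have Aalg: "is_star_algebra A" using fdA by (simp add: fd_cstar_algebra_def)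
  define S where "S = \<pi> ` elems A"
  have Ssub: "star_subalgebra n S" using cor by (simp add: S_def correctable_def)
  then have S: "star_closed n S" by (rule star_subalgebra_star_closed)
  have Salg: "is_star_algebra (sub_alg n S)" by (rule star_algebra_sub_alg[OF S])
  note ph = star_homD[OF pi(1), simplified]
  have pi': "star_hom A (sub_alg n S) \<pi>" using ph by (simp add: star_hom_def S_def)
  define r where "r = inv_into (elems A) \<pi>"
  have r: "r (\<pi> x) = x" if "x \<in> elems A" for x unfolding r_def by (rule inv_into_f_f[OF pi(2) that])
  have rhom: "star_hom (sub_alg n S) A r"
    unfolding star_hom_def sub_alg_simps
  proof (intro conjI ballI allI)
    fix x y assume "x \<in> S" "y \<in> S"
    then obtain a b where ab: "a \<in> elems A" "x = \<pi> a" "b \<in> elems A" "y = \<pi> b" by (auto simp: S_def)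
    show "r (x + y) = add_alg A (r x) (r y)"
      using ab r star_algebraD(2)[OF Aalg ab(1,3)] ph(2)[OF ab(1,3)] by metis
    show "r (x * y) = mult_alg A (r x) (r y)"
      using ab r star_algebraD(3)[OF Aalg ab(1,3)] ph(4)[OF ab(1,3)] by metis
  next
    fix x c assume "x \<in> S"
    then obtain a where a: "a \<in> elems A" "x = \<pi> a" by (auto simp: S_def)
    show "r x \<in> elems A" using a r by simp
    show "r (c \<cdot>\<^sub>m x) = scale_alg A c (r x)"
      using a r star_algebraD(4)[OF Aalg a(1)] ph(3)[OF a(1)] by metis
    show "r (mat_adjoint x) = star A (r x)"
      using a r star_algebraD(5)[OF Aalg a(1)] ph(5)[OF a(1)] by metis
  qed
  have rinj: "inj_on r (elems (sub_alg n S))"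
    unfolding r_def S_def sub_alg_simps by (rule inj_on_inv_into) simp
  have e1: "embeds A (sub_alg n S)" using pi' pi(2) by (rule embedsI)
  have e2: "embeds (sub_alg n S) A" using rhom rinj by (rule embedsI)
  have id: "star_hom (sub_alg n S) (matrix_alg n) (\<lambda>x. x)"
    using star_closedD(1)[OF S] by (auto simp: star_hom_def)
  have e3: "embeds (sub_alg n S) (matrix_alg n)" using id by (rule embedsI) simp
  obtain N where N: "is_cstar_norm A N" using fdA by (auto simp: fd_cstar_algebra_def)
  have "fd_cstar_algebra (sub_alg n S)"
    unfolding fd_cstar_algebra_def
  proof (intro conjI Salg)
    show "finite_dimensional (sub_alg n S)"
      using finite_dimensional_image[OF pi' _ Aalg Salg] fdA by (simp add: fd_cstar_algebra_def S_def)
    show "\<exists>N. is_cstar_norm (sub_alg n S) N"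
      using cstar_norm_pullback[OF Salg Aalg rhom rinj N] by blast
    show "elems (sub_alg n S) \<noteq> {zero_alg (sub_alg n S)}"
      using Ssub by (simp add: star_subalgebra_def)
  qed
  then have T: "transmittable n m \<Phi> (sub_alg n S)"
    unfolding transmittable_def using id cor by (intro conjI exI[of _ "\<lambda>x. x"]) (auto simp: S_def)
  obtain bs where bs: "\<forall>b\<in>set bs. b > 0" "embeds (sub_alg n S) (block_alg bs)" "embeds (block_alg bs) (sub_alg n S)"
    using star_closed_structure[OF S] by blast
  have "bs \<noteq> []"
  proof
    assume "bs = []"
    with bs(2) obtain f where f: "star_hom (sub_alg n S) (block_alg []) f" "inj_on f S"
      by (auto simp: embeds_def)
    have "x = 0\<^sub>m n n" if "x \<in> S" for x
      using inj_onD[OF f(2) _ that star_closedD(2)[OF S]] star_homD(1)[OF f(1), of x]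
        star_homD(1)[OF f(1), of "0\<^sub>m n n"] that star_closedD(2)[OF S] by simp
    then show False using Ssub by (auto simp: star_subalgebra_def)
  qed
  then show ?thesis using that T e1 e2 e3 bs by blast
qed

section \<open>Packing numbers and hybrid capacities\<close>

text \<open>For positive \<open>d\<close>, the largest number of copies of M_d that embed in the sum
  of blocks \<open>bs\<close>.\<close>

definition pack_number :: "nat list \<Rightarrow> nat \<Rightarrow> nat" where
  "pack_number bs d = (\<Sum>b\<leftarrow>bs. b div d)"

lemma embeds_replicate_block_iff:
  assumes "d > 0"
  shows "embeds (block_alg (replicate c d)) (block_alg bs) \<longleftrightarrow> c \<le> pack_number bs d"
proof
  assume "embeds (block_alg (replicate c d)) (block_alg bs)"
  then show "c \<le> pack_number bs d"
    using embeds_replicate_block_bound[OF _ assms] by (simp add: pack_number_def)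
next
  assume c: "c \<le> pack_number bs d"
  let ?css = "map (\<lambda>b. replicate (b div d) d) bs"
  have "concat ?css = replicate (pack_number bs d) d"
    by (induction bs) (auto simp: pack_number_def replicate_add)
  then have "mset (replicate c d) \<subseteq># mset (concat ?css)"
    using c by (auto intro!: mset_subset_eqI)
  moreover have "list_all2 (\<lambda>cs b. sum_list cs \<le> b) ?css bs"
    by (auto simp: list_all2_conv_all_nth sum_list_replicate)
  ultimately show "embeds (block_alg (replicate c d)) (block_alg bs)"
    by (rule embeds_block_packing[rotated])
qed

lemma pack_number_pos_iff: "pack_number bs d > 0 \<longleftrightarrow> (\<exists>b\<in>set bs. b div d > 0)"
  by (induction bs) (auto simp: pack_number_def)

lemma finite_dimensional_matrix_alg: "finite_dimensional (matrix_alg d)"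
proof -
  define L :: "complex mat list" where
    "L = map (\<lambda>(i, j). mat_unit d d i j) (List.product [0..<d] [0..<d])"
  have L: "set L \<subseteq> elems (matrix_alg d)" by (auto simp: L_def)
  have "\<exists>cs. length cs = length L \<and> x = lin_comb (matrix_alg d) (zip cs L)" if "x \<in> carrier_mat d d" for x
    using alg_span_lin_comb[OF star_algebra_matrix_alg L] alg_span_matrix_alg[OF that] by (simp add: L_def)
  then show ?thesis using L unfolding finite_dimensional_def by (intro exI[of _ L]) auto
qed

text \<open>The counterpart of \<open>transmittable_block_alg\<close> for a single block, because
  \<open>d_max\<close> is phrased with \<open>matrix_alg d\<close> and not with a sum of length
  one.\<close>

lemma transmittable_matrix_alg:
  assumes "channel n m \<Phi>" "transmittable n m \<Phi> A" "embeds (block_alg [d]) A" "d > 0"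
  shows "transmittable n m \<Phi> (matrix_alg d)"
proof (rule transmittable_embeds[OF assms(1,2) _ star_algebra_matrix_alg finite_dimensional_matrix_alg])
  show "embeds (matrix_alg d) A" using embeds_trans[OF embeds_matrix_block_single(1) assms(3)] .
  have "(1\<^sub>m d :: complex mat) $$ (0, 0) \<noteq> 0\<^sub>m d d $$ (0, 0)" using assms(4) by simp
  then have "(1\<^sub>m d :: complex mat) \<noteq> 0\<^sub>m d d" by metis
  then show "elems (matrix_alg d) \<noteq> {zero_alg (matrix_alg d)}"
    using one_carrier_mat[of d] by (metis matrix_alg_simps(1,2) singletonD)
  show "1\<^sub>m d \<in> elems (matrix_alg d)" by simp
qed auto

lemma transmittable_matrix_alg_pos:
  assumes "transmittable n m \<Phi> (matrix_alg d)"
  shows "d > 0"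
proof (rule ccontr)
  assume "\<not> d > 0"
  then have "elems (matrix_alg d) = {zero_alg (matrix_alg d)}" by (auto intro!: eq_matI)
  then show False using assms by (simp add: transmittable_def fd_cstar_algebra_def)
qed

lemma transmittable_embeds_matrix_alg: "transmittable n m \<Phi> A \<Longrightarrow> embeds A (matrix_alg n)"
  by (auto simp: transmittable_def embeds_def)

text \<open>The dimension bound makes the maximum in \<open>hybrid_capacity\<close> one over a
  finite set. The value 0 is excluded because the empty sum is the zero algebra.\<close>

lemma transmittable_replicate:
  assumes "transmittable n m \<Phi> (block_alg (replicate c d))" "d > 0"
  shows "0 < c" "c * d \<le> n"
proof -
  show "0 < c"
    using assms by (auto simp: transmittable_def fd_cstar_algebra_def intro!: Nat.gr0I)
  have "embeds (block_alg (replicate c d)) (block_alg [n])"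
    using embeds_trans[OF transmittable_embeds_matrix_alg[OF assms(1)] embeds_matrix_block_single(1)] .
  then have "c \<le> n div d" using assms(2) by (simp add: embeds_replicate_block_iff pack_number_def)
  then show "c * d \<le> n" using assms(2) by (simp add: less_eq_div_iff_mult_less_eq)
qed

lemma transmittable_matrix_alg_le:
  assumes "transmittable n m \<Phi> (matrix_alg d)"
  shows "d \<le> n"
proof -
  have "embeds (block_alg (replicate 1 d)) (block_alg [n])"
    using embeds_trans[OF embeds_trans[OF embeds_matrix_block_single(2)
        transmittable_embeds_matrix_alg[OF assms]] embeds_matrix_block_single(1)] by simp
  then have "1 \<le> n div d"
    using transmittable_matrix_alg_pos[OF assms] embeds_replicate_block_iff[of d 1 "[n]"] by (simp add: pack_number_def)
  then show ?thesis by (metis div_less not_less not_one_le_zero)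
qed

lemma d_max_ge:
  assumes "transmittable n m \<Phi> (matrix_alg d)"
  shows "d \<le> d_max n m \<Phi>"
  unfolding d_max_def
  by (rule Max_ge[OF finite_subset[of _ "{..n}"]]) (use assms transmittable_matrix_alg_le in auto)

lemma direct_sum_replicate: "direct_sum (replicate c (matrix_alg d)) = block_alg (replicate c d)"
  by (simp add: block_alg_def)

lemma hybrid_capacity_ge:
  assumes "transmittable n m \<Phi> (block_alg (replicate c d))" "d > 0"
  shows "c \<le> hybrid_capacity n m \<Phi> d"
  unfolding hybrid_capacity_def direct_sum_replicate
proof (rule Max_ge)
  have "c \<le> n" if "transmittable n m \<Phi> (block_alg (replicate c d))" for c
  proof -
    have "c \<le> c * d" using assms(2) by (cases d) auto
    then show ?thesis using transmittable_replicate(2)[OF that assms(2)] by (rule order.trans)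
  qed
  then show "finite {c. transmittable n m \<Phi> (block_alg (replicate c d))}"
    by - (rule finite_subset[of _ "{..n}"], auto)
qed (use assms in simp)

section \<open>The recursion for the multiplicities and the two implications\<close>

definition cap_list :: "nat \<Rightarrow> nat \<Rightarrow> (complex mat \<Rightarrow> complex mat) \<Rightarrow> nat list" where
  "cap_list n m \<Phi> = concat (map (\<lambda>d. replicate (nat (cap_mult n m \<Phi> d)) d) [1..<Suc (d_max n m \<Phi>)])"

lemma cap_algebra_block_alg: "cap_algebra n m \<Phi> = block_alg (cap_list n m \<Phi>)"
  by (simp add: cap_algebra_def block_alg_def cap_list_def map_concat comp_def)

lemma count_list_replicate: "count_list (replicate k a) x = (if x = a then k else 0)"
  by (induction k) auto

lemma count_concat_replicate:
  "count_list (concat (map (\<lambda>d. replicate (f d) d) [1..<Suc D])) x = (if 1 \<le> x \<and> x \<le> D then f x else 0)"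
  by (induction D) (auto simp: count_list_append count_list_replicate)

text \<open>Blocks smaller than \<open>d\<close> hold no copy of M_d and those of size
  \<open>d\<close> exactly one. The identity has the shape of the recursion for N_d, with block
  counts as multiplicities.\<close>

lemma pack_number_count:
  assumes "set bs \<subseteq> {1..D}" "1 \<le> d" "d \<le> D"
  shows "pack_number bs d = count_list bs d + (\<Sum>k\<in>{d+1..D}. count_list bs k * (k div d))"
proof -
  have "pack_number bs d = (\<Sum>k\<in>{1..D}. count_list bs k * (k div d))"
    unfolding pack_number_def using sum_list_map_eq_sum_count2[OF assms(1)] by simp
  also have "\<dots> = (\<Sum>k\<in>{d..D}. count_list bs k * (k div d))"
    using assms by (intro sum.mono_neutral_right) auto
  also have "{d..D} = insert d {d+1..D}" using assms by auto
  finally show ?thesis using assms by simp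
qed

text \<open>Once the multiplicities of larger blocks are natural numbers, the integer recursion with
  floors can be compared with \<open>pack_number_count\<close>.\<close>

lemma cap_mult_nat:
  assumes d: "1 \<le> d" and N: "\<And>k. k \<in> {d+1..d_max n m \<Phi>} \<Longrightarrow> cap_mult n m \<Phi> k = int (N k)"
  shows "cap_mult n m \<Phi> d =
    int (hybrid_capacity n m \<Phi> d) - int (\<Sum>k\<in>{d+1..d_max n m \<Phi>}. N k * (k div d))"
proof -
  have "(\<Sum>k\<in>{d+1..d_max n m \<Phi>}. cap_mult n m \<Phi> k * \<lfloor>real k / real d\<rfloor>) =
      (\<Sum>k\<in>{d+1..d_max n m \<Phi>}. int (N k * (k div d)))"
    using N by (intro sum.cong) (auto simp: floor_divide_of_nat_eq)
  then show ?thesis by (subst cap_mult.simps) simp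
qed

lemma dominating_imp_cap_transmittable:
  assumes \<Phi>: "channel n m \<Phi>" and A: "dominating_transmittable n m \<Phi> A"
  shows "cap_defined n m \<Phi> \<and> transmittable n m \<Phi> (cap_algebra n m \<Phi>)"
proof -
  have TA: "transmittable n m \<Phi> A" using A by (simp add: dominating_transmittable_def)
  obtain S bs where S: "embeds A (sub_alg n S)" "embeds (sub_alg n S) A"
    "embeds (sub_alg n S) (block_alg bs)" "embeds (block_alg bs) (sub_alg n S)"
    and pos: "\<forall>b\<in>set bs. b > 0" and ne: "bs \<noteq> []"
    by (rule transmittable_structure[OF TA]) blast
  have Abs: "embeds A (block_alg bs)" and bsA: "embeds (block_alg bs) A"
    using embeds_trans[OF S(1,3)] embeds_trans[OF S(4,2)] by auto
  have dom: "embeds B (block_alg bs)" if "transmittable n m \<Phi> B" for B :: "complex mat star_alg"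
    using that A embeds_trans[OF _ Abs] by (auto simp: dominating_transmittable_def)
  have T: "transmittable n m \<Phi> (block_alg (replicate c d)) \<longleftrightarrow> 1 \<le> c \<and> c \<le> pack_number bs d"
    if d: "d > 0" for c d
  proof
    \<comment> \<open>The sum of blocks consists of lists, so \<open>dom\<close> is applied to its
      copy of type \<open>complex mat star_alg\<close>.\<close>
    assume t: "transmittable n m \<Phi> (block_alg (replicate c d))"
    obtain S' where "transmittable n m \<Phi> (sub_alg n S')" "embeds (block_alg (replicate c d)) (sub_alg n S')"
      by (rule transmittable_structure[OF t]) blast
    then have "embeds (block_alg (replicate c d)) (block_alg bs)" using dom embeds_trans by blast
    then show "1 \<le> c \<and> c \<le> pack_number bs d"
      using transmittable_replicate(1)[OF t d] embeds_replicate_block_iff[OF d] by simp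
  next
    assume c: "1 \<le> c \<and> c \<le> pack_number bs d"
    then have "embeds (block_alg (replicate c d)) A"
      using embeds_replicate_block_iff[OF d] embeds_trans[OF _ bsA] by blast
    then show "transmittable n m \<Phi> (block_alg (replicate c d))"
      using c d by (intro transmittable_block_alg[OF \<Phi> TA, of _ d]) auto
  qed
  have TM: "transmittable n m \<Phi> (matrix_alg d) \<longleftrightarrow> d > 0 \<and> (\<exists>b\<in>set bs. d \<le> b)" for d
  proof
    assume t: "transmittable n m \<Phi> (matrix_alg d)"
    have d: "d > 0" by (rule transmittable_matrix_alg_pos[OF t])
    have "embeds (block_alg (replicate 1 d)) (block_alg bs)"
      using embeds_trans[OF embeds_matrix_block_single(2) dom[OF t]] by simp
    then have "pack_number bs d > 0" using embeds_replicate_block_iff[OF d, of 1 bs] by simp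
    then show "d > 0 \<and> (\<exists>b\<in>set bs. d \<le> b)"
      using d by (auto simp: pack_number_pos_iff div_greater_zero_iff)
  next
    assume d: "d > 0 \<and> (\<exists>b\<in>set bs. d \<le> b)"
    then have "pack_number bs d > 0" by (auto simp: pack_number_pos_iff div_greater_zero_iff)
    then have "embeds (block_alg [d]) (block_alg bs)"
      using d embeds_replicate_block_iff[of d 1 bs] by simp
    from transmittable_matrix_alg[OF \<Phi> TA embeds_trans[OF this bsA]] d
    show "transmittable n m \<Phi> (matrix_alg d)" by blast
  qed
  let ?D = "d_max n m \<Phi>"
  have D: "?D = Max (set bs)"
    unfolding d_max_def TM
  proof (rule Max_eqI)
    show "finite {d. 0 < d \<and> (\<exists>b\<in>set bs. d \<le> b)}"
      by (rule finite_subset[of _ "{..Max (set bs)}"]) (auto intro: order.trans[OF _ Max_ge])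
    show "y \<le> Max (set bs)" if "y \<in> {d. 0 < d \<and> (\<exists>b\<in>set bs. d \<le> b)}" for y
      using that by (auto intro: order.trans[OF _ Max_ge])
    have "Max (set bs) \<in> set bs" using ne by (intro Max_in) auto
    then show "Max (set bs) \<in> {d. 0 < d \<and> (\<exists>b\<in>set bs. d \<le> b)}" using pos by blast
  qed
  have sub: "set bs \<subseteq> {1..?D}" using pos by (auto simp: D Suc_le_eq)
  have Dbs: "?D \<in> set bs" unfolding D using ne by (intro Max_in) auto
  have hc: "hybrid_capacity n m \<Phi> d = pack_number bs d" if d: "1 \<le> d" "d \<le> ?D" for d
  proof -
    have "pack_number bs d > 0" using d Dbs by (auto simp: pack_number_pos_iff div_greater_zero_iff)
    then have "Max {1..pack_number bs d} = pack_number bs d" by (intro Max_eqI) simp_all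
    moreover have "d > 0" using d by simp
    then have "{c. transmittable n m \<Phi> (block_alg (replicate c d))} = {1..pack_number bs d}"
      unfolding T[OF \<open>d > 0\<close>] by auto
    ultimately show ?thesis
      unfolding hybrid_capacity_def direct_sum_replicate by metis
  qed
  \<comment> \<open>Downward induction on \<open>d\<close>: with the larger multiplicities already
    identified as counts, the recursion solves \<open>pack_number_count\<close> for the count of
    \<open>d\<close>.\<close>
  have cm: "cap_mult n m \<Phi> d = int (count_list bs d)" if "1 \<le> d" "d \<le> ?D" for d
    using that
  proof (induction "?D - d" arbitrary: d rule: less_induct)
    case less
    have "cap_mult n m \<Phi> d =
        int (hybrid_capacity n m \<Phi> d) - int (\<Sum>k\<in>{d+1..?D}. count_list bs k * (k div d))"
      using less.prems by (intro cap_mult_nat less.hyps) auto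
    then show ?case using hc[OF less.prems] pack_number_count[OF sub less.prems] by simp
  qed
  have "mset (cap_list n m \<Phi>) = mset bs"
  proof (rule multiset_eqI)
    fix x
    show "count (mset (cap_list n m \<Phi>)) x = count (mset bs) x"
      using cm[of x] sub unfolding cap_list_def count_mset count_concat_replicate
      by (auto simp: count_list_0_iff)
  qed
  then have "embeds (block_alg (cap_list n m \<Phi>)) A" and "set (cap_list n m \<Phi>) = set bs"
    using embeds_trans[OF embeds_block_permute[of bs "cap_list n m \<Phi>"] bsA] mset_eq_setD by auto
  then have "transmittable n m \<Phi> (cap_algebra n m \<Phi>)"
    unfolding cap_algebra_block_alg using Dbs pos
    by (intro transmittable_block_alg[OF \<Phi> TA, of _ ?D]) auto
  then show ?thesis using cm by (auto simp: cap_defined_def)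
qed

lemma mset_concat_replicate: "count (mset (concat (replicate k xs))) a = k * count (mset xs) a"
  by (induction k) auto

text \<open>Threes go into threes, twos into twos and then into the remaining threes; ones fill the rest.\<close>

lemma embeds_block_le_3:
  assumes ks: "set ks \<subseteq> {1..3}" and bs: "set bs \<subseteq> {1..3}"
    and le: "\<And>d. d \<in> {1..3} \<Longrightarrow> pack_number ks d \<le> pack_number bs d"
  shows "embeds (block_alg ks) (block_alg bs)"
proof -
  let ?k = "count_list ks" and ?n = "count_list bs"
  have ranges: "{3+1..3::nat} = {}" "{2+1..3::nat} = {3}" "{1+1..3::nat} = {2, 3}" by auto
  have le3: "?k 3 \<le> ?n 3"
    using le[of 3] pack_number_count[OF ks, of 3] pack_number_count[OF bs, of 3] ranges by simp
  have le2: "?k 2 + ?k 3 \<le> ?n 2 + ?n 3"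
    using le[of 2] pack_number_count[OF ks, of 2] pack_number_count[OF bs, of 2] ranges by simp
  have le1: "?k 1 + 2 * ?k 2 + 3 * ?k 3 \<le> ?n 1 + 2 * ?n 2 + 3 * ?n 3"
    using le[of 1] pack_number_count[OF ks, of 1] pack_number_count[OF bs, of 1] ranges by simp
  \<comment> \<open>\<open>t\<close> counts the twos that overflow into threes, truncated
    subtraction giving 0 if there are none; \<open>u\<close> counts the twos placed in twos, and
    \<open>r\<close> the threes left empty. By \<open>le2\<close> and \<open>le3\<close> the
    subtraction in \<open>r\<close> is exact.\<close>
  define t where "t = ?k 2 - ?n 2"
  define u where "u = min (?k 2) (?n 2)"
  define r where "r = ?n 3 - ?k 3 - t"
  have n3: "?n 3 = ?k 3 + (t + r)" using le2 le3 by (auto simp: r_def t_def)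
  have n2: "?n 2 = u + (?n 2 - u)" by (simp add: u_def)
  \<comment> \<open>Every list of the plan fills its block completely; a two in a three, for
    instance, leaves a place for a one.\<close>
  define css :: "nat list list" where
    "css = replicate (?k 3) [3] @ replicate t [2, 1] @ replicate r [1, 1, 1] @
      replicate u [2] @ replicate (?n 2 - u) [1, 1] @ replicate (?n 1) [1]"
  define bs' :: "nat list" where
    "bs' = replicate (?k 3) 3 @ replicate t 3 @ replicate r 3 @
      replicate u 2 @ replicate (?n 2 - u) 2 @ replicate (?n 1) 1"
  have "list_all2 (\<lambda>cs b. sum_list cs \<le> b) css bs'"
    unfolding css_def bs'_def by (intro list_all2_appendI) (auto simp: list_all2_conv_all_nth)
  moreover have "mset ks \<subseteq># mset (concat css)"
  proof (rule mset_subset_eqI)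
    fix a
    show "count (mset ks) a \<le> count (mset (concat css)) a"
    proof (cases "a \<in> {1..3}")
      case True
      then have "a = 1 \<or> a = 2 \<or> a = 3" by auto
      moreover have "?k 2 \<le> t + u" by (auto simp: t_def u_def)
      \<comment> \<open>As no room is wasted, the places for ones make up exactly the total size
        left by twos and threes, so \<open>le1\<close> is all that remains to be used.\<close>
      moreover have "?k 1 \<le> t + 3 * r + 2 * (?n 2 - u) + ?n 1"
        using le1 n3 by (auto simp: t_def u_def)
      ultimately show ?thesis by (auto simp: css_def mset_concat_replicate count_mset[of ks])
    next
      case False
      then have "a \<notin> set ks" using ks by blast
      then show ?thesis by (metis count_mset_0_iff zero_le)
    qed
  qed
  ultimately have "embeds (block_alg ks) (block_alg bs')" by (rule embeds_block_packing)
  moreover have "mset bs = mset bs'"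
  proof (rule multiset_eqI)
    fix a
    show "count (mset bs) a = count (mset bs') a"
    proof (cases "a \<in> {1..3}")
      case True
      then have "a = 1 \<or> a = 2 \<or> a = 3" by auto
      then show ?thesis using n3 n2 by (auto simp: bs'_def count_mset[of bs])
    next
      case False
      then have "a \<notin> set bs" using bs by blast
      then show ?thesis using False by (auto simp: bs'_def count_mset count_list_0_iff)
    qed
  qed
  then have "embeds (block_alg bs') (block_alg bs)" by (rule embeds_block_permute)
  ultimately show ?thesis by (rule embeds_trans)
qed

lemma cap_transmittable_imp_dominating:
  assumes \<Phi>: "channel n m \<Phi>" and D3: "d_max n m \<Phi> \<le> 3"
    and def: "cap_defined n m \<Phi>" and cap: "transmittable n m \<Phi> (cap_algebra n m \<Phi>)"
  shows "\<exists>A. dominating_transmittable n m \<Phi> A"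
proof -
  let ?D = "d_max n m \<Phi>"
  define bs where "bs = cap_list n m \<Phi>"
  have sub: "set bs \<subseteq> {1..?D}" by (auto simp: bs_def cap_list_def)
  have cm: "cap_mult n m \<Phi> d = int (count_list bs d)" if "1 \<le> d" "d \<le> ?D" for d
    using def that unfolding bs_def cap_list_def count_concat_replicate by (auto simp: cap_defined_def)
  \<comment> \<open>The recursion read backwards: nonnegative multiplicities are the block counts of
    the capacity algebra, so each c_d is its packing number.\<close>
  have hc: "hybrid_capacity n m \<Phi> d = pack_number bs d" if d: "1 \<le> d" "d \<le> ?D" for d
  proof -
    have "cap_mult n m \<Phi> d =
        int (hybrid_capacity n m \<Phi> d) - int (\<Sum>k\<in>{d+1..?D}. count_list bs k * (k div d))"
      using d by (intro cap_mult_nat cm) auto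
    then show ?thesis using cm[OF d] pack_number_count[OF sub d] by linarith
  qed
  \<comment> \<open>The dominating algebra has to consist of matrices, so a copy of the capacity
    algebra inside L(H) is exhibited.\<close>
  obtain S where S: "transmittable n m \<Phi> (sub_alg n S)" "embeds (cap_algebra n m \<Phi>) (sub_alg n S)"
    by (rule transmittable_structure[OF cap]) blast
  have "embeds B (sub_alg n S)" if B: "transmittable n m \<Phi> B" for B :: "complex mat star_alg"
  proof -
    obtain S' ks where S': "embeds B (sub_alg n S')" "embeds (sub_alg n S') B"
      "embeds (sub_alg n S') (block_alg ks)" "embeds (block_alg ks) (sub_alg n S')"
      and pos: "\<forall>k\<in>set ks. k > 0"
      by (rule transmittable_structure[OF B]) blast
    have Bks: "embeds B (block_alg ks)" and ksB: "embeds (block_alg ks) B"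
      using embeds_trans[OF S'(1,3)] embeds_trans[OF S'(4,2)] by auto
    have kD: "k \<le> ?D" if k: "k \<in> set ks" for k
    proof -
      have k0: "k > 0" using pos k by blast
      have "pack_number ks k > 0" using k k0 by (auto simp: pack_number_pos_iff intro!: bexI[of _ k])
      then have "embeds (block_alg (replicate 1 k)) (block_alg ks)"
        using embeds_replicate_block_iff[OF k0, of 1 ks] by simp
      then have "embeds (block_alg [k]) B" using embeds_trans[OF _ ksB] by simp
      from transmittable_matrix_alg[OF \<Phi> B this k0] show ?thesis by (rule d_max_ge)
    qed
    have "pack_number ks d \<le> pack_number bs d" if d: "d \<in> {1..3}" for d
    \<comment> \<open>Capacities are known up to \<open>d_max\<close> only. A nonzero packing number
      implies a block of size at least \<open>d\<close>, hence that \<open>d\<close> is in this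
      range.\<close>
    proof (cases "pack_number ks d = 0")
      case False
      then obtain k where "k \<in> set ks" "d \<le> k"
        using pack_number_pos_iff[of ks d] by (auto simp: div_greater_zero_iff)
      then have dD: "1 \<le> d" "d \<le> ?D" using kD d by (auto intro: order.trans)
      have "embeds (block_alg (replicate (pack_number ks d) d)) B"
        using embeds_replicate_block_iff[of d "pack_number ks d" ks] dD embeds_trans[OF _ ksB] by simp
      then have "transmittable n m \<Phi> (block_alg (replicate (pack_number ks d) d))"
        using False dD by (intro transmittable_block_alg[OF \<Phi> B, of _ d]) auto
      then show ?thesis using hybrid_capacity_ge[of n m \<Phi> _ d] dD hc[OF dD] by auto
    qed simp
    note le = this
    have "set ks \<subseteq> {1..3}" using kD pos D3 by (force simp: Suc_le_eq)
    moreover have "set bs \<subseteq> {1..3}" using sub D3 by force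
    ultimately have "embeds (block_alg ks) (block_alg bs)" using le by (rule embeds_block_le_3)
    from embeds_trans[OF Bks this] have "embeds B (cap_algebra n m \<Phi>)"
      by (simp add: cap_algebra_block_alg bs_def)
    then show ?thesis using S(2) by (rule embeds_trans)
  qed
  then show ?thesis using S(1) by (auto simp: dominating_transmittable_def)
qed

theorem corollary4p14:
  fixes n m :: nat and \<Phi> :: "complex mat \<Rightarrow> complex mat"
  assumes "n > 0" and "channel n m \<Phi>" and "d_max n m \<Phi> \<le> 3"
  shows "(\<exists>A. dominating_transmittable n m \<Phi> A) \<longleftrightarrow>
         cap_defined n m \<Phi> \<and> transmittable n m \<Phi> (cap_algebra n m \<Phi>)"
  using dominating_imp_cap_transmittable cap_transmittable_imp_dominating assms by blast

end
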